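(* Let $p>2$ be a prime, let $K$ be the completion of the maximal unramified extension of $\mathbb{Q}_p$, let $\overline{K}$ be an algebraic closure of $K$ and $\mathcal{O}=\mathcal{O}_{\overline{K}}$. Let $\mathscr{F}$ be a strict formal group of dimension $g$ over $\mathrm{Spf}(\mathcal{O}_K)$. Then for every $0\neq P=(x_1,\dots,x_g)\in\mathscr{F}[p](\mathcal{O})$, the extension $K(P)/K$ is tamely ramified and $\mathcal{O}_{K(P)}\cong\mathcal{O}_K[x_1,\dots,x_g]$. Moreover, $K(\mathscr{F}[p])/K$ is tamely ramified.
   Context: Write the multiplication-by-$p$ map of $\mathscr{F}$ as $[p](X_1,\dots,X_g)=(f_1,\dots,f_g)$ with $f_i\in\mathcal{O}_K[[X_1,\dots,X_g]]$. For each $i$, let $F_i$ be the form consisting of those monomials of $f_i$ that have unit coefficient and are of minimal total degree among such monomials (each $X_k$ having degree 1); let $d_i$ be the degree of $F_i$, and let $G_i$ be the reduction of $F_i$ modulo $p$. The formal group $\mathscr{F}$ is called strict if $d_1=d_2=\cdots=d_g$ and the only solution in $(\overline{\mathbb{F}}_p)^g$ of the system $G_1=G_2=\cdots=G_g=0$ is $(0,\dots,0)$. $\mathscr{F}[p](\mathcal{O})$ denotes the $p$-torsion points of $\mathscr{F}$ with coordinates in the maximal ideal of $\mathcal{O}$, and $K(\mathscr{F}[p])$ is the field generated over $K$ by the coordinates of all such points. *)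

theory Defs
  imports "HOL-Analysis.Analysis" "HOL-Algebra.Algebraic_Closure_Type"
    "HOL-Algebra.Generated_Fields"
begin

unbundle no fps_syntax

section \<open>Non-archimedean valued fields\<close>

text \<open>
  The metric is the one induced by the absolute value, so that completeness, closure and summability
  are the library notions.
\<close>

class nonarch_field = field + metric_space +
  fixes absv :: "'a \<Rightarrow> real"
  assumes dist_absv: "dist x y = absv (x - y)"
    and absv_mult: "absv (x * y) = absv x * absv y"
    and absv_add: "absv (x + y) \<le> max (absv x) (absv y)"
begin

lemma absv_ge_0 [simp]: "0 \<le> absv x"
  using zero_le_dist[of x 0] by (simp add: dist_absv)

lemma absv_eq_0 [simp]: "absv x = 0 \<longleftrightarrow> x = 0"
  using dist_eq_0_iff[of x 0] by (simp add: dist_absv)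

lemma absv_0 [simp]: "absv 0 = 0"
  by simp

lemma absv_1 [simp]: "absv 1 = 1"
  using absv_mult[of 1 1] absv_eq_0[of 1] by simp

lemma absv_uminus [simp]: "absv (- x) = absv x"
  using dist_commute[of x 0] by (simp add: dist_absv)

lemma absv_diff: "absv (x - y) \<le> max (absv x) (absv y)"
  using absv_add[of x "- y"] by simp

lemma absv_add_le_1: "absv x \<le> 1 \<Longrightarrow> absv y \<le> 1 \<Longrightarrow> absv (x + y) \<le> 1"
  by (rule order_trans[OF absv_add]) simp

lemma absv_diff_le_1: "absv x \<le> 1 \<Longrightarrow> absv y \<le> 1 \<Longrightarrow> absv (x - y) \<le> 1"
  by (rule order_trans[OF absv_diff]) simp

lemma absv_mult_le_1: "absv x \<le> 1 \<Longrightarrow> absv y \<le> 1 \<Longrightarrow> absv (x * y) \<le> 1"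
  by (simp add: absv_mult mult_le_one)

lemma absv_inverse: "absv (inverse x) = inverse (absv x)"
proof (cases "x = 0")
  case False
  then have "absv x * absv (inverse x) = 1"
    by (simp flip: absv_mult)
  then show ?thesis
    by (simp add: Fields.inverse_unique)
qed simp

end

text \<open>The residue field of the whole field \<^typ>\<open>'a\<close>: integral elements modulo the maximal ideal.\<close>

definition residue_rel :: "'a::nonarch_field \<Rightarrow> 'a \<Rightarrow> bool" where
  "residue_rel x y \<longleftrightarrow> absv x \<le> 1 \<and> absv y \<le> 1 \<and> absv (x - y) < 1"

lemma residue_rel_eqI: "x = y \<Longrightarrow> absv x \<le> 1 \<Longrightarrow> residue_rel x y"
  by (simp add: residue_rel_def)

lemma residue_rel_integral: "residue_rel x y \<Longrightarrow> absv x \<le> 1"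
  by (simp add: residue_rel_def)

quotient_type (overloaded) 'a residue = "'a::nonarch_field" / partial: residue_rel
proof (rule part_equivpI)
  show "\<exists>x. residue_rel x (x :: 'a)"
    by (rule exI[of _ 0]) (simp add: residue_rel_def)
  show "symp (residue_rel :: 'a \<Rightarrow> _)"
    by (rule sympI) (metis dist_commute dist_absv residue_rel_def)
  show "transp (residue_rel :: 'a \<Rightarrow> _)"
  proof (rule transpI)
    fix x y z :: 'a
    assume "residue_rel x y" "residue_rel y z"
    then show "residue_rel x z"
      using absv_add[of "x - y" "y - z"] by (auto simp: residue_rel_def)
  qed
qed

lemma residue_rel_mult:
  assumes "residue_rel x x'" "residue_rel y y'"
  shows "residue_rel (x * y) (x' * y')"
proof -
  have "absv (x * y) \<le> 1" "absv (x' * y') \<le> 1"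
    using assms by (auto simp: residue_rel_def absv_mult mult_le_one)
  moreover have "absv (x * (y - y')) < 1" "absv ((x - x') * y') < 1"
    using assms mult_left_le_one_le[of "absv (y - y')" "absv x"]
      mult_right_le_one_le[of "absv (x - x')" "absv y'"]
    by (auto simp: residue_rel_def absv_mult)
  moreover have "x * y - x' * y' = x * (y - y') + (x - x') * y'"
    by (simp add: algebra_simps)
  ultimately show ?thesis
    using absv_add[of "x * (y - y')" "(x - x') * y'"]
    by (auto simp: residue_rel_def)
qed

lemma residue_rel_inverse:
  assumes "residue_rel x x'"
  shows "residue_rel (if absv x = 1 then inverse x else 0) (if absv x' = 1 then inverse x' else 0)"
proof -
  have "absv x = 1 \<longleftrightarrow> absv x' = 1"
    using assms absv_add[of "x - x'" x'] absv_diff[of x "x - x'"]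
    by (auto simp: residue_rel_def)
  moreover have "absv (inverse x - inverse x') < 1" if "absv x = 1" "absv x' = 1"
  proof -
    from that have "x \<noteq> 0" "x' \<noteq> 0" by auto
    then have "inverse x - inverse x' = inverse x * (x' - x) * inverse x'"
      by (simp add: field_simps)
    then have "absv (inverse x - inverse x') = absv (x' - x)"
      using that by (simp add: absv_mult absv_inverse)
    then show ?thesis
      using assms by (metis dist_commute dist_absv residue_rel_def)
  qed
  ultimately show ?thesis
    by (auto simp: residue_rel_def absv_inverse)
qed

instantiation residue :: (nonarch_field) field
begin

lift_definition zero_residue :: "'a residue" is 0
  by (simp add: residue_rel_def)

lift_definition one_residue :: "'a residue" is 1
  by (simp add: residue_rel_def)

lift_definition plus_residue :: "'a residue \<Rightarrow> 'a residue \<Rightarrow> 'a residue" is "(+)"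
proof -
  fix x x' y y' :: 'a
  assume *: "residue_rel x x'" "residue_rel y y'"
  have "absv (x + y) \<le> 1" "absv (x' + y') \<le> 1"
    by (rule order_trans[OF absv_add]; use * in \<open>simp add: residue_rel_def\<close>)+
  moreover have "absv ((x - x') + (y - y')) < 1"
    by (rule le_less_trans[OF absv_add]) (use * in \<open>simp add: residue_rel_def\<close>)
  moreover have "x + y - (x' + y') = (x - x') + (y - y')" by simp
  ultimately show "residue_rel (x + y) (x' + y')"
    by (simp only: residue_rel_def)
qed

lift_definition uminus_residue :: "'a residue \<Rightarrow> 'a residue" is uminus
  by (auto simp: residue_rel_def) (metis dist_commute dist_absv)

lift_definition minus_residue :: "'a residue \<Rightarrow> 'a residue \<Rightarrow> 'a residue" is "(-)"
proof -
  fix x x' y y' :: 'a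
  assume *: "residue_rel x x'" "residue_rel y y'"
  have "absv (x - y) \<le> 1" "absv (x' - y') \<le> 1"
    by (rule order_trans[OF absv_diff]; use * in \<open>simp add: residue_rel_def\<close>)+
  moreover have "absv ((x - x') - (y - y')) < 1"
    by (rule le_less_trans[OF absv_diff]) (use * in \<open>simp add: residue_rel_def\<close>)
  moreover have "x - y - (x' - y') = (x - x') - (y - y')" by simp
  ultimately show "residue_rel (x - y) (x' - y')"
    by (simp only: residue_rel_def)
qed

lift_definition times_residue :: "'a residue \<Rightarrow> 'a residue \<Rightarrow> 'a residue" is "(*)"
  by (rule residue_rel_mult)

lift_definition inverse_residue :: "'a residue \<Rightarrow> 'a residue" is
  "\<lambda>x. if absv x = 1 then inverse x else 0"
  by (rule residue_rel_inverse)

definition divide_residue :: "'a residue \<Rightarrow> 'a residue \<Rightarrow> 'a residue" where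
  "divide_residue x y = x * inverse y"

instance
proof
  fix a b c :: "'a residue"
  show "a * b * c = a * (b * c)" "a * b = b * a" "1 * a = a" "a + b + c = a + (b + c)"
    "a + b = b + a" "0 + a = a" "- a + a = 0" "a - b = a + - b" "(a + b) * c = a * c + b * c"
    by (transfer; rule residue_rel_eqI;
        simp add: residue_rel_integral absv_add_le_1 absv_diff_le_1 absv_mult_le_1 algebra_simps)+
  show "(0 :: 'a residue) \<noteq> 1"
    by transfer (simp add: residue_rel_def)
  show "a \<noteq> 0 \<Longrightarrow> inverse a * a = 1"
  proof transfer
    fix a :: 'a
    assume "residue_rel a a" "\<not> residue_rel a 0"
    then have a: "absv a = 1" by (auto simp: residue_rel_def)
    then have "a \<noteq> 0" by auto
    with a show "residue_rel ((if absv a = 1 then inverse a else 0) * a) 1"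
      by (simp add: residue_rel_def)
  qed
  show "a div b = a * inverse b"
    by (simp add: divide_residue_def)
  show "inverse (0 :: 'a residue) = 0"
    by transfer (simp add: residue_rel_def)
qed

end

lift_definition reduce :: "'a::nonarch_field \<Rightarrow> 'a residue" is
  "\<lambda>x. if absv x \<le> 1 then x else 0"
  by (simp add: residue_rel_def)

section \<open>Subfields and their extensions\<close>

text \<open>Subfields are subsets of an ambient field \<^typ>\<open>'a\<close>, and carry the restricted absolute value.\<close>

definition field_adjoin :: "'a::field set \<Rightarrow> 'a set \<Rightarrow> 'a set" where
  "field_adjoin K S = generate_field ring_of_type_algebra (K \<union> S)"

definition ring_adjoin :: "'a::field set \<Rightarrow> 'a set \<Rightarrow> 'a set" where
  "ring_adjoin A S = generate_ring ring_of_type_algebra (A \<union> S)"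

definition finite_extension :: "'a::field set \<Rightarrow> 'a set \<Rightarrow> bool" where
  "finite_extension K L \<longleftrightarrow>
     subfield K ring_of_type_algebra \<and> subfield L ring_of_type_algebra \<and> K \<subseteq> L \<and>
     ring.finite_dimension ring_of_type_algebra K L"

definition valuation_ring :: "'a::nonarch_field set \<Rightarrow> 'a set" where
  "valuation_ring K = {x \<in> K. absv x \<le> 1}"

definition value_group :: "'a::nonarch_field set \<Rightarrow> real set" where
  "value_group K = absv ` (K - {0})"

text \<open>The index of the value group of \<open>K\<close> in that of \<open>L\<close>, as the number of cosets.\<close>

definition ramification_index :: "'a::nonarch_field set \<Rightarrow> 'a set \<Rightarrow> nat" where
  "ramification_index K L = card ((\<lambda>c. (\<lambda>v. c * v) ` value_group K) ` value_group L)"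

definition residue_field :: "'a::nonarch_field set \<Rightarrow> 'a residue set" where
  "residue_field K = reduce ` valuation_ring K"

text \<open>Every element is a root of a separable polynomial over the smaller field.\<close>

definition separable_extension :: "'k::field set \<Rightarrow> 'k set \<Rightarrow> bool" where
  "separable_extension k l \<longleftrightarrow>
     (\<forall>\<alpha>\<in>l. \<exists>f. set (coeffs f) \<subseteq> k \<and> coprime f (pderiv f) \<and> poly f \<alpha> = 0)"

definition unramified :: "'a::nonarch_field set \<Rightarrow> 'a set \<Rightarrow> bool" where
  "unramified K L \<longleftrightarrow> finite_extension K L \<and> ramification_index K L = 1 \<and>
     separable_extension (residue_field K) (residue_field L)"

definition tamely_ramified :: "'a::nonarch_field set \<Rightarrow> 'a set \<Rightarrow> bool" where
  "tamely_ramified K L \<longleftrightarrow> finite_extension K L \<and> \<not> CHAR('a residue) dvd ramification_index K L \<and>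
     separable_extension (residue_field K) (residue_field L)"

text \<open>
  The compositum of two finite unramified extensions is unramified, so the maximal
  unramified extension inside \<^typ>\<open>'a\<close> is a plain union.
\<close>

definition maximal_unramified_extension :: "'a::nonarch_field set \<Rightarrow> 'a set" where
  "maximal_unramified_extension K = \<Union>{L. unramified K L}"

text \<open>
  If the absolute value of \<^typ>\<open>'a\<close> restricts to the \<open>p\<close>-adic one on the rationals, as is forced by
  the normalisation below, then \<^term>\<open>closure \<rat>\<close> is the field of \<open>p\<close>-adic numbers: as a closed
  subset of the complete set \<open>K\<close> it is complete, and the rationals are dense in it.
\<close>

definition completed_maximal_unramified ::
    "nat \<Rightarrow> 'a::{nonarch_field, field_char_0} set \<Rightarrow> bool" where
  "completed_maximal_unramified p K \<longleftrightarrow>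
     absv (of_nat p :: 'a) = 1 / real p \<and>
     subfield K ring_of_type_algebra \<and> complete K \<and>
     K = closure (maximal_unramified_extension (closure \<rat>))"

text \<open>That the ambient field \<^typ>\<open>'a\<close> is algebraically closed is part of its sort.\<close>

definition algebraic_closure_of :: "'a::alg_closed_field set \<Rightarrow> bool" where
  "algebraic_closure_of K \<longleftrightarrow>
     (\<forall>x. (ring.algebraic ring_of_type_algebra over K) x)"

section \<open>Formal power series in finitely many variables\<close>

text \<open>The variables are indexed by \<^typ>\<open>'v\<close>; a function \<^typ>\<open>'v \<Rightarrow> nat\<close> is a multi-index.\<close>

typedef ('v, 'a) mfps = "UNIV :: (('v \<Rightarrow> nat) \<Rightarrow> 'a) set"
  morphisms mfps_nth Abs_mfps by simp

setup_lifting type_definition_mfps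

lemma finite_multi_index_le: "finite {a. a \<le> (m :: 'v::finite \<Rightarrow> nat)}"
proof (rule finite_subset)
  show "{a. a \<le> m} \<subseteq> {f. \<forall>x. (x \<in> UNIV \<longrightarrow> f x \<in> {..Max (range m)}) \<and> (x \<notin> UNIV \<longrightarrow> f x = 0)}"
    by (auto simp: le_fun_def intro: order_trans[OF _ Max_ge])
qed (rule finite_set_of_finite_funs; simp)

instantiation mfps :: (finite, comm_ring_1) comm_ring_1
begin

lift_definition zero_mfps :: "('a, 'b) mfps" is "\<lambda>_. 0" .

lift_definition one_mfps :: "('a, 'b) mfps" is "\<lambda>m. if m = (\<lambda>_. 0) then 1 else 0" .

lift_definition plus_mfps :: "('a, 'b) mfps \<Rightarrow> ('a, 'b) mfps \<Rightarrow> ('a, 'b) mfps" is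
  "\<lambda>f g m. f m + g m" .

lift_definition uminus_mfps :: "('a, 'b) mfps \<Rightarrow> ('a, 'b) mfps" is "\<lambda>f m. - f m" .

lift_definition minus_mfps :: "('a, 'b) mfps \<Rightarrow> ('a, 'b) mfps \<Rightarrow> ('a, 'b) mfps" is
  "\<lambda>f g m. f m - g m" .

lift_definition times_mfps :: "('a, 'b) mfps \<Rightarrow> ('a, 'b) mfps \<Rightarrow> ('a, 'b) mfps" is
  "\<lambda>f g m. \<Sum>a | a \<le> m. f a * g (m - a)" .

instance
proof
  fix f g h :: "('a, 'b) mfps"
  show "f * g * h = f * (g * h)"
  proof (transfer, rule ext)
    fix f g h :: "('a \<Rightarrow> nat) \<Rightarrow> 'b" and m :: "'a \<Rightarrow> nat"
    have "(\<Sum>a | a \<le> m. (\<Sum>b | b \<le> a. f b * g (a - b)) * h (m - a)) =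
        (\<Sum>(a, b)\<in>(SIGMA a:{a. a \<le> m}. {b. b \<le> a}). f b * g (a - b) * h (m - a))"
      by (simp add: sum_distrib_right sum.Sigma finite_multi_index_le)
    also have "\<dots> = (\<Sum>(b, c)\<in>(SIGMA b:{b. b \<le> m}. {c. c \<le> m - b}). f b * (g c * h (m - b - c)))"
    proof (rule sum.reindex_bij_witness[where i = "\<lambda>(b, c). (\<lambda>i. b i + c i, b)"
          and j = "\<lambda>(a, b). (b, a - b)"], goal_cases)
      case (1 x)
      then show ?case by (auto simp: le_fun_def fun_eq_iff)
    next
      case (2 x)
      then obtain a b where x: "x = (a, b)" and le: "\<And>i. a i \<le> m i" "\<And>i. b i \<le> a i"
        by (auto simp: le_fun_def)
      have "b i \<le> m i" "a i - b i \<le> m i - b i" for i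
        using le[of i] by linarith+
      then show ?case by (simp add: x le_fun_def)
    next
      case (3 x)
      then show ?case by (auto simp: fun_eq_iff)
    next
      case (4 x)
      then obtain b c where x: "x = (b, c)" and le: "\<And>i. b i \<le> m i" "\<And>i. c i \<le> m i - b i"
        by (auto simp: le_fun_def)
      have "b i + c i \<le> m i" for i
        using le[of i] by linarith
      then show ?case by (simp add: x le_fun_def)
    next
      case (5 x)
      then obtain a b where x: "x = (a, b)" and le: "\<And>i. a i \<le> m i" "\<And>i. b i \<le> a i"
        by (auto simp: le_fun_def)
      have "m i - b i - (a i - b i) = m i - a i" for i
        using le[of i] by linarith
      then have "m - b - (a - b) = m - a"
        by (simp add: fun_eq_iff)
      then show ?case
        by (simp add: x mult.assoc)
    qed
    also have "\<dots> = (\<Sum>b | b \<le> m. f b * (\<Sum>c | c \<le> m - b. g c * h (m - b - c)))"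
      by (simp add: sum_distrib_left sum.Sigma finite_multi_index_le)
    finally show "(\<Sum>a | a \<le> m. (\<Sum>b | b \<le> a. f b * g (a - b)) * h (m - a)) = \<dots>" .
  qed
  show "f * g = g * f"
  proof (transfer, rule ext)
    fix f g :: "('a \<Rightarrow> nat) \<Rightarrow> 'b" and m :: "'a \<Rightarrow> nat"
    show "(\<Sum>a | a \<le> m. f a * g (m - a)) = (\<Sum>a | a \<le> m. g a * f (m - a))"
    proof (rule sum.reindex_bij_witness[where i = "\<lambda>a. m - a" and j = "\<lambda>a. m - a"], goal_cases)
      case (5 a)
      then have "m - (m - a) = a" by (auto simp: le_fun_def fun_eq_iff)
      then show ?case by (simp add: mult.commute)
    qed (auto simp: le_fun_def fun_eq_iff)
  qed
  show "1 * f = f"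
  proof (transfer, rule ext)
    fix f :: "('a \<Rightarrow> nat) \<Rightarrow> 'b" and m :: "'a \<Rightarrow> nat"
    have "(\<Sum>a | a \<le> m. (if a = (\<lambda>_. 0) then 1 else 0) * f (m - a)) =
        (\<Sum>a | a \<le> m. if a = (\<lambda>_. 0) then f (m - a) else 0)"
      by (rule sum.cong) auto
    also have "\<dots> = f m"
      by (subst sum.delta[OF finite_multi_index_le]) (simp add: le_fun_def fun_diff_def)
    finally show "(\<Sum>a | a \<le> m. (if a = (\<lambda>_. 0) then 1 else 0) * f (m - a)) = f m" .
  qed
  show "(f + g) * h = f * h + g * h"
    by transfer (auto simp: algebra_simps sum.distrib)
  show "f + g + h = f + (g + h)" "f + g = g + f" "0 + f = f" "- f + f = 0" "f - g = f + - g"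
    by (transfer; simp add: algebra_simps)+
  show "(0 :: ('a, 'b) mfps) \<noteq> 1"
    by transfer (metis zero_neq_one)
qed

end

definition multi_degree :: "('v::finite \<Rightarrow> nat) \<Rightarrow> nat" where
  "multi_degree m = (\<Sum>v\<in>UNIV. m v)"

definition mfps_var :: "'v \<Rightarrow> ('v, 'a::comm_ring_1) mfps" where
  "mfps_var v = Abs_mfps (\<lambda>m. if m = (\<lambda>w. if w = v then 1 else 0) then 1 else 0)"

text \<open>
  Substitution of series \<open>\<phi> v\<close> \<^emph>\<open>without constant term\<close> for the variables \<open>v\<close>. Then
  only the finitely many monomials of \<open>f\<close> of degree at most that of \<open>m\<close> contribute to the
  coefficient at \<open>m\<close>. If some \<open>\<phi> v\<close> has a constant term, the value is meaningless.
\<close>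

definition mfps_subst ::
    "('v::finite, 'a::comm_ring_1) mfps \<Rightarrow> ('v \<Rightarrow> ('w::finite, 'a) mfps) \<Rightarrow> ('w, 'a) mfps" where
  "mfps_subst f \<phi> = Abs_mfps (\<lambda>m.
     \<Sum>k | multi_degree k \<le> multi_degree m. mfps_nth f k * mfps_nth (\<Prod>v\<in>UNIV. \<phi> v ^ k v) m)"

text \<open>
  Unconditional convergence, the natural notion over non-archimedean fields. An algebraic
  closure is in general not complete; but a series over a complete subfield \<open>K\<close>, evaluated at a point
  with coordinates algebraic over \<open>K\<close>, only involves a finite, hence complete, extension of \<open>K\<close>.
\<close>

definition mfps_has_value :: "('v::finite, 'a::nonarch_field) mfps \<Rightarrow> 'a ^ 'v \<Rightarrow> 'a \<Rightarrow> bool" where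
  "mfps_has_value f x s \<longleftrightarrow> ((\<lambda>m. mfps_nth f m * (\<Prod>v\<in>UNIV. x $ v ^ m v)) has_sum s) UNIV"

section \<open>Formal groups\<close>

text \<open>
  A commutative formal group law: a tuple, indexed by \<^typ>\<open>'n\<close>, of series in two copies of the
  variables (indices \<^const>\<open>Inl\<close> and \<^const>\<open>Inr\<close>), with coefficients in \<open>A\<close>. The unit axioms force the constant terms to vanish,
  so that all substitutions are meaningful.
\<close>

definition formal_group_law ::
    "'a::comm_ring_1 set \<Rightarrow> ('n::finite \<Rightarrow> ('n + 'n, 'a) mfps) \<Rightarrow> bool" where
  "formal_group_law A F \<longleftrightarrow>
     (\<forall>i m. mfps_nth (F i) m \<in> A) \<and>
     (\<forall>i. mfps_subst (F i) (case_sum mfps_var (\<lambda>_. 0)) = mfps_var i) \<and>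
     (\<forall>i. mfps_subst (F i) (case_sum (\<lambda>_. 0) mfps_var) = mfps_var i) \<and>
     (\<forall>i. mfps_subst (F i) (case_sum (\<lambda>j. mfps_var (Inr j)) (\<lambda>j. mfps_var (Inl j))) = F i) \<and>
     (let x = (\<lambda>j. mfps_var (Inl j)) :: 'n \<Rightarrow> ('n + 'n + 'n, 'a) mfps;
          y = (\<lambda>j. mfps_var (Inr (Inl j)));
          z = (\<lambda>j. mfps_var (Inr (Inr j)))
      in \<forall>i. mfps_subst (F i) (case_sum (\<lambda>j. mfps_subst (F j) (case_sum x y)) z) =
             mfps_subst (F i) (case_sum x (\<lambda>j. mfps_subst (F j) (case_sum y z))))"

primrec formal_mult ::
    "('n::finite \<Rightarrow> ('n + 'n, 'a::comm_ring_1) mfps) \<Rightarrow> nat \<Rightarrow> 'n \<Rightarrow> ('n, 'a) mfps" where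
  "formal_mult F 0 = (\<lambda>i. 0)"
| "formal_mult F (Suc k) = (\<lambda>i. mfps_subst (F i) (case_sum (formal_mult F k) mfps_var))"

text \<open>
  The following are meant for series with integral coefficients; the units among these are the
  elements of absolute value 1.
\<close>

definition unit_monomials :: "('v, 'a::nonarch_field) mfps \<Rightarrow> ('v \<Rightarrow> nat) set" where
  "unit_monomials f = {m. absv (mfps_nth f m) = 1}"

definition unit_degree :: "('v::finite, 'a::nonarch_field) mfps \<Rightarrow> nat" where
  "unit_degree f = (LEAST d. \<exists>m\<in>unit_monomials f. multi_degree m = d)"

definition unit_form :: "('v::finite, 'a::nonarch_field) mfps \<Rightarrow> ('v, 'a) mfps" where
  "unit_form f = Abs_mfps (\<lambda>m.
     if m \<in> unit_monomials f \<and> multi_degree m = unit_degree f then mfps_nth f m else 0)"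

definition mfps_reduce :: "('v, 'a::nonarch_field) mfps \<Rightarrow> ('v, 'a residue) mfps" where
  "mfps_reduce f = Abs_mfps (\<lambda>m. reduce (mfps_nth f m))"

text \<open>Evaluation of a series that is homogeneous of degree \<open>d\<close>.\<close>

definition form_eval :: "nat \<Rightarrow> ('v::finite, 'k::comm_ring_1) mfps \<Rightarrow> 'k ^ 'v \<Rightarrow> 'k" where
  "form_eval d G y = (\<Sum>m | multi_degree m = d. mfps_nth G m * (\<Prod>v\<in>UNIV. y $ v ^ m v))"

text \<open>
  The solutions range over the residue field of \<^typ>\<open>'a\<close>. When \<^typ>\<open>'a\<close> is an algebraic closure of
  the completed maximal unramified extension of the \<open>p\<close>-adic numbers, this is an algebraic closure
  of the field with \<open>p\<close> elements, and reduction modulo the maximal ideal restricts to reduction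
  modulo \<open>p\<close> on the integers of the base field.
\<close>

definition strict_formal_group ::
    "nat \<Rightarrow> ('n::finite \<Rightarrow> ('n + 'n, 'a::nonarch_field) mfps) \<Rightarrow> bool" where
  "strict_formal_group p F \<longleftrightarrow>
     (\<forall>i. unit_monomials (formal_mult F p i) \<noteq> {}) \<and>
     (\<exists>d. (\<forall>i. unit_degree (formal_mult F p i) = d) \<and>
          (\<forall>y. (\<forall>i. form_eval d (mfps_reduce (unit_form (formal_mult F p i))) y = 0) \<longrightarrow> y = 0))"

definition torsion_points ::
    "nat \<Rightarrow> ('n::finite \<Rightarrow> ('n + 'n, 'a::nonarch_field) mfps) \<Rightarrow> ('a ^ 'n) set" where
  "torsion_points p F =
     {x. (\<forall>j. absv (x $ j) < 1) \<and> (\<forall>i. mfps_has_value (formal_mult F p i) x 0)}"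

definition coordinates :: "'a ^ 'n \<Rightarrow> 'a set" where
  "coordinates x = range (\<lambda>j. x $ j)"

end

theory Submission
  imports Defs
begin

text \<open>
  Differentiating the associativity law gives \<open>J A(X) = p A([p](X))\<close> for the Jacobian \<open>J\<close> of \<open>[p]\<close> and an
  invertible matrix \<open>A\<close>, so \<open>J\<close> vanishes modulo \<open>p\<close> and every unit monomial of \<open>[p]\<close> is a \<open>p\<close>-th power;
  in particular \<open>p\<close> divides the common degree \<open>d\<close> and \<open>e = d - 1\<close> is prime to \<open>p\<close>. If \<open>r\<close> is the largest
  absolute value of a coordinate of a nonzero torsion point \<open>P\<close>, strictness makes the terms of degree \<open>d\<close>
  cancel only against the linear terms, whence \<open>r\<^sup>e = 1/p\<close>. Let \<open>\<pi>\<^sup>e = p\<close>. After the substitution \<open>x = \<pi>y\<close>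
  the equations \<open>[p](x) = 0\<close> have a Jacobian congruent to the identity, so their integral solutions lie
  in \<open>L = K(\<pi>)\<close>, because \<open>K\<close> and its algebraic closure have the same residue field. A coordinate of \<open>P\<close>
  of absolute value \<open>r\<close> is then a uniformiser of \<open>L\<close>, and \<open>\<pi>\<close>-adic expansion in it gives \<open>K(P) = L\<close> and
  the description of the integers.
\<close>

text \<open>The ambient algebraic closure is not complete, so Hensel's lemma cannot produce zeros in
  it. The direction is reversed: a given zero is approximated by elements of L, which puts it in the
  closure of L, and L is shown to be closed. General theory of extensions of valuations is avoided
  as well. If |x|^e = 1/p, the nonzero terms of a sum of b_i x^i over i < e with b_i in K have
  pairwise different absolute values, because their exponents of |x| differ modulo e. With
  completeness of K and equality of residue fields, this shows that every field containing K and x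
  whose values are powers of |x| is the K-span of 1, ..., x^(e-1). That one statement yields the
  closedness of L and the equality K(P) = L. Equality of residue fields comes from Frobenius: a
  residue is algebraic over the residues of K, hence fixed by a power of Frobenius, and such a
  residue lifts to an unramified extension of Q_p. The p-th power exponents also make the scaled
  equations contracting, although the unit coefficients of degree d keep absolute value 1.\<close>

unbundle no fps_syntax

section \<open>Subfields of a field type\<close>

text \<open>Wraps the HOL-Algebra notion of subfield so that closure properties are stated for the
  type class operations.\<close>

locale type_subfield =
  fixes K :: "'a::field set"
  assumes subfield: "subfield K ring_of_type_algebra"
begin

lemma one_mem [simp]: "1 \<in> K"
  using subringE(3)[OF subfieldE(1)[OF subfield]] by (simp add: ring_of_type_algebra_def)

lemma add_mem: "x \<in> K \<Longrightarrow> y \<in> K \<Longrightarrow> x + y \<in> K"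
  using subringE(7)[OF subfieldE(1)[OF subfield]] by (simp add: ring_of_type_algebra_def)

lemma mult_mem: "x \<in> K \<Longrightarrow> y \<in> K \<Longrightarrow> x * y \<in> K"
  using subringE(6)[OF subfieldE(1)[OF subfield]] by (simp add: ring_of_type_algebra_def)

end

lemma type_algebra_simps [simp]:
  "carrier ring_of_type_algebra = (UNIV :: 'a::field set)"
  "\<one>\<^bsub>ring_of_type_algebra\<^esub> = (1 :: 'a)"
  "\<zero>\<^bsub>ring_of_type_algebra\<^esub> = (0 :: 'a)"
  "x \<oplus>\<^bsub>ring_of_type_algebra\<^esub> y = (x + y :: 'a)"
  "x \<otimes>\<^bsub>ring_of_type_algebra\<^esub> y = (x * y :: 'a)"
  by (simp_all add: ring_of_type_algebra_def)

lemma a_inv_type_algebra [simp]: "\<ominus>\<^bsub>ring_of_type_algebra\<^esub> x = - (x :: 'a::field)"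
proof -
  interpret Ring.field "ring_of_type_algebra :: 'a ring" by rule
  show ?thesis
    by (rule minus_equality) auto
qed

lemma m_inv_type_algebra [simp]: "x \<noteq> 0 \<Longrightarrow> inv\<^bsub>ring_of_type_algebra\<^esub> x = Fields.inverse (x :: 'a::field)"
proof -
  interpret R: Ring.field "ring_of_type_algebra :: 'a ring" by rule
  assume "x \<noteq> 0"
  then show ?thesis
    using R.comm_inv_char[of x "Fields.inverse x"] by simp
qed

lemma nat_pow_type_algebra [simp]: "x [^]\<^bsub>ring_of_type_algebra\<^esub> (n::nat) = (x ^ n :: 'a::field)"
proof -
  interpret Ring.field "ring_of_type_algebra :: 'a ring" by rule
  show ?thesis by (induction n) (simp_all add: mult.commute)
qed

lemma type_subfieldI:
  fixes K :: "'a::field set"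
  assumes "1 \<in> K" "\<And>x y. x \<in> K \<Longrightarrow> y \<in> K \<Longrightarrow> x - y \<in> K"
    "\<And>x y. x \<in> K \<Longrightarrow> y \<in> K \<Longrightarrow> x * y \<in> K" "\<And>x. x \<in> K \<Longrightarrow> x \<noteq> 0 \<Longrightarrow> inverse x \<in> K"
  shows "type_subfield K"
proof (rule type_subfield.intro)
  interpret Ring.field "ring_of_type_algebra :: 'a ring" by rule
  have 0: "0 \<in> K" using assms(2)[OF assms(1) assms(1)] by simp
  have m: "- x \<in> K" if "x \<in> K" for x using assms(2)[OF 0 that] by simp
  have p: "x + y \<in> K" if "x \<in> K" "y \<in> K" for x y using assms(2)[OF that(1) m[OF that(2)]] by simp
  show "subfield K ring_of_type_algebra"
    by (rule subfieldI'; (rule subringI)?) (use assms 0 m p in auto)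
qed

context type_subfield
begin

lemma uminus_mem: "x \<in> K \<Longrightarrow> - x \<in> K"
  using subringE(5)[OF subfieldE(1)[OF subfield], of x] by simp

lemma zero_mem [simp]: "0 \<in> K"
  using add_mem[OF one_mem uminus_mem[OF one_mem]] by simp

lemma diff_mem: "x \<in> K \<Longrightarrow> y \<in> K \<Longrightarrow> x - y \<in> K"
  using add_mem[OF _ uminus_mem] by fastforce

lemma inverse_mem: "x \<in> K \<Longrightarrow> inverse x \<in> K"
proof (cases "x = 0")
  case False
  interpret Ring.field "ring_of_type_algebra :: 'a ring" by rule
  assume "x \<in> K"
  then show ?thesis
    using subfield_m_inv(1)[OF subfield, of x] False by simp
qed simp

lemma divide_mem: "x \<in> K \<Longrightarrow> y \<in> K \<Longrightarrow> x / y \<in> K"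
  by (simp add: divide_inverse mult_mem inverse_mem)

lemma power_mem: "x \<in> K \<Longrightarrow> x ^ n \<in> K"
  by (induction n) (auto intro: mult_mem)

lemma sum_mem: "(\<And>i. i \<in> A \<Longrightarrow> f i \<in> K) \<Longrightarrow> sum f A \<in> K"
  by (induction A rule: infinite_finite_induct) (auto intro: add_mem)

lemma prod_mem: "(\<And>i. i \<in> A \<Longrightarrow> f i \<in> K) \<Longrightarrow> prod f A \<in> K"
  by (induction A rule: infinite_finite_induct) (auto intro: mult_mem)

lemma of_nat_mem: "of_nat n \<in> K"
  by (induction n) (auto intro: add_mem)

lemma of_int_mem: "of_int n \<in> K"
  by (cases n) (auto intro: of_nat_mem diff_mem uminus_mem simp del: of_nat_Suc)

lemmas mem_intros = add_mem mult_mem uminus_mem diff_mem inverse_mem divide_mem power_mem sum_mem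
  prod_mem of_nat_mem of_int_mem

end

section \<open>Adjunction of elements to subfields and subrings\<close>

lemma type_subfield_field_adjoin: "type_subfield (field_adjoin K S)"
proof -
  interpret Ring.field "ring_of_type_algebra :: 'a ring" by rule
  show ?thesis
    unfolding type_subfield_def field_adjoin_def by (rule generate_field_is_subfield) simp
qed

lemma field_adjoin_incl: "K \<subseteq> field_adjoin K S" "S \<subseteq> field_adjoin K S"
  by (auto simp: field_adjoin_def intro: generate_field.incl)

lemma field_adjoin_least:
  assumes "type_subfield L" "K \<subseteq> L" "S \<subseteq> L"
  shows "field_adjoin K S \<subseteq> L"
proof -
  interpret Ring.field "ring_of_type_algebra :: 'a ring" by rule
  show ?thesis
    unfolding field_adjoin_def
    by (rule generate_field_min_subfield1) (use assms in \<open>auto simp: type_subfield_def\<close>)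
qed

lemma ring_adjoin_closed:
  shows "A \<subseteq> ring_adjoin A S" "S \<subseteq> ring_adjoin A S"
    and "x \<in> ring_adjoin A S \<Longrightarrow> y \<in> ring_adjoin A S \<Longrightarrow> x + y \<in> ring_adjoin A S"
    and "x \<in> ring_adjoin A S \<Longrightarrow> y \<in> ring_adjoin A S \<Longrightarrow> x * y \<in> ring_adjoin A S"
    and "1 \<in> ring_adjoin A S"
  using generate_ring.eng_add[of x ring_of_type_algebra "A \<union> S" y]
    generate_ring.eng_mult[of x ring_of_type_algebra "A \<union> S" y]
    generate_ring.one[of ring_of_type_algebra "A \<union> S"]
  by (auto simp: ring_adjoin_def intro: generate_ring.incl)

lemma ring_adjoin_zero: "0 \<in> ring_adjoin A S"
proof -
  interpret Ring.field "ring_of_type_algebra :: 'a ring" by rule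
  show ?thesis using Generated_Rings.ring.zero_in_generate[OF ring_axioms] by (simp add: ring_adjoin_def)
qed

lemma ring_adjoin_power: "x \<in> ring_adjoin A S \<Longrightarrow> x ^ n \<in> ring_adjoin A S"
  by (induction n) (auto intro: ring_adjoin_closed)

lemma ring_adjoin_sum: "(\<And>i. i \<in> I \<Longrightarrow> f i \<in> ring_adjoin A S) \<Longrightarrow> sum f I \<in> ring_adjoin A S"
  by (induction I rule: infinite_finite_induct) (auto intro: ring_adjoin_closed ring_adjoin_zero)

lemma ring_adjoin_least:
  assumes "1 \<in> B" "\<And>x. x \<in> B \<Longrightarrow> - x \<in> B" "\<And>x y. x \<in> B \<Longrightarrow> y \<in> B \<Longrightarrow> x + y \<in> B"
    "\<And>x y. x \<in> B \<Longrightarrow> y \<in> B \<Longrightarrow> x * y \<in> B" "A \<subseteq> B" "S \<subseteq> B"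
  shows "ring_adjoin A S \<subseteq> B"
proof -
  interpret Ring.field "ring_of_type_algebra :: 'a ring" by rule
  show ?thesis
    unfolding ring_adjoin_def
    by (rule generate_ring_min_subring1; (rule subringI)?) (use assms in auto)
qed

text \<open>Both nontrivial finite extensions constructed below, the unramified lift of a residue
  and the field K(\<pi>), have this form.\<close>

definition power_span :: "'a::field set \<Rightarrow> 'a \<Rightarrow> nat \<Rightarrow> 'a set" where
  "power_span K r n = {\<Sum>i<n. b i * r ^ i |b. \<forall>i. b i \<in> K}"

lemma power_spanI: "(\<And>i. b i \<in> K) \<Longrightarrow> (\<Sum>i<n. b i * r ^ i) \<in> power_span K r n"
  by (auto simp: power_span_def)

lemma power_spanE:
  assumes "z \<in> power_span K r n"
  obtains b where "\<forall>i. b i \<in> K" "z = (\<Sum>i<n. b i * r ^ i)"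
  using assms by (auto simp: power_span_def)

context type_subfield
begin

text \<open>The head of the list is the last vector that \<open>Span\<close> adjoins, so the
  exponents run downwards and the induction adds \<open>r ^ n\<close> to the span of the lower
  powers.\<close>

lemma power_span_eq_Span:
  "power_span K r n = ring.Span ring_of_type_algebra K (map (\<lambda>i. r ^ i) (rev [0..<n]))"
proof -
  interpret Ring.field "ring_of_type_algebra :: 'a ring" by rule
  show ?thesis
  proof (induction n)
    case 0
    show ?case by (auto simp: power_span_def intro: exI[of _ "\<lambda>_. 0"])
  next
    case (Suc n)
    have "power_span K r (Suc n) = line_extension K (r ^ n) (power_span K r n)"
    proof (intro equalityI subsetI)
      fix z assume "z \<in> power_span K r (Suc n)"
      then obtain b where b: "\<forall>i. b i \<in> K" "z = (\<Sum>i<Suc n. b i * r ^ i)" by (rule power_spanE)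
      then have "b n \<in> K" "(\<Sum>i<n. b i * r ^ i) \<in> power_span K r n"
        "z = b n * r ^ n + (\<Sum>i<n. b i * r ^ i)"
        by (auto intro: power_spanI)
      then show "z \<in> line_extension K (r ^ n) (power_span K r n)"
        unfolding line_extension_mem_iff type_algebra_simps by blast
    next
      fix z assume "z \<in> line_extension K (r ^ n) (power_span K r n)"
      then obtain k b where b: "k \<in> K" "\<And>i. b i \<in> K" "z = k * r ^ n + (\<Sum>i<n. b i * r ^ i)"
        by (auto simp: line_extension_mem_iff elim!: power_spanE)
      then have "z = (\<Sum>i<Suc n. (b(n := k)) i * r ^ i)"
        by (auto simp: add.commute intro!: sum.cong)
      moreover have "\<dots> \<in> power_span K r (Suc n)"
        by (rule power_spanI) (use b in auto)
      ultimately show "z \<in> power_span K r (Suc n)"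
        by (simp only:)
    qed
    with Suc show ?case by simp
  qed
qed

lemma finite_dimension_power_span:
  "ring.finite_dimension ring_of_type_algebra K (power_span K r n)"
proof -
  interpret Ring.field "ring_of_type_algebra :: 'a ring" by rule
  show ?thesis
    unfolding power_span_eq_Span by (rule Span_finite_dimension) (auto simp: subfield)
qed

text \<open>If \<open>r ^ n\<close> falls back into the span of the lower powers, the span is closed
  under multiplication by \<open>r\<close> and so equals K[r]. A ring K[r] of finite dimension over
  the field K is itself a field.\<close>

lemma finite_extension_power_span:
  assumes n: "n > 0" and r: "r ^ n \<in> power_span K r n"
  shows "finite_extension K (power_span K r n)" "r \<in> power_span K r n"
proof -
  interpret Ring.field "ring_of_type_algebra :: 'a ring" by rule
  let ?S = "power_span K r n"
  have K: "K \<subseteq> ?S"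
  proof
    fix x assume "x \<in> K"
    moreover have "x = (\<Sum>i<n. (if i = 0 then x else 0) * r ^ i)"
      using n by (simp add: if_distrib[of "\<lambda>u. u * _"] cong: if_cong)
    ultimately show "x \<in> ?S"
      using power_spanI[of "\<lambda>i. if i = 0 then x else 0" K r n] by simp
  qed
  have add: "x + y \<in> ?S" if "x \<in> ?S" "y \<in> ?S" for x y
  proof -
    obtain b where "\<forall>i. b i \<in> K" "x = (\<Sum>i<n. b i * r ^ i)"
      using \<open>x \<in> ?S\<close> by (rule power_spanE)
    moreover obtain c where "\<forall>i. c i \<in> K" "y = (\<Sum>i<n. c i * r ^ i)"
      using \<open>y \<in> ?S\<close> by (rule power_spanE)
    ultimately have "\<forall>i. b i \<in> K" "x = (\<Sum>i<n. b i * r ^ i)" "\<forall>i. c i \<in> K" "y = (\<Sum>i<n. c i * r ^ i)"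
      by blast+
    then show ?thesis
      using power_spanI[of "\<lambda>i. b i + c i" K r n] by (simp add: add_mem sum.distrib distrib_right)
  qed
  have smult: "c * x \<in> ?S" if "c \<in> K" "x \<in> ?S" for x c
  proof -
    obtain b where "\<forall>i. b i \<in> K" "x = (\<Sum>i<n. b i * r ^ i)"
      using \<open>x \<in> ?S\<close> by (rule power_spanE)
    then show ?thesis
      using power_spanI[of "\<lambda>i. c * b i" K r n] that by (simp add: mult_mem sum_distrib_left mult.assoc)
  qed
  have sum: "(\<And>i. i \<in> I \<Longrightarrow> f i \<in> ?S) \<Longrightarrow> sum f I \<in> ?S" for I :: "nat set" and f
    by (induction I rule: infinite_finite_induct) (use add K in auto)
  have pw: "r ^ i \<in> ?S" if "i \<le> n" for i
  proof (cases "i = n")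
    case False
    then have "r ^ i = (\<Sum>j<n. (if j = i then 1 else 0) * r ^ j)"
      using that by (simp add: if_distrib[of "\<lambda>u. u * _"] cong: if_cong)
    then show ?thesis
      using power_spanI[of "\<lambda>j. if j = i then 1 else 0" K r n] by simp
  qed (use r in simp)
  have mr: "x * r \<in> ?S" if "x \<in> ?S" for x
  proof -
    obtain b where b: "\<forall>i. b i \<in> K" "x = (\<Sum>i<n. b i * r ^ i)"
      using \<open>x \<in> ?S\<close> by (rule power_spanE)
    have "x * r = (\<Sum>i<n. b i * r ^ Suc i)"
      by (simp only: b(2) sum_distrib_right) (simp add: mult_ac)
    also have "\<dots> \<in> ?S"
      by (intro sum smult b(1)[rule_format] pw) auto
    finally show ?thesis .
  qed
  have mrk: "x * r ^ k \<in> ?S" if "x \<in> ?S" for x k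
    using that mr by (induction k) (auto simp flip: mult.assoc simp: power_Suc2 simp del: power_Suc)
  show rS: "r \<in> ?S" using mr[of 1] subsetD[OF K one_mem] by simp
  have "simple_extension K r = ?S"
  proof
    show "simple_extension K r \<subseteq> ?S"
    proof
      fix x assume "x \<in> simple_extension K r"
      then show "x \<in> ?S"
        by induction (use K mr add in auto)
    qed
    have sub: "subring (simple_extension K r) ring_of_type_algebra"
      by (rule simple_extension_is_subring) (auto intro: subfieldE subfield)
    have K': "K \<subseteq> simple_extension K r" "r \<in> simple_extension K r"
      using simple_extension_incl[of K r] simple_extension_mem[OF subfieldE(1)[OF subfield], of r] by auto
    have pw: "r ^ i \<in> simple_extension K r" for i
      by (induction i) (use K' subringE(3,6)[OF sub] one_mem in auto)
    show "?S \<subseteq> simple_extension K r"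
    proof
      fix x assume "x \<in> ?S"
      then obtain b where b: "\<forall>i. b i \<in> K" "x = (\<Sum>i<n. b i * r ^ i)" by (rule power_spanE)
      then have "b i * r ^ i \<in> simple_extension K r" for i
        using K' pw[of i] subringE(6)[OF sub, of "b i" "r ^ i"] by auto
      then have "(\<Sum>i\<in>I. b i * r ^ i) \<in> simple_extension K r" for I :: "nat set"
        by (induction I rule: infinite_finite_induct) (use subringE(2,7)[OF sub] in auto)
      then show "x \<in> simple_extension K r" using b by blast
    qed
  qed
  then have "subfield ?S ring_of_type_algebra"
    using simple_extension_is_subfield[OF subfield, of r] finite_dimension_power_span[of r n]
      finite_dimension_simple_extension[OF subfield, of r] by simp
  then show "Defs.finite_extension K ?S"
    using K finite_dimension_power_span[of r n] subfield by (simp add: Defs.finite_extension_def)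
qed

end

section \<open>Substitution and differentiation of formal power series\<close>

lemma mfps_nth_Abs [simp]: "mfps_nth (Abs_mfps f) = f"
  by (simp add: Abs_mfps_inverse)

lemma mfps_eqI: "(\<And>m. mfps_nth f m = mfps_nth g m) \<Longrightarrow> f = g"
  by (metis ext mfps_nth_inject)

lemmas mfps_nth_simps [simp] = zero_mfps.rep_eq one_mfps.rep_eq plus_mfps.rep_eq
  uminus_mfps.rep_eq minus_mfps.rep_eq

lemma mfps_nth_mult: "mfps_nth (f * g) m = (\<Sum>a | a \<le> m. mfps_nth f a * mfps_nth g (m - a))"
  by (simp add: times_mfps.rep_eq)

lemma mfps_nth_sum: "mfps_nth (\<Sum>i\<in>I. f i) m = (\<Sum>i\<in>I. mfps_nth (f i) m)"
  by (induction I rule: infinite_finite_induct) auto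

lemma mfps_nth_of_nat_mult: "mfps_nth (of_nat n * f) m = of_nat n * mfps_nth f m"
  by (induction n) (auto simp: distrib_right)

lemma multi_degree_0 [simp]: "multi_degree (\<lambda>_. 0) = 0"
  by (simp add: multi_degree_def)

lemma multi_degree_eq_0_iff [simp]: "multi_degree m = 0 \<longleftrightarrow> m = (\<lambda>_. 0)"
  by (auto simp: multi_degree_def)

lemma multi_degree_split: "a \<le> m \<Longrightarrow> multi_degree a + multi_degree (m - a) = multi_degree m"
  by (simp add: multi_degree_def le_fun_def flip: sum.distrib)

lemma multi_degree_mono: "a \<le> m \<Longrightarrow> multi_degree a \<le> multi_degree m"
  by (auto simp: multi_degree_def le_fun_def intro: sum_mono)

lemma finite_multi_degree_le: "finite {k. multi_degree (k :: 'v::finite \<Rightarrow> nat) \<le> n}"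
proof (rule finite_subset[OF _ finite_multi_index_le])
  show "{k. multi_degree (k :: 'v \<Rightarrow> nat) \<le> n} \<subseteq> {a. a \<le> (\<lambda>_. n)}"
  proof (clarsimp simp: le_fun_def multi_degree_def)
    fix k :: "'v \<Rightarrow> nat" and v
    assume "sum k UNIV \<le> n"
    then show "k v \<le> n"
      using member_le_sum[of v UNIV k] by simp
  qed
qed

definition vanishing_order_ge :: "nat \<Rightarrow> ('v::finite, 'a::comm_ring_1) mfps \<Rightarrow> bool" where
  "vanishing_order_ge n f \<longleftrightarrow> (\<forall>m. multi_degree m < n \<longrightarrow> mfps_nth f m = 0)"

lemma vanishing_order_geD: "vanishing_order_ge n f \<Longrightarrow> multi_degree m < n \<Longrightarrow> mfps_nth f m = 0"
  by (simp add: vanishing_order_ge_def)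

lemma vanishing_order_ge_mult:
  assumes "vanishing_order_ge a f" "vanishing_order_ge b g"
  shows "vanishing_order_ge (a + b) (f * g)"
  unfolding vanishing_order_ge_def
proof (intro allI impI)
  fix m :: "'a \<Rightarrow> nat" assume m: "multi_degree m < a + b"
  show "mfps_nth (f * g) m = 0"
    unfolding mfps_nth_mult
  proof (intro sum.neutral ballI)
    fix c assume "c \<in> {a. a \<le> m}"
    then have "multi_degree c < a \<or> multi_degree (m - c) < b"
      using multi_degree_split[of c m] m by auto
    then show "mfps_nth f c * mfps_nth g (m - c) = 0"
      using assms by (auto simp: vanishing_order_ge_def)
  qed
qed

lemma vanishing_order_ge_0 [simp]: "vanishing_order_ge 0 f"
  by (simp add: vanishing_order_ge_def)

lemma vanishing_order_ge_1_iff [simp]: "vanishing_order_ge (Suc 0) f \<longleftrightarrow> mfps_nth f (\<lambda>_. 0) = 0"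
  by (auto simp: vanishing_order_ge_def)

lemma vanishing_order_ge_power: "vanishing_order_ge a f \<Longrightarrow> vanishing_order_ge (k * a) (f ^ k)"
  by (induction k) (auto intro: vanishing_order_ge_mult)

lemma vanishing_order_ge_prod:
  "(\<And>i. i \<in> I \<Longrightarrow> vanishing_order_ge (a i) (f i)) \<Longrightarrow> vanishing_order_ge (sum a I) (prod f I)"
  by (induction I rule: infinite_finite_induct) (auto intro: vanishing_order_ge_mult)

text \<open>The image of the monomial with exponents \<open>k\<close> under the substitution
  \<open>\<phi>\<close>.\<close>

definition mfps_power_product ::
    "('v::finite \<Rightarrow> ('w::finite, 'a::comm_ring_1) mfps) \<Rightarrow> ('v \<Rightarrow> nat) \<Rightarrow> ('w, 'a) mfps" where
  "mfps_power_product \<phi> k = (\<Prod>v\<in>UNIV. \<phi> v ^ k v)"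

lemma mfps_power_product_0 [simp]: "mfps_power_product \<phi> (\<lambda>_. 0) = 1"
  by (simp add: mfps_power_product_def)

lemma mfps_power_product_add:
  "mfps_power_product \<phi> (\<lambda>v. k v + l v) = mfps_power_product \<phi> k * mfps_power_product \<phi> l"
  by (simp add: mfps_power_product_def power_add prod.distrib)

definition const_free :: "('v \<Rightarrow> ('w::finite, 'a::comm_ring_1) mfps) \<Rightarrow> bool" where
  "const_free \<phi> \<longleftrightarrow> (\<forall>v. mfps_nth (\<phi> v) (\<lambda>_. 0) = 0)"

lemma mfps_nth_power_product_eq_0:
  assumes "const_free \<phi>" "multi_degree m < multi_degree k"
  shows "mfps_nth (mfps_power_product \<phi> k) m = 0"
proof (rule vanishing_order_geD)
  show "vanishing_order_ge (multi_degree k) (mfps_power_product \<phi> k)"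
    using assms(1) vanishing_order_ge_power[of 1 "\<phi> _" "k _"] unfolding mfps_power_product_def multi_degree_def
    by (intro vanishing_order_ge_prod) (simp add: const_free_def)
qed (rule assms)

text \<open>Any cut-off \<open>n\<close> from the degree of \<open>m\<close> on gives the same sum,
  which lets coefficients at different multi-indices share one index set.\<close>

lemma mfps_nth_subst:
  assumes "const_free \<phi>" "multi_degree m \<le> n"
  shows "mfps_nth (mfps_subst f \<phi>) m =
    (\<Sum>k | multi_degree k \<le> n. mfps_nth f k * mfps_nth (mfps_power_product \<phi> k) m)"
proof -
  have "(\<Sum>k | multi_degree k \<le> multi_degree m. mfps_nth f k * mfps_nth (mfps_power_product \<phi> k) m) =
      (\<Sum>k | multi_degree k \<le> n. mfps_nth f k * mfps_nth (mfps_power_product \<phi> k) m)"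
    using assms by (intro sum.mono_neutral_left finite_multi_degree_le)
      (auto simp: not_le mfps_nth_power_product_eq_0)
  then show ?thesis
    by (simp add: mfps_subst_def mfps_power_product_def)
qed

lemma const_free_subst:
  assumes "mfps_nth f (\<lambda>_. 0) = 0"
  shows "mfps_nth (mfps_subst f \<phi>) (\<lambda>_. 0) = 0"
  using assms by (simp add: mfps_subst_def)

lemma mfps_subst_add: "mfps_subst (f + g) \<phi> = mfps_subst f \<phi> + mfps_subst g \<phi>"
  by (rule mfps_eqI) (simp add: mfps_subst_def distrib_right sum.distrib)

lemma mfps_subst_0 [simp]: "mfps_subst 0 \<phi> = 0"
  by (rule mfps_eqI) (simp add: mfps_subst_def)

lemma mfps_subst_sum: "mfps_subst (\<Sum>i\<in>I. f i) \<phi> = (\<Sum>i\<in>I. mfps_subst (f i) \<phi>)"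
  by (induction I rule: infinite_finite_induct) (auto simp: mfps_subst_add)

lemma mfps_subst_1 [simp]: "mfps_subst 1 \<phi> = 1"
proof (rule mfps_eqI)
  fix m
  have "mfps_nth (mfps_subst 1 \<phi>) m =
      (\<Sum>k\<in>{\<lambda>_. 0}. mfps_nth 1 k * mfps_nth (mfps_power_product \<phi> k) m)"
    unfolding mfps_subst_def mfps_nth_Abs mfps_power_product_def
    by (rule sum.mono_neutral_right[OF finite_multi_degree_le]) auto
  then show "mfps_nth (mfps_subst 1 \<phi>) m = mfps_nth 1 m" by simp
qed

lemma mfps_nth_subst_mult:
  assumes "const_free \<phi>" "multi_degree m \<le> n"
  shows "mfps_nth (mfps_subst f \<phi> * h) m =
    (\<Sum>k | multi_degree k \<le> n. mfps_nth f k * mfps_nth (mfps_power_product \<phi> k * h) m)"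
proof -
  have "mfps_nth (mfps_subst f \<phi> * h) m =
    (\<Sum>a | a \<le> m. \<Sum>k | multi_degree k \<le> n.
        mfps_nth f k * (mfps_nth (mfps_power_product \<phi> k) a * mfps_nth h (m - a)))"
    unfolding mfps_nth_mult
    by (rule sum.cong) (use assms(2) in \<open>auto simp: mfps_nth_subst[OF assms(1), of _ n] sum_distrib_right mult.assoc
        dest: multi_degree_mono\<close>)
  also have "\<dots> = (\<Sum>k | multi_degree k \<le> n. mfps_nth f k * mfps_nth (mfps_power_product \<phi> k * h) m)"
    by (subst sum.swap) (simp add: mfps_nth_mult sum_distrib_left)
  finally show ?thesis .
qed

text \<open>Both sides are sums over pairs of exponents \<open>(l, k)\<close>. On the right they run
  over a square; pairs whose total degree exceeds that of \<open>m\<close> contribute nothing,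
  because the power product then vanishes to higher order, and the others are grouped by
  \<open>j = k + l\<close>.\<close>

lemma mfps_subst_mult:
  fixes \<phi> :: "'v::finite \<Rightarrow> ('w::finite, 'a::comm_ring_1) mfps"
  assumes \<phi>: "const_free \<phi>"
  shows "mfps_subst (f * g) \<phi> = mfps_subst f \<phi> * mfps_subst g \<phi>"
proof (rule mfps_eqI)
  fix m :: "'w \<Rightarrow> nat"
  let ?n = "multi_degree m"
  let ?D = "{k. multi_degree k \<le> ?n}"
  let ?t = "\<lambda>(l, k). mfps_nth f l * (mfps_nth g k * mfps_nth (mfps_power_product \<phi> (\<lambda>v. k v + l v)) m)"
  have "mfps_nth (mfps_subst f \<phi> * mfps_subst g \<phi>) m = sum ?t (?D \<times> ?D)"
  proof -
    have "mfps_nth (mfps_power_product \<phi> l * mfps_subst g \<phi>) m =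
        (\<Sum>k\<in>?D. mfps_nth g k * mfps_nth (mfps_power_product \<phi> (\<lambda>v. k v + l v)) m)" for l
      unfolding mfps_power_product_add mult.commute[of "mfps_power_product \<phi> l"]
      by (rule mfps_nth_subst_mult[OF \<phi> order.refl])
    then show ?thesis
      by (simp add: mfps_nth_subst_mult[OF \<phi> order.refl] sum_distrib_left sum.cartesian_product)
  qed
  also have "\<dots> = sum ?t (SIGMA l:?D. {k. multi_degree l + multi_degree k \<le> ?n})"
  proof (rule sum.mono_neutral_right)
    show "finite (?D \<times> ?D)" by (simp add: finite_multi_degree_le)
    have "multi_degree (\<lambda>v. k v + l v) = multi_degree l + multi_degree k" for k l :: "'v \<Rightarrow> nat"
      by (simp add: multi_degree_def sum.distrib)
    then have "mfps_nth (mfps_power_product \<phi> (\<lambda>v. k v + l v)) m = 0"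
      if "\<not> multi_degree l + multi_degree k \<le> ?n" for k l
      using that by (intro mfps_nth_power_product_eq_0[OF \<phi>]) simp
    then show "\<forall>x\<in>?D \<times> ?D - (SIGMA l:?D. {k. multi_degree l + multi_degree k \<le> ?n}). ?t x = 0"
      by force
  qed auto
  also have "\<dots> = (\<Sum>(j, a)\<in>(SIGMA j:?D. {a. a \<le> j}).
      mfps_nth f a * (mfps_nth g (j - a) * mfps_nth (mfps_power_product \<phi> j) m))"
  proof (rule sum.reindex_bij_witness[where j = "\<lambda>(l, k). (\<lambda>v. k v + l v, l)" and i = "\<lambda>(j, a). (a, j - a)"],
      goal_cases)
    case (1 x)
    obtain l k where x: "x = (l, k)" by (cases x)
    have "(\<lambda>v. k v + l v) - l = k" by (simp add: fun_eq_iff)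
    then show ?case by (simp add: x)
  next
    case (2 x)
    obtain l k where x: "x = (l, k)" by (cases x)
    have "multi_degree (\<lambda>v. k v + l v) = multi_degree l + multi_degree k"
      by (simp add: multi_degree_def sum.distrib)
    with 2 show ?case by (simp add: x le_fun_def)
  next
    case (3 x)
    then obtain j a where x: "x = (j, a)" and "a \<le> j" by auto
    then have "(\<lambda>v. (j - a) v + a v) = j" by (simp add: le_fun_def fun_eq_iff)
    then show ?case by (simp add: x)
  next
    case (4 x)
    then obtain j a where "x = (j, a)" "a \<le> j" "multi_degree j \<le> ?n" by auto
    then show ?case
      using multi_degree_split[of a j] multi_degree_mono[of a j] by simp
  next
    case (5 x)
    obtain l k where x: "x = (l, k)" by (cases x)
    have "(\<lambda>v. k v + l v) - l = k" by (simp add: fun_eq_iff)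
    then show ?case by (simp add: x)
  qed
  also have "\<dots> = mfps_nth (mfps_subst (f * g) \<phi>) m"
  proof -
    have "mfps_nth (mfps_subst (f * g) \<phi>) m = (\<Sum>j\<in>?D. \<Sum>a | a \<le> j.
        mfps_nth f a * (mfps_nth g (j - a) * mfps_nth (mfps_power_product \<phi> j) m))"
      by (simp only: mfps_nth_subst[OF \<phi> order.refl] mfps_nth_mult sum_distrib_right mult.assoc)
    also have "\<dots> = (\<Sum>(j, a)\<in>(SIGMA j:?D. {a. a \<le> j}).
        mfps_nth f a * (mfps_nth g (j - a) * mfps_nth (mfps_power_product \<phi> j) m))"
      by (rule sum.Sigma) (simp_all add: finite_multi_degree_le finite_multi_index_le)
    finally show ?thesis ..
  qed
  finally show "mfps_nth (mfps_subst (f * g) \<phi>) m = mfps_nth (mfps_subst f \<phi> * mfps_subst g \<phi>) m" ..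
qed

lemma mfps_subst_power: "const_free \<phi> \<Longrightarrow> mfps_subst (f ^ n) \<phi> = mfps_subst f \<phi> ^ n"
  by (induction n) (auto simp: mfps_subst_mult)

lemma mfps_subst_prod:
  "const_free \<phi> \<Longrightarrow> mfps_subst (\<Prod>i\<in>I. f i) \<phi> = (\<Prod>i\<in>I. mfps_subst (f i) \<phi>)"
  by (induction I rule: infinite_finite_induct) (auto simp: mfps_subst_mult)

text \<open>Substitution of \<open>\<psi>\<close> is a ring homomorphism and so carries power
  products to power products. Both sides become the same double sum, truncated at the degree of
  \<open>m\<close>.\<close>

lemma mfps_subst_compose:
  fixes \<phi> :: "'v::finite \<Rightarrow> ('w::finite, 'a::comm_ring_1) mfps" and \<psi> :: "'w \<Rightarrow> ('u::finite, 'a) mfps"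
  assumes \<phi>: "const_free \<phi>" and \<psi>: "const_free \<psi>"
  shows "mfps_subst (mfps_subst f \<phi>) \<psi> = mfps_subst f (\<lambda>v. mfps_subst (\<phi> v) \<psi>)"
proof (rule mfps_eqI)
  fix m :: "'u \<Rightarrow> nat"
  let ?n = "multi_degree m"
  have cf: "const_free (\<lambda>v. mfps_subst (\<phi> v) \<psi>)"
    using \<phi> by (simp add: const_free_def const_free_subst)
  have "mfps_nth (mfps_subst (mfps_subst f \<phi>) \<psi>) m =
      (\<Sum>k | multi_degree k \<le> ?n. \<Sum>l | multi_degree l \<le> ?n.
        mfps_nth f l * (mfps_nth (mfps_power_product \<phi> l) k * mfps_nth (mfps_power_product \<psi> k) m))"
    unfolding mfps_nth_subst[OF \<psi> order.refl, where m = m]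
  proof (rule sum.cong)
    fix k :: "'w \<Rightarrow> nat" assume "k \<in> {k. multi_degree k \<le> ?n}"
    then have "mfps_nth (mfps_subst f \<phi>) k =
        (\<Sum>l | multi_degree l \<le> ?n. mfps_nth f l * mfps_nth (mfps_power_product \<phi> l) k)"
      by (intro mfps_nth_subst[OF \<phi>]) simp
    then show "mfps_nth (mfps_subst f \<phi>) k * mfps_nth (mfps_power_product \<psi> k) m =
        (\<Sum>l | multi_degree l \<le> ?n.
          mfps_nth f l * (mfps_nth (mfps_power_product \<phi> l) k * mfps_nth (mfps_power_product \<psi> k) m))"
      by (simp only: sum_distrib_right mult.assoc)
  qed simp
  also have "\<dots> = (\<Sum>l | multi_degree l \<le> ?n. mfps_nth f l *
      mfps_nth (mfps_subst (mfps_power_product \<phi> l) \<psi>) m)"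
    by (subst sum.swap) (simp only: mfps_nth_subst[OF \<psi> order.refl] sum_distrib_left)
  also have "\<dots> = mfps_nth (mfps_subst f (\<lambda>v. mfps_subst (\<phi> v) \<psi>)) m"
    by (simp add: mfps_nth_subst[OF cf order.refl] mfps_power_product_def
        mfps_subst_prod[OF \<psi>] mfps_subst_power[OF \<psi>])
  finally show "mfps_nth (mfps_subst (mfps_subst f \<phi>) \<psi>) m = mfps_nth (mfps_subst f (\<lambda>v. mfps_subst (\<phi> v) \<psi>)) m" .
qed

lemma mfps_nth_var: "mfps_nth (mfps_var v) m = (if m = (\<lambda>_. 0)(v := 1) then 1 else 0)"
  by (auto simp: mfps_var_def fun_upd_def)

lemma mfps_nth_var_0 [simp]: "mfps_nth (mfps_var v) (\<lambda>_. 0) = 0"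
  by (auto simp: mfps_nth_var fun_eq_iff)

lemma multi_degree_single [simp]: "multi_degree ((\<lambda>_. 0)(v := n)) = n"
  by (simp add: multi_degree_def if_distrib fun_upd_def)

lemma mfps_power_product_single: "mfps_power_product \<phi> ((\<lambda>_. 0)(v := n)) = \<phi> v ^ n"
proof -
  have "mfps_power_product \<phi> ((\<lambda>_. 0)(v := n)) = (\<Prod>w\<in>UNIV. if w = v then \<phi> w ^ n else 1)"
    unfolding mfps_power_product_def by (rule prod.cong) auto
  then show ?thesis by simp
qed

lemma mfps_subst_var:
  assumes "const_free \<phi>"
  shows "mfps_subst (mfps_var v) \<phi> = \<phi> v"
proof (rule mfps_eqI)
  fix m
  have "mfps_nth (mfps_subst (mfps_var v) \<phi>) m =
     (\<Sum>k | multi_degree k \<le> Suc (multi_degree m).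
       if k = (\<lambda>_. 0)(v := 1) then mfps_nth (mfps_power_product \<phi> k) m else 0)"
    unfolding mfps_nth_subst[OF assms, of m "Suc (multi_degree m)", simplified]
    by (rule sum.cong) (auto simp: mfps_nth_var)
  also have "\<dots> = mfps_nth (\<phi> v) m"
    by (subst sum.delta[OF finite_multi_degree_le]) (simp add: mfps_power_product_single del: fun_upd_apply)
  finally show "mfps_nth (mfps_subst (mfps_var v) \<phi>) m = mfps_nth (\<phi> v) m" .
qed

section \<open>Formal partial derivatives and the chain rule\<close>

definition mfps_deriv :: "'v \<Rightarrow> ('v::finite, 'a::comm_ring_1) mfps \<Rightarrow> ('v, 'a) mfps" where
  "mfps_deriv v f = Abs_mfps (\<lambda>m. of_nat (Suc (m v)) * mfps_nth f (m(v := Suc (m v))))"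

lemma mfps_nth_var_mult:
  "mfps_nth (mfps_var v * f) m = (if m v = 0 then 0 else mfps_nth f (m(v := m v - 1)))"
proof -
  have e: "(\<lambda>_. 0)(v := 1) \<le> m \<longleftrightarrow> m v \<noteq> 0"
    by (auto simp: le_fun_def fun_upd_def)
  have d: "m - (\<lambda>_. 0)(v := 1) = m(v := m v - 1)"
    by (auto simp: fun_eq_iff)
  have "mfps_nth (mfps_var v * f) m =
      (\<Sum>a | a \<le> m. if a = (\<lambda>_. 0)(v := 1) then mfps_nth f (m - a) else 0)"
    unfolding mfps_nth_mult by (rule sum.cong) (auto simp: mfps_nth_var)
  also have "\<dots> = (if m v = 0 then 0 else mfps_nth f (m(v := m v - 1)))"
    unfolding sum.delta[OF finite_multi_index_le] by (simp only: mem_Collect_eq e d) simp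
  finally show ?thesis .
qed

lemma mfps_var_mult_cancel: "mfps_var v * f = mfps_var v * g \<Longrightarrow> f = g"
proof (rule mfps_eqI)
  fix m assume "mfps_var v * f = mfps_var v * g"
  then have "mfps_nth (mfps_var v * f) (m(v := Suc (m v))) = mfps_nth (mfps_var v * g) (m(v := Suc (m v)))"
    by simp
  then show "mfps_nth f m = mfps_nth g m" by (simp add: mfps_nth_var_mult)
qed

lemma mfps_nth_var_mult_deriv: "mfps_nth (mfps_var v * mfps_deriv v f) m = of_nat (m v) * mfps_nth f m"
  by (simp add: mfps_nth_var_mult mfps_deriv_def)

lemma mfps_deriv_0 [simp]: "mfps_deriv v 0 = 0"
  by (rule mfps_eqI) (simp add: mfps_deriv_def)

lemma mfps_deriv_1 [simp]: "mfps_deriv v 1 = 0"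
  by (rule mfps_eqI) (auto simp: mfps_deriv_def fun_eq_iff intro!: exI[of _ v])

lemma mfps_deriv_var: "mfps_deriv v (mfps_var w) = (if v = w then 1 else 0)"
proof (rule mfps_eqI)
  fix m
  have "m(v := Suc (m v)) = (\<lambda>_. 0)(w := 1) \<longleftrightarrow> v = w \<and> m = (\<lambda>_. 0)"
    by (auto simp: fun_eq_iff split: if_splits)
  then show "mfps_nth (mfps_deriv v (mfps_var w)) m = mfps_nth (if v = w then 1 else 0) m"
    by (auto simp: mfps_deriv_def mfps_nth_var)
qed

text \<open>The Euler operator \<open>X\<^sub>v \<partial>\<^sub>v\<close> does not shift exponents, so the product rule is immediate for it.\<close>

lemma mfps_deriv_mult: "mfps_deriv v (f * g) = mfps_deriv v f * g + f * mfps_deriv v g"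
proof (rule mfps_var_mult_cancel[of v], rule mfps_eqI)
  fix m
  let ?X = "mfps_var v"
  have "mfps_nth (?X * mfps_deriv v (f * g)) m =
      (\<Sum>a | a \<le> m. (of_nat (a v) + of_nat ((m - a) v)) * (mfps_nth f a * mfps_nth g (m - a)))"
    unfolding mfps_nth_var_mult_deriv unfolding mfps_nth_mult sum_distrib_left
  proof (rule sum.cong)
    fix a assume "a \<in> {a. a \<le> m}"
    then have "m v = a v + (m - a) v" by (simp add: le_fun_def)
    then show "of_nat (m v) * (mfps_nth f a * mfps_nth g (m - a)) =
        (of_nat (a v) + of_nat ((m - a) v)) * (mfps_nth f a * mfps_nth g (m - a))"
      by (metis of_nat_add)
  qed simp
  also have "\<dots> = mfps_nth ((?X * mfps_deriv v f) * g) m + mfps_nth (f * (?X * mfps_deriv v g)) m"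
    unfolding mfps_nth_mult[of _ g] mfps_nth_mult[of f] mfps_nth_var_mult_deriv
    by (simp only: sum.distrib[symmetric]) (rule sum.cong, auto simp: algebra_simps)
  also have "\<dots> = mfps_nth (?X * (mfps_deriv v f * g + f * mfps_deriv v g)) m"
    by (simp add: algebra_simps)
  finally show "mfps_nth (?X * mfps_deriv v (f * g)) m = mfps_nth (?X * (mfps_deriv v f * g + f * mfps_deriv v g)) m" .
qed

lemma mfps_deriv_power: "mfps_deriv v (f ^ n) = of_nat n * f ^ (n - 1) * mfps_deriv v f"
proof (induction n)
  case (Suc n)
  then show ?case by (cases n) (auto simp: mfps_deriv_mult algebra_simps)
qed simp

lemma mfps_deriv_prod:
  assumes "finite I"
  shows "mfps_deriv v (\<Prod>i\<in>I. f i) = (\<Sum>i\<in>I. mfps_deriv v (f i) * (\<Prod>j\<in>I - {i}. f j))"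
  using assms
proof induction
  case (insert x I)
  have "(\<Sum>i\<in>I. mfps_deriv v (f i) * (\<Prod>j\<in>insert x I - {i}. f j)) =
      (\<Sum>i\<in>I. f x * (mfps_deriv v (f i) * (\<Prod>j\<in>I - {i}. f j)))"
  proof (rule sum.cong)
    fix i assume "i \<in> I"
    with insert have "insert x I - {i} = insert x (I - {i})" by auto
    with insert show "mfps_deriv v (f i) * (\<Prod>j\<in>insert x I - {i}. f j) =
        f x * (mfps_deriv v (f i) * (\<Prod>j\<in>I - {i}. f j))"
      by (simp add: algebra_simps)
  qed simp
  moreover have "insert x I - {x} = I" using insert by auto
  ultimately show ?case
    using insert by (simp add: mfps_deriv_mult sum_distrib_left)
qed simp

text \<open>For \<open>k u = 0\<close> the truncated difference \<open>k u - 1\<close> is harmless,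
  since the summand carries the factor \<open>of_nat (k u)\<close>.\<close>

lemma mfps_deriv_power_product:
  "mfps_deriv w (mfps_power_product \<phi> k) =
     (\<Sum>u\<in>UNIV. of_nat (k u) * (mfps_power_product \<phi> (k(u := k u - 1)) * mfps_deriv w (\<phi> u)))"
proof -
  have "mfps_power_product \<phi> (k(u := k u - 1)) = \<phi> u ^ (k u - 1) * (\<Prod>j\<in>UNIV - {u}. \<phi> j ^ k j)" for u
    unfolding mfps_power_product_def by (subst prod.remove[of _ u]) auto
  then show ?thesis
    unfolding mfps_power_product_def[of _ k]
    by (simp add: mfps_deriv_prod mfps_deriv_power mult_ac)
qed

text \<open>By linearity this reduces to power products. A coefficient of the derivative comes from
  one degree higher, hence the cut-off \<open>Suc ?n\<close>; terms with \<open>k u = 0\<close>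
  vanish, and the others are reindexed by lowering the exponent of \<open>u\<close>.\<close>

lemma mfps_chain_rule:
  fixes \<phi> :: "'v::finite \<Rightarrow> ('w::finite, 'a::comm_ring_1) mfps"
  assumes \<phi>: "const_free \<phi>"
  shows "mfps_deriv w (mfps_subst f \<phi>) = (\<Sum>u\<in>UNIV. mfps_subst (mfps_deriv u f) \<phi> * mfps_deriv w (\<phi> u))"
proof (rule mfps_eqI)
  fix m :: "'w \<Rightarrow> nat"
  let ?n = "multi_degree m"
  have "multi_degree (m(w := Suc (m w))) = Suc ?n"
    by (simp add: multi_degree_def sum.remove[of _ w])
  then have "mfps_nth (mfps_deriv w (mfps_subst f \<phi>)) m =
      (\<Sum>k | multi_degree k \<le> Suc ?n. mfps_nth f k * mfps_nth (mfps_deriv w (mfps_power_product \<phi> k)) m)"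
    by (simp add: mfps_deriv_def mfps_nth_subst[OF \<phi>, of _ "Suc ?n"] sum_distrib_left mult_ac)
  also have "\<dots> = (\<Sum>u\<in>UNIV. \<Sum>k | multi_degree k \<le> Suc ?n. mfps_nth f k * (of_nat (k u) *
      mfps_nth (mfps_power_product \<phi> (k(u := k u - 1)) * mfps_deriv w (\<phi> u)) m))"
    by (subst sum.swap) (simp add: mfps_deriv_power_product mfps_nth_sum mfps_nth_of_nat_mult sum_distrib_left)
  also have "\<dots> = (\<Sum>u\<in>UNIV. \<Sum>k | multi_degree k \<le> ?n. mfps_nth (mfps_deriv u f) k *
      mfps_nth (mfps_power_product \<phi> k * mfps_deriv w (\<phi> u)) m)"
  proof (rule sum.cong)
    fix u
    have deg: "multi_degree (k(u := Suc (k u))) = Suc (multi_degree k)" for k :: "'v \<Rightarrow> nat"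
      by (simp add: multi_degree_def sum.remove[of _ u])
    have "(\<Sum>k | multi_degree k \<le> Suc ?n. mfps_nth f k * (of_nat (k u) *
        mfps_nth (mfps_power_product \<phi> (k(u := k u - 1)) * mfps_deriv w (\<phi> u)) m)) =
      (\<Sum>k | multi_degree k \<le> Suc ?n \<and> k u \<noteq> 0. mfps_nth f k * (of_nat (k u) *
        mfps_nth (mfps_power_product \<phi> (k(u := k u - 1)) * mfps_deriv w (\<phi> u)) m))"
      by (rule sum.mono_neutral_right[OF finite_multi_degree_le]) auto
    also have "\<dots> = (\<Sum>k | multi_degree k \<le> ?n. mfps_nth (mfps_deriv u f) k *
      mfps_nth (mfps_power_product \<phi> k * mfps_deriv w (\<phi> u)) m)"
    proof (rule sum.reindex_bij_witness[where i = "\<lambda>k. k(u := Suc (k u))" and j = "\<lambda>k. k(u := k u - 1)"],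
        goal_cases)
      case (2 k)
      then show ?case using deg[of "k(u := k u - 1)"] by simp
    qed (auto simp: deg mfps_deriv_def mult_ac)
    finally show "(\<Sum>k | multi_degree k \<le> Suc ?n. mfps_nth f k * (of_nat (k u) *
        mfps_nth (mfps_power_product \<phi> (k(u := k u - 1)) * mfps_deriv w (\<phi> u)) m)) = \<dots>" .
  qed simp
  also have "\<dots> = mfps_nth (\<Sum>u\<in>UNIV. mfps_subst (mfps_deriv u f) \<phi> * mfps_deriv w (\<phi> u)) m"
    by (simp add: mfps_nth_sum mfps_nth_subst_mult[OF \<phi> order.refl])
  finally show "mfps_nth (mfps_deriv w (mfps_subst f \<phi>)) m = \<dots>" .
qed

section \<open>The Jacobian of multiplication by \<open>n\<close> on a formal group\<close>

lemma sum_UNIV_Plus: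
  "(\<Sum>x\<in>UNIV. f x) = (\<Sum>a\<in>UNIV. f (Inl a)) + (\<Sum>b\<in>UNIV. f (Inr b))"
  for f :: "'a::finite + 'b::finite \<Rightarrow> 'c::comm_monoid_add"
  using sum.Plus[of "UNIV :: 'a set" "UNIV :: 'b set" f] by simp

definition formal_add ::
    "('n::finite \<Rightarrow> ('n + 'n, 'a::comm_ring_1) mfps) \<Rightarrow> ('n \<Rightarrow> ('w::finite, 'a) mfps) \<Rightarrow> ('n \<Rightarrow> ('w, 'a) mfps)
      \<Rightarrow> 'n \<Rightarrow> ('w, 'a) mfps" where
  "formal_add F a b i = mfps_subst (F i) (case_sum a b)"

text \<open>The matrix of \<open>\<partial>F(X, Y)/\<partial>Y\<close> at \<open>X = a\<close>, \<open>Y = 0\<close>, whose inverse describes the invariant differentials.\<close>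

definition right_jacobian ::
    "('n::finite \<Rightarrow> ('n + 'n, 'a::comm_ring_1) mfps) \<Rightarrow> ('n \<Rightarrow> ('w::finite, 'a) mfps)
      \<Rightarrow> 'n \<Rightarrow> 'n \<Rightarrow> ('w, 'a) mfps" where
  "right_jacobian F a i v = mfps_subst (mfps_deriv (Inr v) (F i)) (case_sum a (\<lambda>_. 0))"

lemma const_free_case_sum: "const_free a \<Longrightarrow> const_free b \<Longrightarrow> const_free (case_sum a b)"
  by (auto simp: const_free_def split: sum.splits)

lemma const_free_0 [simp]: "const_free (\<lambda>_. 0)"
  by (simp add: const_free_def)

lemma const_free_vars [simp]: "const_free (\<lambda>j. mfps_var (g j))" "const_free mfps_var"
  by (simp_all add: const_free_def)

lemma mfps_nth_subst_const: "mfps_nth (mfps_subst f \<phi>) (\<lambda>_. 0) = mfps_nth f (\<lambda>_. 0)"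
  by (simp add: mfps_subst_def)

context
  fixes A :: "'a::comm_ring_1 set" and F :: "'n::finite \<Rightarrow> ('n + 'n, 'a) mfps"
  assumes F: "formal_group_law A F"
begin

lemma formal_group_const: "mfps_nth (F i) (\<lambda>_. 0) = 0"
proof -
  have "mfps_subst (F i) (case_sum mfps_var (\<lambda>_. 0)) = mfps_var i"
    using F by (simp add: formal_group_law_def)
  then show ?thesis
    using mfps_nth_subst_const[of "F i"] by (metis mfps_nth_var_0)
qed

lemma const_free_formal_add: "const_free (formal_add F a b)"
  by (simp add: const_free_def formal_add_def mfps_nth_subst_const formal_group_const)

lemma const_free_formal_mult: "const_free (formal_mult F n)"
  by (cases n) (simp_all add: const_free_def mfps_nth_subst_const formal_group_const)

lemma formal_mult_Suc: "formal_mult F (Suc n) = formal_add F (formal_mult F n) mfps_var"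
  by (simp add: formal_add_def fun_eq_iff)

lemma mfps_subst_case_sum:
  assumes "const_free a" "const_free b" "const_free \<psi>"
  shows "mfps_subst (mfps_subst G (case_sum a b)) \<psi> =
    mfps_subst G (case_sum (\<lambda>j. mfps_subst (a j) \<psi>) (\<lambda>j. mfps_subst (b j) \<psi>))"
proof -
  have "(\<lambda>w. mfps_subst (case_sum a b w) \<psi>) = case_sum (\<lambda>j. mfps_subst (a j) \<psi>) (\<lambda>j. mfps_subst (b j) \<psi>)"
    by (auto split: sum.splits)
  then show ?thesis
    using mfps_subst_compose[OF const_free_case_sum[OF assms(1,2)] assms(3), of G] by simp
qed

lemma formal_add_subst:
  assumes "const_free a" "const_free b" "const_free \<psi>"
  shows "mfps_subst (formal_add F a b i) \<psi> =
    formal_add F (\<lambda>j. mfps_subst (a j) \<psi>) (\<lambda>j. mfps_subst (b j) \<psi>) i"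
  unfolding formal_add_def by (rule mfps_subst_case_sum[OF assms])

lemma mfps_deriv_formal_add:
  assumes "const_free a" "const_free b"
  shows "mfps_deriv w (formal_add F a b i) =
    (\<Sum>u\<in>UNIV. mfps_subst (mfps_deriv (Inl u) (F i)) (case_sum a b) * mfps_deriv w (a u)) +
    (\<Sum>u\<in>UNIV. mfps_subst (mfps_deriv (Inr u) (F i)) (case_sum a b) * mfps_deriv w (b u))"
  unfolding formal_add_def mfps_chain_rule[OF const_free_case_sum[OF assms]] sum_UNIV_Plus by simp

lemma formal_add_assoc_vars:
  defines "x \<equiv> (\<lambda>j. mfps_var (Inl j)) :: 'n \<Rightarrow> ('n + 'n + 'n, 'a) mfps"
    and "y \<equiv> (\<lambda>j. mfps_var (Inr (Inl j))) :: 'n \<Rightarrow> ('n + 'n + 'n, 'a) mfps"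
    and "z \<equiv> (\<lambda>j. mfps_var (Inr (Inr j))) :: 'n \<Rightarrow> ('n + 'n + 'n, 'a) mfps"
  shows "formal_add F (formal_add F x y) z i = formal_add F x (formal_add F y z) i"
proof -
  have "formal_add F a b = (\<lambda>i. mfps_subst (F i) (case_sum a b))" for a b :: "'n \<Rightarrow> ('n + 'n + 'n, 'a) mfps"
    by (simp add: formal_add_def fun_eq_iff)
  then show ?thesis
    using F by (simp add: formal_group_law_def Let_def x_def y_def z_def)
qed

lemma formal_add_comm_vars:
  "formal_add F (\<lambda>j. mfps_var (Inr j)) (\<lambda>j. mfps_var (Inl j)) i = F i"
  using F by (simp add: formal_group_law_def formal_add_def)

lemma formal_add_commute:
  assumes "const_free a" "const_free b"
  shows "formal_add F a b = formal_add F b a"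
proof
  fix i
  have "formal_add F a b i = mfps_subst (formal_add F (\<lambda>j. mfps_var (Inr j)) (\<lambda>j. mfps_var (Inl j)) i) (case_sum a b)"
    by (simp only: formal_add_comm_vars) (simp only: formal_add_def)
  also have "\<dots> = formal_add F b a i"
    by (simp add: formal_add_subst const_free_case_sum assms mfps_subst_var)
  finally show "formal_add F a b i = formal_add F b a i" .
qed

lemma sum_mult_kronecker:
  fixes f :: "'n \<Rightarrow> 'b::comm_ring_1"
  shows "(\<Sum>u\<in>UNIV. f u * (if v = u then 1 else 0)) = f v" "(\<Sum>u\<in>UNIV. f u * (if u = v then 1 else 0)) = f v"
  by (simp_all add: if_distrib cong: if_cong)

text \<open>Differentiating the commutativity law exchanges the two slots, so derivatives in the
  first slot can be expressed through those in the second.\<close>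

lemma mfps_subst_deriv_Inl:
  assumes "const_free a" "const_free b"
  shows "mfps_subst (mfps_deriv (Inl u) (F i)) (case_sum a b) = mfps_subst (mfps_deriv (Inr u) (F i)) (case_sum b a)"
proof -
  let ?r = "\<lambda>j. mfps_var (Inr j) :: ('n + 'n, 'a) mfps" and ?l = "\<lambda>j. mfps_var (Inl j) :: ('n + 'n, 'a) mfps"
  have "mfps_deriv (Inl u) (F i) = mfps_deriv (Inl u) (formal_add F ?r ?l i)"
    by (simp add: formal_add_comm_vars)
  also have "\<dots> = mfps_subst (mfps_deriv (Inr u) (F i)) (case_sum ?r ?l)"
    by (simp add: mfps_deriv_formal_add mfps_deriv_var sum_mult_kronecker)
  finally show ?thesis
    by (simp add: mfps_subst_case_sum const_free_case_sum assms mfps_subst_var)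
qed

text \<open>Differentiate \<open>F(F(X, Y), Z) = F(X, F(Y, Z))\<close> with respect to \<open>Z\<close> and put \<open>X = a\<close>, \<open>Y = b\<close>, \<open>Z = 0\<close>.\<close>

lemma right_jacobian_add:
  fixes a b :: "'n \<Rightarrow> ('w::finite, 'a) mfps"
  assumes ab: "const_free a" "const_free b"
  shows "right_jacobian F (formal_add F a b) i v =
    (\<Sum>u\<in>UNIV. mfps_subst (mfps_deriv (Inr u) (F i)) (case_sum a b) * right_jacobian F b u v)"
proof -
  define x where "x = (\<lambda>j. mfps_var (Inl j) :: ('n + 'n + 'n, 'a) mfps)"
  define y where "y = (\<lambda>j. mfps_var (Inr (Inl j)) :: ('n + 'n + 'n, 'a) mfps)"
  define z where "z = (\<lambda>j. mfps_var (Inr (Inr j)) :: ('n + 'n + 'n, 'a) mfps)"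
  define \<psi> where "\<psi> = case_sum a (case_sum b (\<lambda>_ :: 'n. 0 :: ('w, 'a) mfps))"
  let ?d = "mfps_deriv (Inr (Inr v)) :: ('n + 'n + 'n, 'a) mfps \<Rightarrow> _"
  have cf [simp]: "const_free x" "const_free y" "const_free z" "const_free \<psi>"
    by (simp_all add: x_def y_def z_def \<psi>_def ab const_free_case_sum)
  have [simp]: "mfps_subst (x j) \<psi> = a j" "mfps_subst (y j) \<psi> = b j" "mfps_subst (z j) \<psi> = 0" for j
    by (simp_all add: x_def y_def z_def mfps_subst_var) (simp_all add: \<psi>_def)
  have [simp]: "?d (x j) = 0" "?d (y j) = 0" "?d (z j) = (if j = v then 1 else 0)" for j
    by (auto simp: x_def y_def z_def mfps_deriv_var)
  have "?d (formal_add F (formal_add F x y) z i) =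
      mfps_subst (mfps_deriv (Inr v) (F i)) (case_sum (formal_add F x y) z)"
    by (simp add: mfps_deriv_formal_add const_free_formal_add sum_mult_kronecker)
  moreover have "?d (formal_add F x (formal_add F y z) i) =
      (\<Sum>u\<in>UNIV. mfps_subst (mfps_deriv (Inr u) (F i)) (case_sum x (formal_add F y z)) *
        mfps_subst (mfps_deriv (Inr v) (F u)) (case_sum y z))"
    by (simp add: mfps_deriv_formal_add const_free_formal_add sum_mult_kronecker)
  ultimately have "mfps_subst (mfps_subst (mfps_deriv (Inr v) (F i)) (case_sum (formal_add F x y) z)) \<psi> =
      mfps_subst (\<Sum>u\<in>UNIV. mfps_subst (mfps_deriv (Inr u) (F i)) (case_sum x (formal_add F y z)) *
        mfps_subst (mfps_deriv (Inr v) (F u)) (case_sum y z)) \<psi>"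
    using formal_add_assoc_vars[of i] by (simp add: x_def y_def z_def)
  moreover have "formal_add F b (\<lambda>_. 0) = b"
  proof
    fix i
    have "mfps_subst (mfps_subst (F i) (case_sum mfps_var (\<lambda>_. 0))) b = mfps_subst (mfps_var i) b"
      using F by (simp add: formal_group_law_def)
    then show "formal_add F b (\<lambda>_. 0) i = b i"
      by (simp add: mfps_subst_case_sum mfps_subst_var ab formal_add_def)
  qed
  ultimately show ?thesis
    by (simp add: mfps_subst_case_sum const_free_formal_add mfps_subst_sum mfps_subst_mult
        formal_add_subst right_jacobian_def eta_contract_eq)
qed

lemma right_jacobian_add':
  assumes "const_free a" "const_free b"
  shows "right_jacobian F (formal_add F a b) i v =
    (\<Sum>u\<in>UNIV. mfps_subst (mfps_deriv (Inl u) (F i)) (case_sum a b) * right_jacobian F a u v)"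
  by (simp add: formal_add_commute[OF assms] right_jacobian_add assms mfps_subst_deriv_Inl)

text \<open>In other words, [n] multiplies the invariant differentials by n. In the induction step
  [n + 1] = F([n], X), and the two halves of the chain rule carry the matrix at [n] and the matrix
  at X to the matrix at [n + 1], by \<open>right_jacobian_add'\<close> and
  \<open>right_jacobian_add\<close>. They contribute \<open>n\<close> copies and one copy.\<close>

lemma jacobian_formal_mult:
  "(\<Sum>w\<in>UNIV. mfps_deriv w (formal_mult F n i) * right_jacobian F mfps_var w v) =
    of_nat n * right_jacobian F (formal_mult F n) i v"
proof (induction n arbitrary: i)
  case (Suc n)
  let ?S = "formal_mult F n"
  let ?P = "\<lambda>u. mfps_subst (mfps_deriv (Inl u) (F i)) (case_sum ?S mfps_var)"
  let ?Q = "\<lambda>u. mfps_subst (mfps_deriv (Inr u) (F i)) (case_sum ?S mfps_var)"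
  let ?R = "\<lambda>w. right_jacobian F mfps_var w v"
  have d: "mfps_deriv w (formal_mult F (Suc n) i) = (\<Sum>u\<in>UNIV. ?P u * mfps_deriv w (?S u)) + ?Q w" for w
    unfolding formal_mult_Suc
    by (simp add: mfps_deriv_formal_add const_free_formal_mult mfps_deriv_var sum_mult_kronecker)
  have "(\<Sum>w\<in>UNIV. mfps_deriv w (formal_mult F (Suc n) i) * ?R w) =
      (\<Sum>w\<in>UNIV. \<Sum>u\<in>UNIV. ?P u * (mfps_deriv w (?S u) * ?R w)) + (\<Sum>w\<in>UNIV. ?Q w * ?R w)"
    by (simp only: d distrib_right sum_distrib_right sum.distrib mult.assoc)
  also have "(\<Sum>w\<in>UNIV. \<Sum>u\<in>UNIV. ?P u * (mfps_deriv w (?S u) * ?R w)) =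
      (\<Sum>u\<in>UNIV. ?P u * (\<Sum>w\<in>UNIV. mfps_deriv w (?S u) * ?R w))"
    by (subst sum.swap) (simp only: sum_distrib_left)
  also have "\<dots> = of_nat n * right_jacobian F (formal_mult F (Suc n)) i v"
    unfolding Suc formal_mult_Suc right_jacobian_add'[OF const_free_formal_mult const_free_vars(2)]
    by (simp only: sum_distrib_left mult.left_commute)
  also have "(\<Sum>w\<in>UNIV. ?Q w * ?R w) = right_jacobian F (formal_mult F (Suc n)) i v"
    unfolding formal_mult_Suc right_jacobian_add[OF const_free_formal_mult const_free_vars(2)] ..
  finally show ?case
    by (simp only: of_nat_Suc distrib_right mult_1_left add.commute)
qed simp

text \<open>Comes from differentiating F(0, Y) = Y. Being the identity at the origin is what later
  allows the Jacobian of [n] to be solved for.\<close>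

lemma right_jacobian_const:
  "mfps_nth (right_jacobian F a i v) (\<lambda>_. 0) = (if i = v then 1 else 0)"
proof -
  have "formal_add F (\<lambda>_. 0) mfps_var i = mfps_var i"
    using F by (simp add: formal_group_law_def formal_add_def)
  then have "mfps_deriv v (formal_add F (\<lambda>_. 0) mfps_var i) = mfps_deriv v (mfps_var i)" by simp
  then have "mfps_subst (mfps_deriv (Inr v) (F i)) (case_sum (\<lambda>_. 0) mfps_var) = (if v = i then 1 else 0)"
    by (simp add: mfps_deriv_formal_add mfps_deriv_var sum_mult_kronecker)
  then have "mfps_nth (mfps_deriv (Inr v) (F i)) (\<lambda>_. 0) = (if i = v then 1 else 0)"
    using mfps_nth_subst_const[of "mfps_deriv (Inr v) (F i)" "case_sum (\<lambda>_. 0) (mfps_var :: 'n \<Rightarrow> ('n, 'a) mfps)"]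
    by (auto split: if_splits)
  then show ?thesis
    by (auto simp: right_jacobian_def mfps_nth_subst_const)
qed

end

section \<open>Integrality and divisibility of coefficients\<close>

text \<open>Isolates the closure properties behind integrality: products, substitution and
  differentiation of series only add and multiply coefficients.\<close>

locale coefficient_ring =
  fixes A :: "'a::comm_ring_1 set"
  assumes zero_mem: "0 \<in> A" and one_mem: "1 \<in> A"
    and add_mem: "x \<in> A \<Longrightarrow> y \<in> A \<Longrightarrow> x + y \<in> A"
    and mult_mem: "x \<in> A \<Longrightarrow> y \<in> A \<Longrightarrow> x * y \<in> A"
begin

definition series_over :: "('v::finite, 'a) mfps \<Rightarrow> bool" where
  "series_over f \<longleftrightarrow> (\<forall>m. mfps_nth f m \<in> A)"

lemma sum_mem: "(\<And>i. i \<in> I \<Longrightarrow> f i \<in> A) \<Longrightarrow> sum f I \<in> A"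
  by (induction I rule: infinite_finite_induct) (auto intro: add_mem zero_mem)

lemma of_nat_mem: "of_nat n \<in> A"
  by (induction n) (auto intro: add_mem zero_mem one_mem)

lemma series_over_basic: "series_over 0" "series_over 1" "series_over (mfps_var v)"
  by (auto simp: series_over_def zero_mem one_mem mfps_nth_var)

lemma series_over_mult: "series_over f \<Longrightarrow> series_over g \<Longrightarrow> series_over (f * g)"
  by (auto simp: series_over_def mfps_nth_mult intro: sum_mem mult_mem)

lemma series_over_power: "series_over f \<Longrightarrow> series_over (f ^ n)"
  by (induction n) (auto intro: series_over_mult series_over_basic)

lemma series_over_prod: "(\<And>i. i \<in> I \<Longrightarrow> series_over (f i)) \<Longrightarrow> series_over (prod f I)"
  by (induction I rule: infinite_finite_induct) (auto intro: series_over_mult series_over_basic)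

lemma series_over_subst:
  assumes "series_over f" "\<And>v. series_over (\<phi> v)"
  shows "series_over (mfps_subst f \<phi>)"
proof -
  have "series_over (\<Prod>v\<in>UNIV. \<phi> v ^ k v)" for k
    by (intro series_over_prod series_over_power assms)
  then have "mfps_nth f k * mfps_nth (\<Prod>v\<in>UNIV. \<phi> v ^ k v) m \<in> A" for k m
    using assms(1) unfolding series_over_def by (intro mult_mem) blast+
  then show ?thesis
    unfolding series_over_def mfps_subst_def mfps_nth_Abs by (intro allI sum_mem)
qed

lemma series_over_deriv: "series_over f \<Longrightarrow> series_over (mfps_deriv v f)"
  unfolding series_over_def mfps_deriv_def mfps_nth_Abs by (intro allI mult_mem of_nat_mem) blast

lemma series_over_formal_mult:
  assumes "formal_group_law A F"
  shows "series_over (formal_mult F n i)"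
proof (induction n arbitrary: i)
  case (Suc n)
  have "series_over (F i)" using assms by (simp add: formal_group_law_def series_over_def)
  moreover have "series_over (case_sum (formal_mult F n) mfps_var v)" for v
    by (cases v) (auto simp: Suc series_over_basic)
  ultimately show ?case by (simp add: series_over_subst)
qed (simp add: series_over_basic)

lemma series_over_right_jacobian:
  assumes "formal_group_law A F" "\<And>i. series_over (a i)"
  shows "series_over (right_jacobian F a i v)"
proof -
  have "series_over (F i)" using assms by (simp add: formal_group_law_def series_over_def)
  moreover have "series_over (case_sum a (\<lambda>_. 0) v)" for v
    by (cases v) (auto simp: assms series_over_basic)
  ultimately show ?thesis
    unfolding right_jacobian_def by (intro series_over_subst series_over_deriv)
qed

end

lemma absv_sum_le:
  assumes "0 \<le> B" "\<And>i. i \<in> I \<Longrightarrow> absv (f i) \<le> B"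
  shows "absv (sum f I) \<le> (B :: real)"
  using assms(2)
proof (induction I rule: infinite_finite_induct)
  case (insert x I)
  then have "max (absv (f x)) (absv (sum f I)) \<le> B" by simp
  then show ?case
    using insert by (simp add: order_trans[OF absv_add])
qed (auto simp: assms(1))

lemma absv_mult_le:
  assumes "absv x \<le> B" "absv y \<le> 1"
  shows "absv (x * y) \<le> B"
proof -
  have "absv x * absv y \<le> absv x * 1"
    using assms(2) by (intro mult_left_mono) auto
  then show ?thesis
    using assms(1) by (simp add: absv_mult)
qed

lemma coefficient_ring_valuation_ring:
  fixes K :: "'a::nonarch_field set"
  assumes "0 \<in> K" "1 \<in> K" "\<And>x y. x \<in> K \<Longrightarrow> y \<in> K \<Longrightarrow> x + y \<in> K" "\<And>x y. x \<in> K \<Longrightarrow> y \<in> K \<Longrightarrow> x * y \<in> K"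
  shows "coefficient_ring (valuation_ring K)"
  by standard (auto simp: valuation_ring_def assms absv_add_le_1 absv_mult_le_1)

context
  fixes A :: "'a::nonarch_field set" and F :: "'n::finite \<Rightarrow> ('n + 'n, 'a) mfps" and n :: nat
  assumes F: "formal_group_law A F" and A: "coefficient_ring A" and integral: "\<And>x. x \<in> A \<Longrightarrow> absv x \<le> 1"
begin

text \<open>Instead of inverting a matrix of power series, \<open>jacobian_formal_mult\<close> is
  solved for the coefficient at \<open>m\<close> by induction on its degree. The matrix is the
  identity at the origin, so the remaining terms contain the Jacobian only in lower degrees, with
  integral factors.\<close>

lemma absv_deriv_formal_mult_le:
  "absv (mfps_nth (mfps_deriv v (formal_mult F n i)) m) \<le> absv (of_nat n :: 'a)"
proof (induction "multi_degree m" arbitrary: m v rule: less_induct)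
  case less
  interpret coefficient_ring A by (rule A)
  let ?J = "\<lambda>w. mfps_deriv w (formal_mult F n i)" and ?R = "\<lambda>w. right_jacobian F mfps_var w v"
  have R: "absv (mfps_nth (?R w) k) \<le> 1" for w k
    using series_over_right_jacobian[OF F, of mfps_var w v, OF series_over_basic(3)] integral
    by (auto simp: series_over_def)
  have T: "absv (mfps_nth (right_jacobian F (formal_mult F n) i v) m) \<le> 1"
    using series_over_right_jacobian[OF F, of "formal_mult F n" i v, OF series_over_formal_mult[OF F]] integral
    by (auto simp: series_over_def)
  have split: "mfps_nth (?J w * ?R w) m = mfps_nth (?J w) m * (if w = v then 1 else 0) +
      (\<Sum>a\<in>{a. a \<le> m} - {m}. mfps_nth (?J w) a * mfps_nth (?R w) (m - a))" for w
  proof -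
    have "m - m = (\<lambda>_. 0)" by (simp add: fun_eq_iff)
    then show ?thesis
      unfolding mfps_nth_mult by (subst sum.remove[of _ m])
        (auto simp: finite_multi_index_le right_jacobian_const[OF F])
  qed
  have "mfps_nth (\<Sum>w\<in>UNIV. ?J w * ?R w) m =
      mfps_nth (of_nat n * right_jacobian F (formal_mult F n) i v) m"
    by (simp only: jacobian_formal_mult[OF F])
  then have eq: "mfps_nth (?J v) m = of_nat n * mfps_nth (right_jacobian F (formal_mult F n) i v) m -
      (\<Sum>w\<in>UNIV. \<Sum>a\<in>{a. a \<le> m} - {m}. mfps_nth (?J w) a * mfps_nth (?R w) (m - a))"
    unfolding mfps_nth_sum split sum.distrib mfps_nth_of_nat_mult by (simp add: if_distrib eq_diff_eq cong: if_cong)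
  have "absv (\<Sum>w\<in>UNIV. \<Sum>a\<in>{a. a \<le> m} - {m}. mfps_nth (?J w) a * mfps_nth (?R w) (m - a)) \<le> absv (of_nat n :: 'a)"
  proof (intro absv_sum_le)
    fix w a assume a: "a \<in> {a. a \<le> m} - {m}"
    have "multi_degree (m - a) \<noteq> 0"
    proof
      assume "multi_degree (m - a) = 0"
      then have "m i - a i = 0" for i by (simp add: fun_eq_iff)
      then have "m \<le> a" by (simp add: le_fun_def)
      with a have "m = a" by (intro antisym) auto
      then show False using a by simp
    qed
    then have "multi_degree a < multi_degree m"
      using multi_degree_split[of a m] a by (simp del: multi_degree_eq_0_iff)
    then have "absv (mfps_nth (?J w) a) \<le> absv (of_nat n :: 'a)"
      by (rule less)
    then show "absv (mfps_nth (?J w) a * mfps_nth (?R w) (m - a)) \<le> absv (of_nat n :: 'a)"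
      using R by (rule absv_mult_le)
  qed simp_all
  moreover have "absv (of_nat n * mfps_nth (right_jacobian F (formal_mult F n) i v) m) \<le> absv (of_nat n :: 'a)"
    by (rule absv_mult_le[OF order.refl T])
  ultimately show ?case
    unfolding eq by (intro order_trans[OF absv_diff] max.boundedI)
qed

lemma formal_mult_const: "mfps_nth (formal_mult F n i) (\<lambda>_. 0) = 0"
  using const_free_formal_mult[OF F, of n] by (simp add: const_free_def)

text \<open>Read off from the constant coefficient of \<open>jacobian_formal_mult\<close>, where
  both matrices are the identity.\<close>

lemma formal_mult_linear:
  "mfps_nth (formal_mult F n i) ((\<lambda>_. 0)(v := 1)) = (if i = v then of_nat n else 0)"
proof -
  have "mfps_nth (\<Sum>w\<in>UNIV. mfps_deriv w (formal_mult F n i) * right_jacobian F mfps_var w v) (\<lambda>_. 0) =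
      mfps_nth (of_nat n * right_jacobian F (formal_mult F n) i v) (\<lambda>_. 0)"
    by (simp only: jacobian_formal_mult[OF F])
  then have "(\<Sum>w\<in>UNIV. mfps_nth (mfps_deriv w (formal_mult F n i) * right_jacobian F mfps_var w v) (\<lambda>_. 0)) =
      of_nat n * (if i = v then 1 else 0)"
    by (simp only: mfps_nth_sum mfps_nth_of_nat_mult right_jacobian_const[OF F])
  moreover have "mfps_nth (f * g) (\<lambda>_. 0) = mfps_nth f (\<lambda>_. 0) * mfps_nth g (\<lambda>_. 0)" for f g :: "('n, 'a) mfps"
  proof -
    have "{a :: 'n \<Rightarrow> nat. a \<le> (\<lambda>_. 0)} = {\<lambda>_. 0}" by (auto simp: le_fun_def)
    then show ?thesis by (simp add: mfps_nth_mult fun_diff_def)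
  qed
  ultimately have "mfps_nth (mfps_deriv v (formal_mult F n i)) (\<lambda>_. 0) = (if i = v then of_nat n else 0)"
    by (simp add: right_jacobian_const[OF F] sum_mult_kronecker[OF F])
  then show ?thesis
    by (simp add: mfps_deriv_def)
qed

text \<open>For \<open>m v > 0\<close> the product is a coefficient of the partial derivative in
  direction \<open>v\<close>. With \<open>n = p\<close> and a unit coefficient, the bound forces
  \<open>p\<close> to divide \<open>m v\<close>.\<close>

lemma absv_exponent_formal_mult_le:
  "absv (of_nat (m v) * mfps_nth (formal_mult F n i) m) \<le> absv (of_nat n :: 'a)"
proof (cases "m v")
  case (Suc k)
  then have "m(v := Suc k) = m" by (intro fun_upd_idem)
  then have "mfps_nth (mfps_deriv v (formal_mult F n i)) (m(v := k)) =
      of_nat (m v) * mfps_nth (formal_mult F n i) m"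
    by (simp only: mfps_deriv_def mfps_nth_Abs fun_upd_same fun_upd_upd Suc)
  then show ?thesis
    using absv_deriv_formal_mult_le[of v i "m(v := k)"] by (simp only:)
qed simp

end

section \<open>Absolute values and residues\<close>

lemma absv_power [simp]: "absv (x ^ n) = absv x ^ n" for x :: "'a::nonarch_field"
  by (induction n) (auto simp: absv_mult)

lemma absv_prod: "absv (\<Prod>i\<in>I. f i) = (\<Prod>i\<in>I. absv (f i))" for f :: "'b \<Rightarrow> 'a::nonarch_field"
  by (induction I rule: infinite_finite_induct) (auto simp: absv_mult)

lemma absv_divide: "absv (x / y) = absv x / absv y" for x :: "'a::nonarch_field"
  by (simp add: divide_inverse absv_mult absv_inverse)

lemma absv_minus_commute: "absv (x - y) = absv (y - x)" for x :: "'a::nonarch_field"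
  by (metis absv_uminus minus_diff_eq)

lemma absv_pos_iff [simp]: "0 < absv x \<longleftrightarrow> x \<noteq> 0" for x :: "'a::nonarch_field"
  using absv_ge_0[of x] absv_eq_0[of x] by (auto simp: less_le simp del: absv_ge_0 absv_eq_0)

lemma absv_le_0_iff [simp]: "absv x \<le> 0 \<longleftrightarrow> x = 0" for x :: "'a::nonarch_field"
  using absv_pos_iff[of x] by (simp only: not_less[symmetric]) simp

lemma absv_eq_if_close:
  fixes x y :: "'a::nonarch_field"
  assumes "absv (x - y) < absv x"
  shows "absv y = absv x"
proof (rule antisym)
  have "absv (x - (x - y)) \<le> max (absv x) (absv (x - y))" by (rule absv_diff)
  with assms show "absv y \<le> absv x" by simp
  have "absv ((x - y) + y) \<le> max (absv (x - y)) (absv y)" by (rule absv_add)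
  with assms show "absv x \<le> absv y" by (simp add: max_def split: if_splits)
qed

lemma absv_add_less: "absv x < B \<Longrightarrow> absv y < B \<Longrightarrow> absv (x + y) < B" for x y :: "'a::nonarch_field"
  using absv_add[of x y] by simp

lemma absv_diff_less: "absv x < B \<Longrightarrow> absv y < B \<Longrightarrow> absv (x - y) < B" for x y :: "'a::nonarch_field"
  using absv_diff[of x y] by simp

lemma absv_add_le: "absv x \<le> B \<Longrightarrow> absv y \<le> B \<Longrightarrow> absv (x + y) \<le> B" for x y :: "'a::nonarch_field"
  using absv_add[of x y] by simp

lemma absv_diff_le: "absv x \<le> B \<Longrightarrow> absv y \<le> B \<Longrightarrow> absv (x - y) \<le> B" for x y :: "'a::nonarch_field"
  using absv_diff[of x y] by simp

lemma absv_sum_less: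
  assumes "0 < B" "\<And>i. i \<in> I \<Longrightarrow> absv (f i) < B"
  shows "absv (sum f I) < (B :: real)"
  using assms(2) by (induction I rule: infinite_finite_induct) (auto simp: assms(1) absv_add_less)

lemma absv_of_nat_le_1 [simp]: "absv (of_nat n :: 'a::nonarch_field) \<le> 1"
  by (induction n) (auto intro: absv_add_le)

lemma absv_of_int_le_1 [simp]: "absv (of_int n :: 'a::nonarch_field) \<le> 1"
  by (cases n) (auto intro: absv_diff_le simp del: of_nat_Suc)

lemma closure_absv_iff:
  "x \<in> closure S \<longleftrightarrow> (\<forall>e>0. \<exists>y\<in>S. absv (x - y) < e)" for x :: "'a::nonarch_field"
  by (simp add: closure_approachable dist_commute flip: dist_absv)

lemma reduce_eq_iff:
  "absv x \<le> 1 \<Longrightarrow> absv y \<le> 1 \<Longrightarrow> reduce x = reduce y \<longleftrightarrow> absv (x - y) < 1"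
  by transfer (simp add: residue_rel_def)

lemma reduce_0 [simp]: "reduce 0 = 0"
  by transfer (simp add: residue_rel_def)

lemma reduce_1 [simp]: "reduce 1 = 1"
  by transfer (simp add: residue_rel_def)

lemma reduce_eq_0_iff: "absv x \<le> 1 \<Longrightarrow> reduce x = 0 \<longleftrightarrow> absv x < 1"
  using reduce_eq_iff[of x 0] by simp

lemma reduce_add: "absv x \<le> 1 \<Longrightarrow> absv y \<le> 1 \<Longrightarrow> reduce (x + y) = reduce x + reduce y"
  by transfer (simp add: residue_rel_def absv_add_le)

lemma reduce_diff: "absv x \<le> 1 \<Longrightarrow> absv y \<le> 1 \<Longrightarrow> reduce (x - y) = reduce x - reduce y"
  by transfer (simp add: residue_rel_def absv_diff_le)

lemma reduce_mult: "absv x \<le> 1 \<Longrightarrow> absv y \<le> 1 \<Longrightarrow> reduce (x * y) = reduce x * reduce y"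
  by transfer (simp add: residue_rel_def absv_mult_le)

lemma reduce_power: "absv x \<le> 1 \<Longrightarrow> reduce (x ^ n) = reduce x ^ n"
  by (induction n) (auto simp: reduce_mult power_le_one)

lemma reduce_sum: "(\<And>i. i \<in> I \<Longrightarrow> absv (f i) \<le> 1) \<Longrightarrow> reduce (sum f I) = (\<Sum>i\<in>I. reduce (f i))"
  by (induction I rule: infinite_finite_induct) (auto simp: reduce_add absv_sum_le)

lemma reduce_prod: "(\<And>i. i \<in> I \<Longrightarrow> absv (f i) \<le> 1) \<Longrightarrow> reduce (prod f I) = (\<Prod>i\<in>I. reduce (f i))"
  by (induction I rule: infinite_finite_induct) (auto simp: reduce_mult absv_prod prod_le_1)

lemma reduce_of_nat: "reduce (of_nat n :: 'a::nonarch_field) = of_nat n"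
proof (induction n)
  case (Suc n)
  have "reduce (of_nat (Suc n) :: 'a) = reduce (1 + of_nat n)" by simp
  also have "\<dots> = reduce 1 + reduce (of_nat n :: 'a)" by (rule reduce_add) simp_all
  finally show ?case using Suc by simp
qed simp

lemma reduce_surj:
  obtains x where "absv x \<le> 1" "reduce x = \<xi>"
proof -
  have "\<exists>x. absv x \<le> 1 \<and> reduce x = \<xi>"
  proof transfer
    fix \<xi> :: 'a assume "residue_rel \<xi> \<xi>"
    then show "\<exists>x. absv x \<le> 1 \<and> residue_rel (if absv x \<le> 1 then x else 0) \<xi>"
      by (intro exI[of _ \<xi>]) (auto simp: residue_rel_def)
  qed
  then show ?thesis using that by blast
qed

lemma value_group_mult:
  assumes "type_subfield K" "u \<in> value_group K" "v \<in> value_group K"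
  shows "u * v \<in> value_group K" "u / v \<in> value_group K"
proof -
  obtain x y where xy: "x \<in> K" "x \<noteq> 0" "y \<in> K" "y \<noteq> 0" "u = absv x" "v = absv y"
    using assms by (auto simp: value_group_def)
  interpret type_subfield K by (rule assms)
  have "absv (x * y) \<in> value_group K" "absv (x / y) \<in> value_group K"
    unfolding value_group_def using xy by (intro imageI; simp add: mult_mem divide_mem)+
  then show "u * v \<in> value_group K" "u / v \<in> value_group K"
    by (simp_all add: xy absv_mult absv_divide)
qed

lemma one_in_value_group: "type_subfield K \<Longrightarrow> 1 \<in> value_group K"
  using type_subfield.one_mem[of K] by (force simp: value_group_def)

lemma value_group_coset:
  assumes "type_subfield K" "v \<in> value_group K"
  shows "(\<lambda>u. v * u) ` value_group K = value_group K"
proof -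
  have "v \<noteq> 0" using assms(2) by (auto simp: value_group_def)
  then have "u \<in> (\<lambda>u. v * u) ` value_group K" if "u \<in> value_group K" for u
    using value_group_mult(2)[OF assms(1) that assms(2)] by (intro image_eqI[of _ _ "u / v"]) auto
  then show ?thesis
    using value_group_mult(1)[OF assms(1,2)] by auto
qed

lemma ramification_index_1_imp_value_group:
  assumes "type_subfield K" "type_subfield L" "ramification_index K L = 1"
  shows "value_group L \<subseteq> value_group K"
proof
  fix v assume v: "v \<in> value_group L"
  obtain S where S: "(\<lambda>c. (\<lambda>v. c * v) ` value_group K) ` value_group L = {S}"
    using assms(3) unfolding ramification_index_def by (rule card_1_singletonE)
  have "(\<lambda>u. v * u) ` value_group K = (\<lambda>u. 1 * u) ` value_group K"
  proof -
    have "(\<lambda>u. c * u) ` value_group K = S" if "c \<in> value_group L" for c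
      using imageI[OF that, of "\<lambda>c. (\<lambda>v. c * v) ` value_group K"] unfolding S by simp
    then show ?thesis
      using v one_in_value_group[OF assms(2)] by metis
  qed
  moreover have "v \<in> (\<lambda>u. v * u) ` value_group K"
    using one_in_value_group[OF assms(1)] by force
  ultimately show "v \<in> value_group K" by simp
qed

lemma ramification_index_eq_1:
  assumes "type_subfield K" "value_group L = value_group K"
  shows "ramification_index K L = 1"
proof -
  have "(\<lambda>c. (\<lambda>v. c * v) ` value_group K) ` value_group K = {value_group K}"
    using value_group_coset[OF assms(1)] one_in_value_group[OF assms(1)] by auto
  then show ?thesis by (simp add: ramification_index_def assms(2))
qed

text \<open>A nonzero limit has the absolute value of every sufficiently close approximation, so
  passing to the closure adds no values.\<close>

lemma value_group_closure: "value_group (closure K) = value_group K"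
proof
  show "value_group (closure K) \<subseteq> value_group K"
  proof
    fix v assume "v \<in> value_group (closure K)"
    then obtain x where x: "x \<in> closure K" "x \<noteq> 0" "v = absv x" by (auto simp: value_group_def)
    then obtain y where "y \<in> K" "absv (x - y) < absv x"
      unfolding closure_absv_iff by (metis absv_pos_iff)
    with absv_eq_if_close[of x y] x show "v \<in> value_group K"
      by (auto simp: value_group_def intro!: image_eqI[of _ _ y])
  qed
  show "value_group K \<subseteq> value_group (closure K)"
    using closure_subset[of K] by (auto simp: value_group_def)
qed

lemma type_subfield_closure:
  fixes K :: "'a::nonarch_field set"
  assumes "type_subfield K"
  shows "type_subfield (closure K)"
proof (rule type_subfieldI)
  interpret type_subfield K by (rule assms)
  show "1 \<in> closure K" using closure_subset[of K] by auto
next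
  interpret type_subfield K by (rule assms)
  fix x y assume xy: "x \<in> closure K" "y \<in> closure K"
  show "x - y \<in> closure K"
    unfolding closure_absv_iff
  proof (intro allI impI)
    fix e :: real assume "e > 0"
    then obtain x' y' where "x' \<in> K" "absv (x - x') < e" "y' \<in> K" "absv (y - y') < e"
      using xy unfolding closure_absv_iff by blast
    then show "\<exists>z\<in>K. absv (x - y - z) < e"
      using absv_diff_less[of "x - x'" e "y - y'"]
      by (intro bexI[of _ "x' - y'"] diff_mem) (auto simp: algebra_simps)
  qed
  show "x * y \<in> closure K"
    unfolding closure_absv_iff
  proof (intro allI impI)
    fix e :: real assume e: "e > 0"
    define c where "c = max 1 (max (absv x) (absv y))"
    have c: "c \<ge> 1" "absv x \<le> c" "absv y \<le> c" by (auto simp: c_def)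
    \<comment> \<open>The entry 1 keeps the approximation of \<open>y\<close> within the bound
      \<open>c\<close>, and \<open>e / c\<close> makes both error terms of the product smaller than
      \<open>e\<close>.\<close>
    define d where "d = min 1 (e / c)"
    have d: "d > 0" "d \<le> 1" using e c by (auto simp: d_def)
    have dc: "d * c \<le> e"
      using c e by (simp add: d_def min_def field_simps)
    obtain x' y' where x': "x' \<in> K" "absv (x - x') < d" and y': "y' \<in> K" "absv (y - y') < d"
      using xy d(1) unfolding closure_absv_iff by blast
    have "absv (y - (y - y')) \<le> c"
      by (rule absv_diff_le) (use c y' d in auto)
    then have "absv y' \<le> c" by simp
    then have "absv (x - x') * absv y' \<le> absv (x - x') * c"
      by (rule mult_left_mono) simp
    also have "\<dots> < d * c"
      using x'(2) c by (intro mult_strict_right_mono) auto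
    finally have "absv ((x - x') * y') < e"
      using dc by (simp add: absv_mult)
    moreover have "absv (x * (y - y')) < e"
    proof -
      have "absv x * absv (y - y') \<le> c * absv (y - y')"
        using c(2) by (rule mult_right_mono) simp
      also have "\<dots> < c * d"
        using y'(2) c by (intro mult_strict_left_mono) auto
      finally show ?thesis
        using dc by (simp add: absv_mult mult.commute[of c])
    qed
    ultimately have "absv (x * (y - y') + (x - x') * y') < e"
      by (intro absv_add_less)
    then show "\<exists>z\<in>K. absv (x * y - z) < e"
      using x' y' by (intro bexI[of _ "x' * y'"] mult_mem) (auto simp: algebra_simps)
  qed
next
  interpret type_subfield K by (rule assms)
  fix x assume x: "x \<in> closure K" "x \<noteq> 0"
  show "inverse x \<in> closure K"
    unfolding closure_absv_iff
  proof (intro allI impI)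
    fix e :: real assume e: "e > 0"
    \<comment> \<open>The first entry forces \<open>absv x' = absv x\<close>; the second absorbs the
      denominator of 1/x - 1/x' = (x' - x)/(x x').\<close>
    define d where "d = min (absv x) (e * absv x * absv x)"
    have "d > 0" using e x by (simp add: d_def)
    then obtain x' where x': "x' \<in> K" "absv (x - x') < d"
      using x unfolding closure_absv_iff by blast
    then have eq: "absv x' = absv x" by (intro absv_eq_if_close) (simp add: d_def)
    then have "x' \<noteq> 0" using x by auto
    then have "inverse x - inverse x' = (x' - x) / (x * x')"
      using x by (simp add: field_simps)
    then have "absv (inverse x - inverse x') = absv (x - x') / (absv x * absv x)"
      by (simp add: absv_divide absv_mult eq absv_minus_commute)
    also have "\<dots> < e"
      using x' x by (simp add: d_def divide_less_eq mult.assoc)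
    finally show "\<exists>z\<in>K. absv (inverse x - z) < e"
      using x' inverse_mem by blast
  qed
qed

section \<open>Frobenius orbits\<close>

lemma frobenius_fixed_mult:
  fixes x :: "'k::monoid_mult"
  assumes "x ^ (q ^ m) = x"
  shows "x ^ (q ^ (m * k)) = x"
proof (induction k)
  case (Suc k)
  have "x ^ (q ^ (m * Suc k)) = (x ^ (q ^ m)) ^ (q ^ (m * k))"
    by (simp only: mult_Suc_right power_add power_mult[symmetric])
  then show ?case using Suc assms by simp
qed simp

text \<open>Frobenius permutes the finitely many roots of a polynomial whose coefficients it fixes.\<close>

lemma root_frobenius_periodic:
  fixes \<alpha> :: "'k::field"
  assumes p: "Factorial_Ring.prime CHAR('k)"
    and c: "\<And>i. i \<le> n \<Longrightarrow> c i ^ (CHAR('k) ^ N) = c i"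
    and nz: "j \<le> n" "c j \<noteq> 0" and root: "(\<Sum>i\<le>n. c i * \<alpha> ^ i) = 0"
  shows "\<exists>M>0. \<alpha> ^ (CHAR('k) ^ (N * M)) = \<alpha>"
proof -
  define q where "q = CHAR('k) ^ N"
  define \<phi> where "\<phi> = (\<lambda>x :: 'k. x ^ q)"
  define R where "R = {x. (\<Sum>i\<le>n. c i * x ^ i) = 0}"
  have q: "q > 0" using p by (simp add: q_def prime_gt_0_nat)
  have "finite R"
  proof -
    define h where "h = (\<Sum>i\<le>n. Polynomial.monom (c i) i)"
    have "Polynomial.coeff h j = c j"
      using nz by (simp add: h_def coeff_sum)
    then have "h \<noteq> 0" using nz by auto
    moreover have "R = {x. poly h x = 0}"
      by (simp add: R_def h_def poly_sum poly_monom)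
    ultimately show ?thesis by (simp add: poly_roots_finite)
  qed
  have \<phi>R: "\<phi> x \<in> R" if "x \<in> R" for x
  proof -
    have "(\<Sum>i\<le>n. c i * \<phi> x ^ i) = (\<Sum>i\<le>n. (c i * x ^ i) ^ q)"
    proof (rule sum.cong)
      fix i assume "i \<in> {..n}"
      then have "c i ^ q = c i" by (simp add: c q_def)
      moreover have "(x ^ i) ^ q = (x ^ q) ^ i" by (simp only: power_mult[symmetric] mult.commute)
      ultimately show "c i * \<phi> x ^ i = (c i * x ^ i) ^ q"
        by (simp add: \<phi>_def power_mult_distrib)
    qed simp
    also have "\<dots> = (\<Sum>i\<le>n. c i * x ^ i) ^ q"
      by (rule freshmans_dream_sum'[OF p, symmetric]) (simp add: q_def)
    finally show ?thesis using that q by (simp add: R_def)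
  qed
  have "inj \<phi>"
  proof (rule injI)
    fix x y assume "\<phi> x = \<phi> y"
    moreover have "((x - y) + y) ^ q = (x - y) ^ q + y ^ q"
      by (rule freshmans_dream'[OF p]) (simp add: q_def)
    ultimately show "x = y" by (simp add: \<phi>_def)
  qed
  moreover have orbit: "(\<phi> ^^ k) \<alpha> \<in> R" for k
    by (induction k) (use root \<phi>R in \<open>auto simp: R_def\<close>)
  then have "finite {y. \<exists>k. y = (\<phi> ^^ k) \<alpha>}"
    by (intro finite_subset[OF _ \<open>finite R\<close>]) auto
  ultimately obtain M where M: "M > 0" "(\<phi> ^^ M) \<alpha> = \<alpha>"
    by (rule funpow_inj_finite)
  have "(\<phi> ^^ k) \<alpha> = \<alpha> ^ (CHAR('k) ^ (N * k))" for k
  proof (induction k)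
    case (Suc k)
    have "(\<phi> ^^ Suc k) \<alpha> = (\<alpha> ^ (CHAR('k) ^ (N * k))) ^ (CHAR('k) ^ N)"
      by (simp only: funpow.simps o_apply Suc) (simp only: \<phi>_def q_def)
    also have "\<dots> = \<alpha> ^ (CHAR('k) ^ (N * k) * CHAR('k) ^ N)"
      by (rule power_mult[symmetric])
    also have "CHAR('k) ^ (N * k) * CHAR('k) ^ N = CHAR('k) ^ (N * Suc k)"
      by (simp only: power_add[symmetric] mult_Suc_right add.commute)
    finally show ?case .
  qed simp
  with M show ?thesis by auto
qed

lemma algebraic_relation:
  fixes K :: "'a::field set"
  assumes K: "type_subfield K" and x: "(ring.algebraic ring_of_type_algebra over K) x"
  obtains c n where "\<forall>i. c i \<in> K" "c n \<noteq> 0" "(\<Sum>i\<le>n. c i * x ^ i) = 0"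
proof -
  interpret R: Ring.field "ring_of_type_algebra :: 'a ring" by rule
  interpret type_subfield K by (rule K)
  obtain f where f: "f \<in> carrier (univ_poly ring_of_type_algebra K)" "f \<noteq> []" "R.eval f x = 0"
    using R.algebraicE[OF subfieldE(1)[OF subfield] _ x] by auto
  \<comment> \<open>Polynomials of HOL-Algebra are lists that begin with the leading coefficient,
    hence the reversal.\<close>
  have eval: "R.eval g x = (\<Sum>i<length g. rev g ! i * x ^ i)" for g
  proof (induction g)
    case (Cons a g)
    have "R.eval (a # g) x = a * x ^ length g + R.eval g x" by simp
    also have "\<dots> = (\<Sum>i<Suc (length g). rev (a # g) ! i * x ^ i)"
      by (simp add: Cons nth_append add.commute)
    finally show ?case by simp
  qed simp
  have mem: "set f \<subseteq> K" and hd: "hd f \<noteq> 0"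
    using f(1,2) by (auto simp: univ_poly_def polynomial_def)
  define n where "n = length f - 1"
  have len: "length f = Suc n" using f(2) by (cases f) (auto simp: n_def)
  define c where "c i = (if i < length f then rev f ! i else 0)" for i
  show ?thesis
  proof
    show "\<forall>i. c i \<in> K"
      using mem by (auto simp: c_def rev_nth)
    show "c n \<noteq> 0"
      using hd f(2) len by (simp add: c_def rev_nth hd_conv_nth)
    have "(\<Sum>i\<le>n. c i * x ^ i) = (\<Sum>i<length f. rev f ! i * x ^ i)"
      by (rule sum.cong) (auto simp: c_def len)
    then show "(\<Sum>i\<le>n. c i * x ^ i) = 0"
      using f(3) eval by simp
  qed
qed

text \<open>Division by the largest coefficient makes the relation integral with one coefficient
  equal to 1, so its reduction is nontrivial. The leading coefficient may reduce to 0, which is why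
  a separate index \<open>j\<close> is returned.\<close>

lemma residue_algebraic_relation:
  fixes K :: "'a::nonarch_field set"
  assumes K: "type_subfield K" and x: "(ring.algebraic ring_of_type_algebra over K) x" "absv x \<le> 1"
  obtains b n j where "\<forall>i\<le>n. b i \<in> residue_field K" "j \<le> n" "b j \<noteq> 0"
    "(\<Sum>i\<le>n. b i * reduce x ^ i) = 0"
proof -
  interpret type_subfield K by (rule K)
  obtain c n where c: "\<forall>i. c i \<in> K" "c n \<noteq> 0" "(\<Sum>i\<le>n. c i * x ^ i) = 0"
    using algebraic_relation[OF K x(1)] .
  define B where "B = Max ((\<lambda>i. absv (c i)) ` {..n})"
  have "B \<in> (\<lambda>i. absv (c i)) ` {..n}" unfolding B_def by (rule Max_in) auto
  then obtain j where j: "j \<le> n" "B = absv (c j)" by auto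
  have le: "absv (c i) \<le> B" if "i \<le> n" for i
    unfolding B_def by (rule Max_ge) (use that in auto)
  have "c j \<noteq> 0" using le[of n] j c(2) by auto
  define e where "e i = c i / c j" for i
  have int: "absv (e i) \<le> 1" if "i \<le> n" for i
    using le[OF that] j \<open>c j \<noteq> 0\<close> by (simp add: e_def absv_divide divide_le_eq_1)
  have "(\<Sum>i\<le>n. reduce (e i) * reduce x ^ i) = (\<Sum>i\<le>n. reduce (e i * x ^ i))"
    using int x by (intro sum.cong) (auto simp: reduce_mult reduce_power power_le_one)
  also have "\<dots> = reduce (\<Sum>i\<le>n. e i * x ^ i)"
    by (rule reduce_sum[symmetric]) (use int x in \<open>auto intro!: absv_mult_le simp: power_le_one\<close>)
  also have "(\<Sum>i\<le>n. e i * x ^ i) = (\<Sum>i\<le>n. c i * x ^ i) / c j"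
    by (simp add: e_def sum_divide_distrib)
  finally have "(\<Sum>i\<le>n. reduce (e i) * reduce x ^ i) = 0"
    using c(3) by simp
  moreover have "reduce (e i) \<in> residue_field K" if "i \<le> n" for i
    using int[OF that] c(1) by (auto simp: residue_field_def valuation_ring_def e_def intro!: imageI divide_mem)
  moreover have "reduce (e j) \<noteq> 0"
    using \<open>c j \<noteq> 0\<close> by (simp add: e_def)
  ultimately show ?thesis
    using that[of n "\<lambda>i. reduce (e i)" j] j(1) by blast
qed

lemma type_subfield_Rats: "type_subfield (\<rat> :: 'a::field_char_0 set)"
  by (rule type_subfieldI) auto

section \<open>The completed maximal unramified extension\<close>

locale normalised_absv =
  fixes p :: nat and ty :: "'a::{field_char_0, nonarch_field} itself"
  assumes p: "Factorial_Ring.prime p" and absv_p: "absv (of_nat p :: 'a) = 1 / real p"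
begin

lemma p_gt_1: "p > 1"
  using p by (rule prime_gt_1_nat)

text \<open>In a Bezout identity u p + v n = 1 the first term has absolute value below 1, so the
  second cannot.\<close>

lemma absv_of_int_eq_1:
  assumes "\<not> int p dvd n"
  shows "absv (of_int n :: 'a) = 1"
proof -
  have "coprime (int p) n"
    using p assms by (intro prime_imp_coprime) auto
  then obtain u v where uv: "u * int p + v * n = 1"
    using bezout_int[of "int p" n] by auto
  have "absv (of_nat p * of_int u :: 'a) \<le> 1 / real p"
    by (rule absv_mult_le) (simp_all add: absv_p)
  then have "absv (of_int u * of_nat p :: 'a) < 1"
    using p_gt_1 by (simp add: mult.commute order_le_less_trans)
  moreover have "absv (1 :: 'a) \<le> max (absv (of_int u * of_nat p :: 'a)) (absv (of_int v * of_int n :: 'a))"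
  proof -
    have "of_int (u * int p + v * n) = (1 :: 'a)" by (simp only: uv of_int_1)
    then have "(1 :: 'a) = of_int u * of_nat p + of_int v * of_int n" by simp
    then show ?thesis using absv_add[of "of_int u * of_nat p :: 'a" "of_int v * of_int n"] by metis
  qed
  ultimately have "1 \<le> absv (of_int v * of_int n :: 'a)"
    by (auto simp: max_def split: if_splits)
  also have "\<dots> \<le> absv (of_int n :: 'a)"
    using absv_mult_le[OF order.refl absv_of_int_le_1, of "of_int n :: 'a" v] by (simp add: mult.commute)
  finally show ?thesis
    using absv_of_int_le_1[of n, where ?'a = 'a] by linarith
qed

lemma absv_of_nat_less_1_iff: "absv (of_nat n :: 'a) < 1 \<longleftrightarrow> p dvd n"
proof
  assume "absv (of_nat n :: 'a) < 1"
  then show "p dvd n"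
    using absv_of_int_eq_1[of "int n"] by auto
next
  assume "p dvd n"
  then obtain k where "n = p * k" by blast
  then have "absv (of_nat n :: 'a) \<le> 1 / real p"
    using absv_mult_le[of "of_nat p :: 'a" "1 / real p" "of_nat k"] by (simp add: absv_p)
  also have "\<dots> < 1" using p_gt_1 by simp
  finally show "absv (of_nat n :: 'a) < 1" .
qed

lemma absv_of_nat_power: "n > 0 \<Longrightarrow> \<exists>k. absv (of_nat n :: 'a) = (1 / real p) ^ k"
proof (induction n rule: less_induct)
  case (less n)
  show ?case
  proof (cases "p dvd n")
    case True
    then obtain m where m: "n = p * m" by blast
    with less.prems p_gt_1 have "m > 0" "m < n" by auto
    with less.IH obtain k where "absv (of_nat m :: 'a) = (1 / real p) ^ k" by blast
    then show ?thesis
      by (intro exI[of _ "Suc k"]) (simp add: m absv_mult absv_p)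
  next
    case False
    then show ?thesis
      using absv_of_int_eq_1[of "int n"] by (intro exI[of _ 0]) simp
  qed
qed

lemma value_group_Rats: "value_group (\<rat> :: 'a set) = range (\<lambda>k::int. real p powi k)"
proof
  show "value_group (\<rat> :: 'a set) \<subseteq> range (\<lambda>k::int. real p powi k)"
  proof
    fix v assume "v \<in> value_group (\<rat> :: 'a set)"
    then obtain x :: 'a where x: "x \<in> \<rat>" "x \<noteq> 0" "v = absv x" by (auto simp: value_group_def)
    obtain a b where ab: "b > 0" "x = of_int a / of_int b" using x(1) by (elim Rats_cases')
    have of_int: "absv (of_int i :: 'a) = absv (of_nat (nat \<bar>i\<bar>) :: 'a)" for i
      by (cases i) (auto simp del: of_nat_Suc)
    have "a \<noteq> 0" using ab x by auto
    then obtain k l where "absv (of_int a :: 'a) = (1 / real p) ^ k" "absv (of_int b :: 'a) = (1 / real p) ^ l"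
      using absv_of_nat_power[of "nat \<bar>a\<bar>"] absv_of_nat_power[of "nat \<bar>b\<bar>"] ab unfolding of_int by auto
    then have "v = real p powi (int l - int k)"
      using x(3) p_gt_1 unfolding ab(2) absv_divide by (simp add: power_int_diff power_one_over)
    then show "v \<in> range (\<lambda>k::int. real p powi k)" by blast
  qed
  show "range (\<lambda>k::int. real p powi k) \<subseteq> value_group (\<rat> :: 'a set)"
  proof (intro subsetI, elim rangeE)
    fix v and k :: int assume v: "v = real p powi k"
    define x :: 'a where "x = (if k \<ge> 0 then 1 / of_nat p ^ nat k else of_nat p ^ nat (- k))"
    have "absv x = v"
      using v p_gt_1 by (auto simp: x_def absv_divide absv_p power_int_def power_one_over field_simps)
    moreover have "x \<in> \<rat>" "x \<noteq> 0" using p_gt_1 by (auto simp: x_def)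
    ultimately show "v \<in> value_group (\<rat> :: 'a set)" by (auto simp: value_group_def)
  qed
qed

lemma CHAR_residue: "CHAR('a residue) = p"
proof (rule CHAR_eqI)
  have iff: "of_nat n = (0 :: 'a residue) \<longleftrightarrow> p dvd n" for n
    using reduce_eq_0_iff[of "of_nat n :: 'a"] absv_of_nat_less_1_iff[of n] by (simp add: reduce_of_nat)
  show "of_nat p = (0 :: 'a residue)" by (simp add: iff)
  show "p dvd n" if "of_nat n = (0 :: 'a residue)" for n using that by (simp add: iff)
qed

lemma residue_of_nat_power_p: "(of_nat n :: 'a residue) ^ p = of_nat n"
proof (induction n)
  case 0
  show ?case using p_gt_1 by simp
next
  case (Suc n)
  have "(1 + of_nat n :: 'a residue) ^ p = 1 ^ p + of_nat n ^ p"
    by (rule freshmans_dream) (use p in \<open>simp_all add: CHAR_residue\<close>)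
  then show ?case by (simp add: Suc)
qed

lemma type_subfield_prime_field: "type_subfield (range of_nat :: 'a residue set)"
proof (rule type_subfieldI)
  have zero: "of_nat p = (0 :: 'a residue)"
    using CHAR_residue of_nat_CHAR[where ?'a = "'a residue"] by simp
  show "(1 :: 'a residue) \<in> range of_nat" by (rule range_eqI[of _ _ 1]) simp
  fix x y :: "'a residue" assume "x \<in> range of_nat" "y \<in> range of_nat"
  then obtain m n where mn: "x = of_nat m" "y = of_nat n" by blast
  \<comment> \<open>Since p = 0 among the residues, p - 1 serves as -1, which keeps differences in
    the range of \<open>of_nat\<close>.\<close>
  have "of_nat (m + (p - 1) * n) = of_nat m + (of_nat p - 1) * (of_nat n :: 'a residue)"
    using p_gt_1 by (simp only: of_nat_add of_nat_mult of_nat_diff[OF less_imp_le] of_nat_1)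
  then have "of_nat (m + (p - 1) * n) = x - y"
    by (simp add: mn zero)
  then show "x - y \<in> range of_nat" by (metis rangeI)
  show "x * y \<in> range of_nat" by (rule range_eqI[of _ _ "m * n"]) (simp add: mn)
next
  fix x :: "'a residue" assume x: "x \<in> range of_nat" "x \<noteq> 0"
  then obtain n where n: "x = of_nat n" by blast
  \<comment> \<open>By Fermat's little theorem \<open>x ^ (p - 2)\<close> is the inverse of
    \<open>x\<close>.\<close>
  have "x * (x * x ^ (p - 2)) = x ^ p"
    using p_gt_1 by (simp flip: power_Suc add: Suc_diff_Suc numeral_2_eq_2)
  then have "x * (x * x ^ (p - 2)) = x * 1"
    by (simp add: n residue_of_nat_power_p)
  then have "x * x ^ (p - 2) = 1" using x(2) mult_left_cancel[of x] by blast
  then have "inverse x = x ^ (p - 2)" by (rule Fields.inverse_unique)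
  then show "inverse x \<in> range of_nat"
    by (metis n of_nat_power rangeI)
qed

lemma type_subfield_Qp: "type_subfield (closure \<rat> :: 'a set)"
  by (rule type_subfield_closure[OF type_subfield_Rats])

text \<open>An integral p-adic number is congruent to a rational one modulo the maximal ideal, and
  an integral fraction in lowest terms has a denominator prime to p. So its residue is a quotient
  inside the prime field.\<close>

lemma residue_field_Qp: "residue_field (closure \<rat> :: 'a set) = range of_nat"
proof
  interpret F: type_subfield "range of_nat :: 'a residue set" by (rule type_subfield_prime_field)
  show "residue_field (closure \<rat> :: 'a set) \<subseteq> range of_nat"
  proof
    fix \<xi> assume "\<xi> \<in> residue_field (closure \<rat> :: 'a set)"
    then obtain x :: 'a where x: "x \<in> closure \<rat>" "absv x \<le> 1" "\<xi> = reduce x"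
      by (auto simp: residue_field_def valuation_ring_def)
    then obtain y where y: "y \<in> \<rat>" "absv (x - y) < 1"
      unfolding closure_absv_iff by (meson zero_less_one)
    have "absv (x - (x - y)) \<le> 1" by (rule absv_diff_le) (use x y in auto)
    then have y1: "absv y \<le> 1" by simp
    then have \<xi>: "\<xi> = reduce y" using x y reduce_eq_iff[of x y] by simp
    obtain a b where ab: "b > 0" "coprime a b" "y = of_int a / of_int b" using y(1) by (elim Rats_cases')
    have reduce_of_int: "reduce (of_int i :: 'a) = of_int i" for i
    proof (cases i)
      case (neg n)
      have "reduce (0 - of_nat (Suc n) :: 'a) = reduce 0 - reduce (of_nat (Suc n))"
        by (rule reduce_diff) (simp_all del: of_nat_Suc)
      then show ?thesis unfolding neg by (simp add: reduce_of_nat del: of_nat_Suc)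
    qed (simp add: reduce_of_nat)
    have b: "absv (of_int b :: 'a) = 1"
    proof (rule ccontr)
      assume "absv (of_int b :: 'a) \<noteq> 1"
      then have "int p dvd b" using absv_of_int_eq_1 by blast
      moreover from this have "\<not> int p dvd a"
        using ab(2) p by (metis coprime_common_divisor not_prime_unit prime_nat_int_transfer)
      ultimately have "absv (of_int a :: 'a) = 1" "absv (of_int b :: 'a) < 1"
        using absv_of_int_eq_1 absv_of_nat_less_1_iff[of "nat b"] ab(1)
          nat_dvd_iff int_dvd_int_iff[of p "nat b"] by simp_all
      moreover have "absv y * absv (of_int b :: 'a) = absv (of_int a :: 'a)"
        using ab by (simp flip: absv_mult)
      ultimately show False
        using y1 mult_mono[of "absv y" 1 "absv (of_int b :: 'a)" "absv (of_int b :: 'a)"] by simp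
    qed
    have "reduce y * reduce (of_int b) = reduce (of_int a)"
      using ab y1 by (simp flip: reduce_mult)
    moreover have "reduce (of_int b :: 'a) \<noteq> 0" using b by (simp add: reduce_eq_0_iff)
    ultimately have "\<xi> = of_int a / of_int b"
      by (simp add: \<xi> reduce_of_int field_simps)
    then show "\<xi> \<in> range of_nat"
      by (simp only:) (intro F.divide_mem F.of_int_mem)
  qed
  show "range of_nat \<subseteq> residue_field (closure \<rat> :: 'a set)"
    using closure_subset[of "\<rat> :: 'a set"]
    by (force simp: residue_field_def valuation_ring_def reduce_of_nat[symmetric, where ?'a = 'a])
qed

text \<open>Separability provides a nonzero polynomial over the prime field with root
  \<open>\<xi>\<close>. Frobenius fixes its coefficients, so \<open>root_frobenius_periodic\<close>
  applies.\<close>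

lemma unramified_residue_periodic:
  assumes L: "unramified (closure \<rat>) L" and \<xi>: "\<xi> \<in> residue_field (L :: 'a set)"
  shows "\<exists>N>0. \<xi> ^ (p ^ N) = \<xi>"
proof -
  obtain f where f: "set (coeffs f) \<subseteq> range of_nat" "coprime f (pderiv f)" "poly f \<xi> = 0"
    using L \<xi> by (auto simp: unramified_def separable_extension_def residue_field_Qp)
  have "f \<noteq> 0" using f(2) by auto
  interpret F: type_subfield "range of_nat :: 'a residue set" by (rule type_subfield_prime_field)
  have c: "Polynomial.coeff f i \<in> range of_nat" for i
    using f(1) F.zero_mem by (metis coeff_in_coeffs coeff_eq_0 not_le subsetD \<open>f \<noteq> 0\<close>)
  have "\<exists>M>0. \<xi> ^ (CHAR('a residue) ^ (1 * M)) = \<xi>"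
  proof (rule root_frobenius_periodic)
    show "Polynomial.coeff f i ^ CHAR('a residue) ^ 1 = Polynomial.coeff f i" for i
      using c[of i] residue_of_nat_power_p by (auto simp: CHAR_residue)
    show "(\<Sum>i\<le>Polynomial.degree f. Polynomial.coeff f i * \<xi> ^ i) = 0"
      using f(3) by (simp add: poly_altdef)
    show "Polynomial.coeff f (Polynomial.degree f) \<noteq> 0"
      using \<open>f \<noteq> 0\<close> by simp
  qed (use p in \<open>simp_all add: CHAR_residue\<close>)
  then show ?thesis by (simp add: CHAR_residue)
qed

end

section \<open>Lifting residues to unramified extensions of Q_p\<close>

lemma value_group_mono: "K \<subseteq> L \<Longrightarrow> value_group K \<subseteq> value_group L"
  unfolding value_group_def by (intro image_mono Diff_mono) auto

lemma one_le_absv_prod_mset: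
  "(\<And>r. r \<in># A \<Longrightarrow> 1 \<le> absv (g r)) \<Longrightarrow> 1 \<le> absv (\<Prod>r\<in>#A. g r)" for g :: "'b \<Rightarrow> 'a::nonarch_field"
proof (induction A)
  case (add x A)
  then have "1 * 1 \<le> absv (g x) * absv (\<Prod>r\<in>#A. g r)"
    by (intro mult_mono) auto
  then show ?case by (simp add: absv_mult)
qed simp

text \<open>Takes the place of Hensel's lemma: over an algebraically closed field the value of a
  monic polynomial at \<open>a\<close> is the product of \<open>a - r\<close> over its roots
  \<open>r\<close>, and a product of absolute value below 1 has a factor below 1.\<close>

lemma close_root:
  fixes c :: "nat \<Rightarrow> 'a::{alg_closed_field, nonarch_field}"
  assumes "absv (a ^ f - (\<Sum>i<f. c i * a ^ i)) < 1"
  obtains r where "r ^ f = (\<Sum>i<f. c i * r ^ i)" "absv (a - r) < 1"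
proof -
  define G where "G = Polynomial.monom 1 f - (\<Sum>i<f. Polynomial.monom (c i) i)"
  have poly: "poly G x = x ^ f - (\<Sum>i<f. c i * x ^ i)" for x
    by (simp add: G_def poly_sum poly_monom)
  have coeff: "Polynomial.coeff G k = (if k = f then 1 else if k < f then - c k else 0)" for k
    by (simp add: G_def coeff_sum)
  have "Polynomial.degree G = f"
    by (intro antisym degree_le le_degree) (auto simp: coeff)
  moreover from this have "Polynomial.lead_coeff G = 1" by (simp add: coeff)
  moreover from this have "G \<noteq> 0" by auto
  ultimately obtain A where "G = (\<Prod>x\<in>#A. [:-x, 1:])"
    using alg_closed_imp_factorization[of G] by auto
  then have fact: "poly G x = (\<Prod>r\<in>#A. x - r)" for x
    by (simp add: poly_prod_mset)
  have "\<exists>r. r \<in># A \<and> absv (a - r) < 1"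
  proof (rule ccontr)
    assume "\<not> (\<exists>r. r \<in># A \<and> absv (a - r) < 1)"
    then have "1 \<le> absv (poly G a)"
      unfolding fact by (intro one_le_absv_prod_mset) (auto simp: not_less)
    with assms show False by (simp add: poly)
  qed
  then obtain r where r: "r \<in># A" "absv (a - r) < 1" by blast
  then have "poly G r = 0"
    unfolding fact by (intro prod_mset_zero_iff[THEN iffD2]) force
  with r that show ?thesis by (simp add: poly)
qed

locale normalised_absv_closed = normalised_absv p ty
  for p and ty :: "'a::{alg_closed_field, field_char_0, nonarch_field} itself"
begin

lemma prime_field_power_p:
  assumes "c \<in> (range of_nat :: 'a residue set)"
  shows "c ^ (p ^ m) = c"
  using assms residue_of_nat_power_p frobenius_fixed_mult[of c p 1 m] by auto

text \<open>
  Lift the minimal polynomial of \<open>\<xi>\<close> over the prime field: the powers of a root \<open>r\<close> that reduces to \<open>\<xi>\<close> are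
  orthonormal over the \<open>p\<close>-adic numbers, because the powers of \<open>\<xi>\<close> are independent over the prime field.
\<close>

lemma unramified_lift:
  fixes \<xi> :: "'a residue"
  assumes \<xi>: "\<xi> ^ (p ^ m) = \<xi>" and m: "m > 0"
  obtains L r where "unramified (closure \<rat>) L" "r \<in> L" "absv r \<le> 1" "reduce r = \<xi>"
proof -
  define F where "F = (range of_nat :: 'a residue set)"
  interpret F: type_subfield F unfolding F_def by (rule type_subfield_prime_field)
  interpret Q: type_subfield "closure \<rat> :: 'a set" by (rule type_subfield_Qp)
  define q where "q = p ^ m"
  have q: "1 < q" using p_gt_1 m unfolding q_def by (rule one_less_power)
  \<comment> \<open>\<open>S f\<close> says that \<open>\<xi>\<close> is a root of a monic
    polynomial of degree \<open>f\<close> over the prime field, so the least such \<open>f\<close>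
    is the degree of its minimal polynomial. One exists because
    \<open>\<xi> ^ q = \<xi>\<close>.\<close>
  define S where "S f \<longleftrightarrow> (\<exists>c. (\<forall>i. c i \<in> F) \<and> \<xi> ^ f = (\<Sum>i<f. c i * \<xi> ^ i))" for f
  have "S q"
    unfolding S_def
  proof (intro exI conjI allI)
    show "(if i = 1 then 1 else 0) \<in> F" for i :: nat by simp
    have "(\<Sum>i<q. (if i = 1 then 1 else 0) * \<xi> ^ i) = (\<Sum>i<q. if i = 1 then \<xi> else 0)"
      by (rule sum.cong) auto
    then show "\<xi> ^ q = (\<Sum>i<q. (if i = 1 then 1 else 0) * \<xi> ^ i)"
      using q \<xi> by (simp add: q_def)
  qed
  define f where "f = (LEAST f. S f)"
  have "S f" unfolding f_def using \<open>S q\<close> by (rule LeastI)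
  then obtain c where c: "\<And>i. c i \<in> F" "\<xi> ^ f = (\<Sum>i<f. c i * \<xi> ^ i)" unfolding S_def by blast
  have "f > 0" using c(2) by (cases f) auto
  \<comment> \<open>Dividing a relation by its highest nonzero coefficient, at \<open>j\<close> say,
    would give \<open>S j\<close> with \<open>j < f\<close>.\<close>
  have indep: "\<beta> i = 0" if \<beta>: "\<And>i. i < f \<Longrightarrow> \<beta> i \<in> F" "(\<Sum>i<f. \<beta> i * \<xi> ^ i) = 0" and "i < f" for \<beta> i
  proof (rule ccontr)
    assume "\<beta> i \<noteq> 0"
    define J where "J = {i. i < f \<and> \<beta> i \<noteq> 0}"
    define j where "j = Max J"
    have J: "finite J" "J \<noteq> {}" using \<open>i < f\<close> \<open>\<beta> i \<noteq> 0\<close> by (auto simp: J_def)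
    have j: "j < f" "\<beta> j \<noteq> 0" using Max_in[OF J] by (auto simp: J_def j_def)
    have above: "\<beta> k = 0" if "j < k" "k < f" for k
    proof (rule ccontr)
      assume "\<beta> k \<noteq> 0"
      then have "k \<in> J" using that by (simp add: J_def)
      then have "k \<le> j" unfolding j_def by (rule Max_ge[OF J(1)])
      then show False using that by simp
    qed
    have "0 = (\<Sum>i<Suc j. \<beta> i * \<xi> ^ i)"
      unfolding \<beta>(2)[symmetric] by (rule sum.mono_neutral_right) (use j above in auto)
    then have "\<beta> j * \<xi> ^ j = - (\<Sum>i<j. \<beta> i * \<xi> ^ i)"
      by (simp add: eq_neg_iff_add_eq_0 add.commute)
    then have "\<xi> ^ j = - (\<Sum>i<j. \<beta> i * \<xi> ^ i) / \<beta> j"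
      using j(2) by (simp add: field_simps)
    also have "\<dots> = (\<Sum>i<j. (if i < f then - \<beta> i / \<beta> j else 0) * \<xi> ^ i)"
      unfolding sum_negf[symmetric] sum_divide_distrib by (rule sum.cong) (use j in auto)
    finally have "S j"
      unfolding S_def using j \<beta>(1)
      by (intro exI[of _ "\<lambda>i. if i < f then - \<beta> i / \<beta> j else 0"]) (auto intro!: F.mem_intros)
    then show False
      using not_less_Least[of j S] j(1) by (simp add: f_def)
  qed
  obtain n where n: "\<And>i. c i = of_nat (n i)"
    using c(1) unfolding F_def image_iff by metis
  obtain a where a: "absv a \<le> 1" "reduce a = \<xi>" by (rule reduce_surj)
  have "absv (a ^ f - (\<Sum>i<f. of_nat (n i) * a ^ i)) < 1"
  proof -
    have int: "absv (of_nat (n i) * a ^ i) \<le> 1" for i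
      using a by (intro absv_mult_le) (auto simp: power_le_one)
    have "reduce (\<Sum>i<f. of_nat (n i) * a ^ i) = \<xi> ^ f"
      unfolding c(2) using int a by (simp add: reduce_sum reduce_mult reduce_power reduce_of_nat n power_le_one)
    then have "reduce (a ^ f) = reduce (\<Sum>i<f. of_nat (n i) * a ^ i)"
      using a by (simp add: reduce_power)
    then show ?thesis
      using a int by (subst (asm) reduce_eq_iff) (auto simp: power_le_one absv_sum_le)
  qed
  then obtain r where r: "r ^ f = (\<Sum>i<f. of_nat (n i) * r ^ i)" "absv (a - r) < 1"
    by (rule close_root)
  have "absv (a - (a - r)) \<le> 1" by (rule absv_diff_le) (use a r in auto)
  then have r1: "absv r \<le> 1" by simp
  have r\<xi>: "reduce r = \<xi>" using reduce_eq_iff[OF a(1) r1] r a by simp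
  define L where "L = power_span (closure \<rat>) r f"
  have "r ^ f \<in> power_span (closure \<rat>) r f"
    unfolding r(1) by (rule power_spanI) (rule Q.of_nat_mem)
  then have L: "Defs.finite_extension (closure \<rat>) L" "r \<in> L"
    unfolding L_def using \<open>f > 0\<close> by (auto intro: Q.finite_extension_power_span)
  \<comment> \<open>After division by the largest coefficient, the sum reduces to a nontrivial
    combination of powers of \<open>\<xi>\<close>. This residue is nonzero, so the divided sum has
    absolute value 1.\<close>
  have orth: "\<exists>j<f. b j \<noteq> 0 \<and> absv (\<Sum>i<f. b i * r ^ i) = absv (b j) \<and> (\<forall>i<f. absv (b i) \<le> absv (b j))"
    if b: "\<And>i. b i \<in> closure \<rat>" and nz: "\<exists>i<f. b i \<noteq> 0" for b
  proof -
    define B where "B = Max ((\<lambda>i. absv (b i)) ` {..<f})"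
    have "B \<in> (\<lambda>i. absv (b i)) ` {..<f}" unfolding B_def by (rule Max_in) (use \<open>f > 0\<close> in auto)
    then obtain j where j: "j < f" "B = absv (b j)" by auto
    have le: "absv (b i) \<le> absv (b j)" if "i < f" for i
      unfolding j(2)[symmetric] B_def by (rule Max_ge) (use that in auto)
    have "b j \<noteq> 0" using nz le by fastforce
    define e where "e i = b i / b j" for i
    have int: "absv (e i) \<le> 1" if "i < f" for i
      using le[OF that] \<open>b j \<noteq> 0\<close> by (simp add: e_def absv_divide divide_le_eq_1)
    have int': "absv (e i * r ^ i) \<le> 1" if "i < f" for i
      using int[OF that] r1 by (intro absv_mult_le) (auto simp: power_le_one)
    have "reduce (e i) \<in> F" if "i < f" for i
      unfolding F_def residue_field_Qp[symmetric] residue_field_def valuation_ring_def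
      using int[OF that] b by (auto simp: e_def intro!: imageI Q.divide_mem)
    moreover have "reduce (e j) \<noteq> 0" using \<open>b j \<noteq> 0\<close> by (simp add: e_def)
    ultimately have "(\<Sum>i<f. reduce (e i) * \<xi> ^ i) \<noteq> 0"
      using indep[of "\<lambda>i. reduce (e i)" j] j(1) by blast
    also have "(\<Sum>i<f. reduce (e i) * \<xi> ^ i) = reduce (\<Sum>i<f. e i * r ^ i)"
    proof -
      have "reduce (\<Sum>i<f. e i * r ^ i) = (\<Sum>i<f. reduce (e i * r ^ i))"
        by (rule reduce_sum) (use int' in auto)
      also have "\<dots> = (\<Sum>i<f. reduce (e i) * \<xi> ^ i)"
        by (rule sum.cong) (use int r1 in \<open>auto simp: reduce_mult reduce_power power_le_one r\<xi>\<close>)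
      finally show ?thesis ..
    qed
    finally have "absv (\<Sum>i<f. e i * r ^ i) = 1"
      using int' reduce_eq_0_iff[of "\<Sum>i<f. e i * r ^ i"] absv_sum_le[of 1 "{..<f}" "\<lambda>i. e i * r ^ i"]
      by fastforce
    moreover have "(\<Sum>i<f. b i * r ^ i) = b j * (\<Sum>i<f. e i * r ^ i)"
      using \<open>b j \<noteq> 0\<close> by (simp add: e_def sum_distrib_left)
    ultimately show ?thesis
      using j \<open>b j \<noteq> 0\<close> le by (auto simp: absv_mult)
  qed
  have "value_group L = value_group (closure \<rat> :: 'a set)"
  proof
    show "value_group (closure \<rat> :: 'a set) \<subseteq> value_group L"
      by (rule value_group_mono) (use L(1) in \<open>simp add: Defs.finite_extension_def\<close>)
    show "value_group L \<subseteq> value_group (closure \<rat> :: 'a set)"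
    proof
      fix v assume "v \<in> value_group L"
      then obtain x where x: "x \<in> L" "x \<noteq> 0" "v = absv x" by (auto simp: value_group_def)
      obtain b where b: "\<forall>i. b i \<in> closure \<rat>" "x = (\<Sum>i<f. b i * r ^ i)"
        using x(1) unfolding L_def by (rule power_spanE)
      have "\<exists>i<f. b i \<noteq> 0" using x(2) b(2) by (force intro: sum.neutral)
      then obtain j where "b j \<noteq> 0" "v = absv (b j)"
        using orth[of b] b x(3) by auto
      then show "v \<in> value_group (closure \<rat> :: 'a set)" using b(1) by (auto simp: value_group_def)
    qed
  qed
  then have "ramification_index (closure \<rat>) L = 1"
    by (rule ramification_index_eq_1[OF type_subfield_Qp])
  moreover have "separable_extension (residue_field (closure \<rat>)) (residue_field L)"
    unfolding separable_extension_def
  proof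
    fix \<alpha> assume "\<alpha> \<in> residue_field L"
    then obtain x where x: "x \<in> L" "absv x \<le> 1" "\<alpha> = reduce x"
      by (auto simp: residue_field_def valuation_ring_def)
    obtain b where b: "\<forall>i. b i \<in> closure \<rat>" "x = (\<Sum>i<f. b i * r ^ i)"
      using x(1) unfolding L_def by (rule power_spanE)
    \<comment> \<open>The \<open>m\<close>-th power of Frobenius fixes the prime field and
      \<open>\<xi>\<close>, hence every residue of \<open>L\<close>.\<close>
    have \<alpha>: "\<alpha> ^ q = \<alpha>"
    proof (cases "\<exists>i<f. b i \<noteq> 0")
      case True
      then have int: "absv (b i) \<le> 1" if "i < f" for i
        using orth[of b] b x(2) that by fastforce
      have int': "absv (b i * r ^ i) \<le> 1" if "i < f" for i
        using int[OF that] r1 by (intro absv_mult_le) (auto simp: power_le_one)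
      have "\<alpha> = (\<Sum>i<f. reduce (b i * r ^ i))"
        unfolding x(3) b(2) by (rule reduce_sum) (use int' in auto)
      also have "\<dots> = (\<Sum>i<f. reduce (b i) * \<xi> ^ i)"
        by (rule sum.cong) (use int r1 in \<open>auto simp: reduce_mult reduce_power power_le_one r\<xi>\<close>)
      finally have \<alpha>: "\<alpha> = (\<Sum>i<f. reduce (b i) * \<xi> ^ i)" .
      have "(\<Sum>i<f. reduce (b i) * \<xi> ^ i) ^ q = (\<Sum>i<f. (reduce (b i) * \<xi> ^ i) ^ q)"
        by (rule freshmans_dream_sum'[of _ m]) (use p in \<open>simp_all add: CHAR_residue q_def\<close>)
      also have "\<dots> = (\<Sum>i<f. reduce (b i) * \<xi> ^ i)"
      proof (rule sum.cong)
        fix i assume "i \<in> {..<f}"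
        then have "reduce (b i) \<in> F"
          unfolding F_def residue_field_Qp[symmetric] residue_field_def valuation_ring_def
          using int b by (intro imageI) auto
        then have "reduce (b i) ^ q = reduce (b i)"
          unfolding F_def q_def by (rule prime_field_power_p)
        moreover have "(\<xi> ^ i) ^ q = \<xi> ^ i"
          using \<xi> by (metis mult.commute power_mult q_def)
        ultimately show "(reduce (b i) * \<xi> ^ i) ^ q = reduce (b i) * \<xi> ^ i"
          by (simp add: power_mult_distrib)
      qed simp
      finally show ?thesis by (simp only: \<alpha>)
    next
      case False
      then have "x = 0" unfolding b(2) by (intro sum.neutral) auto
      then show ?thesis using q by (simp add: x(3))
    qed
    \<comment> \<open>X^q - X has derivative -1 in characteristic p, so it is separable.\<close>
    define h where "h = Polynomial.monom 1 q - Polynomial.monom (1 :: 'a residue) 1"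
    have "poly h \<alpha> = 0" by (simp add: h_def poly_monom \<alpha>)
    moreover have "set (coeffs h) \<subseteq> F"
    proof
      fix y assume "y \<in> set (coeffs h)"
      then obtain i where "y = Polynomial.coeff h i"
        by (metis in_set_conv_nth coeffs_nth degree_0 length_coeffs_degree less_Suc_eq_le coeffs_0_eq_Nil empty_iff list.set(1))
      then have "y = (if q = i then 1 else 0) - (if 1 = i then 1 else 0)" by (simp add: h_def)
      then show "y \<in> F" by (auto intro: F.mem_intros)
    qed
    moreover have "pderiv h = -1"
    proof -
      have "of_nat q = (0 :: 'a residue)"
        using m by (simp add: of_nat_eq_0_iff_char_dvd CHAR_residue q_def)
      then show ?thesis
        by (simp add: h_def pderiv_diff pderiv_monom)
    qed
    ultimately show "\<exists>h. set (coeffs h) \<subseteq> residue_field (closure \<rat>) \<and> coprime h (pderiv h) \<and> poly h \<alpha> = 0"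
      by (intro exI[of _ h]) (simp add: residue_field_Qp F_def is_unit_right_imp_coprime)
  qed
  ultimately have "unramified (closure \<rat>) L"
    using L(1) by (simp add: unramified_def)
  then show ?thesis using that L(2) r1 r\<xi> by blast
qed

section \<open>The value group and the residue field of the base field\<close>

context
  fixes K :: "'a set"
  assumes K: "completed_maximal_unramified p K" and alg: "algebraic_closure_of K"
begin

lemma type_subfield_base: "type_subfield K"
  using K unfolding completed_maximal_unramified_def type_subfield_def by blast

lemma base_approx:
  assumes "x \<in> K" "e > 0"
  obtains L y where "unramified (closure \<rat>) L" "y \<in> L" "absv (x - y) < e"
proof -
  have "K = closure (maximal_unramified_extension (closure \<rat>))"
    using K by (simp add: completed_maximal_unramified_def)
  then have "\<exists>y\<in>maximal_unramified_extension (closure \<rat>). absv (x - y) < e"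
    using assms closure_absv_iff by metis
  then show ?thesis
    using that by (auto simp: maximal_unramified_extension_def)
qed

lemma unramified_subset_base:
  assumes "unramified (closure \<rat>) L"
  shows "L \<subseteq> K"
proof -
  have "L \<subseteq> maximal_unramified_extension (closure \<rat>)"
    using assms by (auto simp: maximal_unramified_extension_def)
  also have "\<dots> \<subseteq> closure \<dots>" by (rule closure_subset)
  also have "\<dots> = K" using K by (simp add: completed_maximal_unramified_def)
  finally show ?thesis .
qed

text \<open>An element closer to \<open>x\<close> than |x| has the same absolute value. One can be
  found in an unramified extension of Q_p, whose values are those of Q_p.\<close>

lemma value_group_base: "value_group K = range (\<lambda>k::int. real p powi k)"
proof
  interpret type_subfield K by (rule type_subfield_base)
  show "value_group K \<subseteq> range (\<lambda>k::int. real p powi k)"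
  proof
    fix v assume "v \<in> value_group K"
    then obtain x where x: "x \<in> K" "x \<noteq> 0" "v = absv x" by (auto simp: value_group_def)
    then obtain L y where L: "unramified (closure \<rat>) L" and y: "y \<in> L" "absv (x - y) < absv x"
      using base_approx[of x "absv x"] by auto
    have "v = absv y" using absv_eq_if_close[OF y(2)] x by simp
    moreover from this have "y \<noteq> 0" using x by auto
    ultimately have "v \<in> value_group L" using y by (auto simp: value_group_def)
    also have "\<dots> \<subseteq> value_group (closure \<rat> :: 'a set)"
      by (rule ramification_index_1_imp_value_group[OF type_subfield_Qp])
        (use L in \<open>auto simp: unramified_def Defs.finite_extension_def type_subfield_def\<close>)
    finally show "v \<in> range (\<lambda>k::int. real p powi k)"
      by (simp add: value_group_closure value_group_Rats)
  qed
  have "(\<rat> :: 'a set) \<subseteq> K"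
    by (auto elim!: Rats_cases' intro: mem_intros)
  then show "range (\<lambda>k::int. real p powi k) \<subseteq> value_group K"
    unfolding value_group_Rats[symmetric] using value_group_mono by blast
qed

text \<open>Any residue is algebraic over the residue field of K, whose elements come from
  unramified extensions of Q_p and are therefore periodic under Frobenius. So the given residue is
  periodic too, and \<open>unramified_lift\<close> realises it inside K.\<close>

lemma residue_field_base: "residue_field K = UNIV"
proof (rule UNIV_eq_I[symmetric])
  fix \<xi> :: "'a residue"
  obtain a where a: "absv a \<le> 1" "reduce a = \<xi>" by (rule reduce_surj)
  obtain b n j where b: "\<forall>i\<le>n. b i \<in> residue_field K" and j: "j \<le> n" "b j \<noteq> 0"
    and rel: "(\<Sum>i\<le>n. b i * reduce a ^ i) = 0"
    using residue_algebraic_relation[OF type_subfield_base _ a(1)] alg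
    unfolding algebraic_closure_of_def by metis
  have "\<exists>N>0. b i ^ (p ^ N) = b i" if "i \<le> n" for i
  proof -
    have "b i \<in> residue_field K" using b that by blast
    then obtain x where x: "x \<in> K" "absv x \<le> 1" "b i = reduce x"
      by (auto simp: residue_field_def valuation_ring_def)
    obtain L y where L: "unramified (closure \<rat>) L" and y: "y \<in> L" "absv (x - y) < 1"
      using base_approx[OF x(1), of 1] by auto
    have "absv (x - (x - y)) \<le> 1" by (rule absv_diff_le) (use x y in auto)
    then have "absv y \<le> 1" by simp
    then have "b i \<in> residue_field L"
      using x y reduce_eq_iff[of x y] by (auto simp: residue_field_def valuation_ring_def)
    then show ?thesis by (rule unramified_residue_periodic[OF L])
  qed
  then obtain N where N: "\<And>i. i \<le> n \<Longrightarrow> N i > 0 \<and> b i ^ (p ^ N i) = b i" by metis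
  \<comment> \<open>The product is a common multiple of the Frobenius periods of all
    coefficients.\<close>
  define N' where "N' = (\<Prod>i\<le>n. N i)"
  have "N' > 0" using N by (auto simp: N'_def intro!: prod_pos)
  have "b i ^ (CHAR('a residue) ^ N') = b i" if "i \<le> n" for i
  proof -
    have "N i dvd N'" unfolding N'_def by (rule dvd_prodI) (use that in auto)
    then obtain k where "N' = N i * k" by blast
    then show ?thesis
      using frobenius_fixed_mult[of "b i" p "N i" k] N[OF that] by (simp add: CHAR_residue)
  qed
  then have "\<exists>M>0. \<xi> ^ (CHAR('a residue) ^ (N' * M)) = \<xi>"
    using j rel a(2) p by (intro root_frobenius_periodic[of n b N' j]) (auto simp: CHAR_residue)
  then obtain M where M: "M > 0" "\<xi> ^ (p ^ (N' * M)) = \<xi>" by (auto simp: CHAR_residue)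
  then obtain L r where "unramified (closure \<rat>) L" "r \<in> L" "absv r \<le> 1" "reduce r = \<xi>"
    using unramified_lift[of \<xi> "N' * M"] \<open>N' > 0\<close> by auto
  then show "\<xi> \<in> residue_field K"
    using unramified_subset_base by (auto simp: residue_field_def valuation_ring_def)
qed

end

end

section \<open>Totally tamely ramified extensions\<close>

lemma value_groupI: "x \<in> K \<Longrightarrow> x \<noteq> 0 \<Longrightarrow> absv x \<in> value_group K"
  by (simp add: value_group_def)

lemma absv_sum_unique_max:
  fixes f :: "'b \<Rightarrow> 'a::nonarch_field"
  assumes "finite I" "j \<in> I" "\<And>i. i \<in> I \<Longrightarrow> i \<noteq> j \<Longrightarrow> absv (f i) < absv (f j)"
  shows "absv (sum f I) = absv (f j)"
proof (cases "f j = 0")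
  case True
  have "i = j" if "i \<in> I" for i
    using assms(3)[OF that] absv_ge_0[of "f i"] True by (metis absv_0 not_less)
  with assms(2) have "I = {j}" by blast
  then show ?thesis by simp
next
  case False
  have "absv (sum f (I - {j})) < absv (f j)"
    by (rule absv_sum_less) (use assms False in auto)
  then have "absv (f j - sum f I) < absv (f j)"
    using assms by (simp add: sum.remove[of I j])
  then show ?thesis by (rule absv_eq_if_close)
qed

text \<open>Collects what the later arguments use of the base field. The last assumption says that K
  represents every residue of the ambient field, because \<open>residue_field\<close> takes its
  values there.\<close>

locale discrete_base =
  fixes K :: "'a::{field_char_0, nonarch_field} set" and p :: nat
  assumes subfield_K: "type_subfield K" and complete_K: "complete K"
    and p_gt_1: "p > 1" and absv_p: "absv (of_nat p :: 'a) = 1 / real p"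
    and value_group_K: "value_group K = range (\<lambda>k::int. real p powi k)"
    and residue_field_K: "residue_field K = UNIV"
begin

sublocale K: type_subfield K
  by (rule subfield_K)

lemma absv_K:
  assumes "x \<in> K" "x \<noteq> 0"
  obtains k :: int where "absv x = real p powi k"
proof -
  have "absv x \<in> value_group K" using assms by (rule value_groupI)
  then show ?thesis using that unfolding value_group_K by blast
qed

lemma absv_nonunit_le:
  assumes "x \<in> K" "absv x < 1"
  shows "absv x \<le> 1 / real p"
proof (cases "x = 0")
  case False
  then obtain k :: int where k: "absv x = real p powi k" using assms(1) by (elim absv_K)
  have "k < 0"
  proof (rule ccontr)
    assume "\<not> k < 0"
    then have "1 \<le> real p powi k" using p_gt_1 by (auto simp: power_int_def)
    then show False using assms(2) k by simp
  qed
  then have "real p powi k \<le> real p powi (-1)"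
    using p_gt_1 by (intro power_int_increasing) auto
  then show ?thesis by (simp add: k power_int_minus divide_inverse)
qed simp

end

text \<open>Only the absolute value of \<open>x\<close> is prescribed, not \<open>x ^ e\<close>
  itself, so that the locale applies both to \<pi> and to a largest coordinate of a torsion
  point.\<close>

locale tame_uniformiser = discrete_base K p
  for K :: "'a::{field_char_0, nonarch_field} set" and p +
  fixes x :: 'a and e :: nat
  assumes e_pos: "e > 0" and absv_x: "absv x ^ e = 1 / real p"
begin

lemma absv_x_bounds: "0 < absv x" "absv x < 1" "x \<noteq> 0"
proof -
  show "x \<noteq> 0" using absv_x e_pos p_gt_1 by (auto simp: power_0_left)
  then show "0 < absv x" by simp
  show "absv x < 1"
  proof (rule ccontr)
    assume "\<not> absv x < 1"
    then have "1 \<le> absv x ^ e" by (intro one_le_power) simp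
    with absv_x p_gt_1 show False by simp
  qed
qed

lemma power_p_eq: "real p powi k = absv x powi (- int e * k)"
proof -
  have "real p = inverse (absv x ^ e)"
    unfolding absv_x by simp
  then have "real p = absv x powi (- int e)"
    by (simp add: power_int_minus)
  then show ?thesis by (simp only: power_int_mult)
qed

lemma powi_inject: "absv x powi k = absv x powi l \<longleftrightarrow> k = l"
  using power_int_strict_antimono[of "absv x"] absv_x_bounds
  by (metis linorder_neqE_linordered_idom order_less_irrefl power_int_strict_decreasing)

text \<open>A nonzero term \<open>b i * x ^ i\<close> has absolute value |x|^(i - e k) for some
  integer k, and for different i < e these exponents differ modulo e. So no two nonzero terms are
  equally large, and the sum is as large as its largest term.\<close>

lemma absv_power_span:
  assumes b: "\<And>i. b i \<in> K"
  shows "\<And>j. j < e \<Longrightarrow> absv (b j) * absv x ^ j \<le> absv (\<Sum>i<e. b i * x ^ i)"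
    and "(\<Sum>i<e. b i * x ^ i) \<noteq> 0 \<Longrightarrow> \<exists>k. absv (\<Sum>i<e. b i * x ^ i) = absv x powi k"
proof -
  define t where "t i = b i * x ^ i" for i
  define B where "B = Max ((\<lambda>i. absv (t i)) ` {..<e})"
  have "B \<in> (\<lambda>i. absv (t i)) ` {..<e}" unfolding B_def by (rule Max_in) (use e_pos in auto)
  then obtain j where j: "j < e" "B = absv (t j)" by auto
  have le: "absv (t i) \<le> absv (t j)" if "i < e" for i
    unfolding j(2)[symmetric] B_def by (rule Max_ge) (use that in auto)
  have val: "\<exists>k::int. absv (t i) = absv x powi (int i - int e * k)" if nz: "t i \<noteq> 0" for i
  proof -
    have "b i \<noteq> 0" using nz by (auto simp: t_def)
    then obtain k :: int where "absv (b i) = real p powi k" using b absv_K by blast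
    then have "absv (t i) = absv x powi (- int e * k) * absv x powi int i"
      by (simp add: t_def absv_mult power_p_eq)
    also have "\<dots> = absv x powi (- int e * k + int i)"
      using absv_x_bounds by (intro power_int_add[symmetric]) simp
    finally show ?thesis by (intro exI[of _ k]) (simp add: algebra_simps)
  qed
  have eq: "absv (\<Sum>i<e. t i) = absv (t j)"
  proof (cases "t j = 0")
    case True
    then have "t i = 0" if "i < e" for i using le[OF that] by simp
    then show ?thesis using True by simp
  next
    case False
    show ?thesis
    proof (rule absv_sum_unique_max)
      fix i assume i: "i \<in> {..<e}" "i \<noteq> j"
      have "absv (t i) \<noteq> absv (t j)"
      proof
        assume eq: "absv (t i) = absv (t j)"
        then have "t i \<noteq> 0" using False absv_eq_0 by metis
        then obtain k l :: int where "absv (t i) = absv x powi (int i - int e * k)"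
            "absv (t j) = absv x powi (int j - int e * l)"
          using val False by metis
        then have "int i - int e * k = int j - int e * l" using eq by (simp add: powi_inject)
        then have "int i - int j = int e * (k - l)" by (simp add: algebra_simps)
        then have "int e dvd int i - int j" by simp
        moreover have "\<bar>int i - int j\<bar> < int e" using i j by auto
        ultimately have "int i - int j = 0" using zdvd_imp_le[of "int e" "\<bar>int i - int j\<bar>"] by force
        with i show False by simp
      qed
      with le[of i] i show "absv (t i) < absv (t j)" by simp
    qed (use j in auto)
  qed
  show "absv (b i) * absv x ^ i \<le> absv (\<Sum>i<e. b i * x ^ i)" if "i < e" for i
    using le[OF that] eq by (simp add: t_def absv_mult)
  show "\<exists>k. absv (\<Sum>i<e. b i * x ^ i) = absv x powi k" if "(\<Sum>i<e. b i * x ^ i) \<noteq> 0"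
  proof -
    have "t j \<noteq> 0" using that eq by (auto simp: t_def[symmetric])
    then show ?thesis using val[of j] eq by (auto simp: t_def[symmetric])
  qed
qed

lemma value_group_power_span: "value_group (power_span K x e) \<subseteq> range (\<lambda>k::int. absv x powi k)"
proof
  fix v assume "v \<in> value_group (power_span K x e)"
  then obtain z where z: "z \<in> power_span K x e" "z \<noteq> 0" "v = absv z" by (auto simp: value_group_def)
  obtain b where "\<forall>i. b i \<in> K" "z = (\<Sum>i<e. b i * x ^ i)" using z(1) by (rule power_spanE)
  then show "v \<in> range (\<lambda>k::int. absv x powi k)"
    using absv_power_span(2)[of b] z(2,3) by blast
qed

section \<open>Expansions in powers of \<open>x\<close> over an intermediate field\<close>

context
  fixes M :: "'a set"
  assumes M: "type_subfield M" and KM: "K \<subseteq> M" and xM: "x \<in> M"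
    and value_group_M: "value_group M \<subseteq> range (\<lambda>k::int. absv x powi k)"
begin

interpretation M: type_subfield M by (rule M)

lemma absv_less_1_le:
  assumes "z \<in> M" "absv z < 1"
  shows "absv z \<le> absv x"
proof (cases "z = 0")
  case False
  with assms(1) have "absv z \<in> value_group M" by (rule value_groupI)
  then obtain k :: int where k: "absv z = absv x powi k" using value_group_M by blast
  have "k \<ge> 1"
  proof (rule ccontr)
    assume "\<not> k \<ge> 1"
    then have "absv x powi 0 \<le> absv x powi k"
      using absv_x_bounds by (intro power_int_decreasing) auto
    then show False using assms(2) k by simp
  qed
  then have "absv x powi k \<le> absv x powi 1"
    using absv_x_bounds by (intro power_int_decreasing) auto
  then show ?thesis by (simp add: k)
qed (use absv_x_bounds in simp)

text \<open>An integer of K with the same residue serves as leading digit, and discreteness of the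
  value group makes the difference divisible by \<open>x\<close>.\<close>

lemma expansion_step:
  assumes "w \<in> valuation_ring M"
  obtains a w' where "a \<in> valuation_ring K" "w' \<in> valuation_ring M" "w = a + x * w'"
proof -
  have w: "w \<in> M" "absv w \<le> 1" using assms by (auto simp: valuation_ring_def)
  have "reduce w \<in> residue_field K" by (simp add: residue_field_K)
  then obtain a where a: "a \<in> K" "absv a \<le> 1" "reduce w = reduce a"
    by (auto simp: residue_field_def valuation_ring_def)
  have mem: "w - a \<in> M" using w a KM by (intro M.diff_mem) auto
  have "absv (w - a) < 1" using reduce_eq_iff[OF w(2) a(2)] a(3) by simp
  then have "absv (w - a) \<le> absv x" by (rule absv_less_1_le[OF mem])
  then have "absv ((w - a) / x) \<le> 1"
    using absv_x_bounds by (simp add: absv_divide divide_le_eq_1)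
  then show ?thesis
    using that[of a "(w - a) / x"] a mem xM absv_x_bounds
    by (auto simp: valuation_ring_def intro: M.divide_mem)
qed

lemma expansion_below:
  assumes "w \<in> valuation_ring M"
  shows "\<exists>b w'. (\<forall>i. b i \<in> valuation_ring K) \<and> w' \<in> valuation_ring M \<and> w = (\<Sum>i<j. b i * x ^ i) + x ^ j * w'"
proof (induction j)
  case 0
  have "0 \<in> valuation_ring K" by (simp add: valuation_ring_def)
  then show ?case using assms by (intro exI[of _ "\<lambda>_. 0"] exI[of _ w]) simp
next
  case (Suc j)
  then obtain b w' where b: "\<forall>i. b i \<in> valuation_ring K" "w' \<in> valuation_ring M"
    "w = (\<Sum>i<j. b i * x ^ i) + x ^ j * w'" by blast
  obtain a w'' where a: "a \<in> valuation_ring K" "w'' \<in> valuation_ring M" "w' = a + x * w''"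
    using b(2) by (rule expansion_step)
  have "(\<Sum>i<j. (b(j := a)) i * x ^ i) = (\<Sum>i<j. b i * x ^ i)"
    by (rule sum.cong) auto
  then have "w = (\<Sum>i<Suc j. (b(j := a)) i * x ^ i) + x ^ Suc j * w''"
    by (simp add: b(3) a(3) algebra_simps)
  then show ?case
    using a b by (intro exI[of _ "b(j := a)"] exI[of _ w'']) auto
qed

text \<open>Since |x^e| = |p|, the remainder after \<open>e\<close> digits is divisible by p. The
  new digits are added to the coefficients already found, so the number of terms stays
  \<open>e\<close> while the precision grows.\<close>

lemma expansion_mod_p:
  assumes "w \<in> valuation_ring M"
  shows "\<exists>b w'. (\<forall>i. b i \<in> valuation_ring K) \<and> w' \<in> valuation_ring M \<and>
    w = (\<Sum>i<e. b i * x ^ i) + of_nat p ^ N * w'"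
proof (induction N)
  case 0
  have "0 \<in> valuation_ring K" by (simp add: valuation_ring_def)
  then show ?case using assms by (intro exI[of _ "\<lambda>_. 0"] exI[of _ w]) simp
next
  case (Suc N)
  then obtain b w' where b: "\<forall>i. b i \<in> valuation_ring K" "w' \<in> valuation_ring M"
    "w = (\<Sum>i<e. b i * x ^ i) + of_nat p ^ N * w'" by blast
  obtain c w'' where c: "\<forall>i. c i \<in> valuation_ring K" "w'' \<in> valuation_ring M"
    "w' = (\<Sum>i<e. c i * x ^ i) + x ^ e * w''"
    using expansion_below[OF b(2), of e] by blast
  have p0: "of_nat p \<noteq> (0 :: 'a)" using p_gt_1 by simp
  define u where "u = x ^ e / of_nat p * w''"
  have "u \<in> valuation_ring M"
    using c(2) xM p_gt_1 unfolding valuation_ring_def u_def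
    by (auto intro!: M.mult_mem M.divide_mem M.power_mem M.of_nat_mem
        simp: absv_mult absv_divide absv_x absv_p)
  moreover have "(b i + of_nat p ^ N * c i) \<in> valuation_ring K" for i
    using b(1) c(1) by (auto simp: valuation_ring_def absv_mult power_mult_distrib
        intro!: K.mem_intros absv_add_le mult_le_one power_le_one)
  moreover have "w = (\<Sum>i<e. (b i + of_nat p ^ N * c i) * x ^ i) + of_nat p ^ Suc N * u"
    using p0 unfolding b(3) c(3) u_def
    by (simp add: distrib_right distrib_left sum.distrib sum_distrib_left mult_ac)
  ultimately show ?case
    by (intro exI[of _ "\<lambda>i. b i + of_nat p ^ N * c i"] exI[of _ u]) simp
qed

text \<open>The expansions modulo the various powers of p are chosen independently of each other.
  Their coefficients converge nevertheless, because by \<open>absv_power_span\<close> a small sum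
  has small coefficients; the limits lie in K by completeness.\<close>

lemma valuation_ring_expansion:
  assumes z: "z \<in> valuation_ring M"
  obtains b where "\<And>i. b i \<in> valuation_ring K" "z = (\<Sum>i<e. b i * x ^ i)"
proof -
  obtain b w where b: "\<And>N i. b N i \<in> valuation_ring K" and w: "\<And>N. w N \<in> valuation_ring M"
    and zN: "\<And>N. z = (\<Sum>i<e. b N i * x ^ i) + of_nat p ^ N * w N"
    using expansion_mod_p[OF z] by metis
  define q where "q = 1 / real p"
  have q: "0 < q" "q < 1" using p_gt_1 by (auto simp: q_def)
  have rem: "absv (of_nat p ^ N * w N) \<le> q ^ N" for N
    by (rule absv_mult_le) (use w[of N] in \<open>auto simp: valuation_ring_def absv_p q_def power_one_over\<close>)
  \<comment> \<open>The loss of a factor 1/q comes from q = |x|^e \<le> |x|^i for i < e.\<close>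
  have close: "absv (b N i - b N' i) \<le> q ^ N / q" if "i < e" "N \<le> N'" for N N' i
  proof -
    have "(\<Sum>i<e. (b N i - b N' i) * x ^ i) = of_nat p ^ N' * w N' - of_nat p ^ N * w N"
      using zN[of N] zN[of N'] by (simp add: left_diff_distrib sum_subtractf algebra_simps)
    moreover have "absv (of_nat p ^ N' * w N' - of_nat p ^ N * w N) \<le> q ^ N"
      using rem[of N] order_trans[OF rem[of N'] power_decreasing[OF that(2), of q]] q by (intro absv_diff_le) auto
    moreover have "absv (b N i - b N' i) * absv x ^ i \<le> absv (\<Sum>i<e. (b N i - b N' i) * x ^ i)"
      by (rule absv_power_span(1)) (use b that in \<open>auto simp: valuation_ring_def intro: K.diff_mem\<close>)
    moreover have "q \<le> absv x ^ i"
      unfolding q_def absv_x[symmetric] using absv_x_bounds that by (intro power_decreasing) auto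
    then have "absv (b N i - b N' i) * q \<le> absv (b N i - b N' i) * absv x ^ i"
      by (rule mult_left_mono) simp
    ultimately have "absv (b N i - b N' i) * q \<le> q ^ N" by simp
    then show ?thesis using q by (simp add: field_simps)
  qed
  have small: "\<exists>N. q ^ N < \<epsilon>" if "\<epsilon> > 0" for \<epsilon>
    using real_arch_pow_inv[OF that q(2)] .
  have "\<exists>l\<in>K. (\<lambda>N. b N i) \<longlonglongrightarrow> l" if i: "i < e" for i
  proof -
    have "Cauchy (\<lambda>N. b N i)"
    proof (rule CauchyI')
      fix \<epsilon> :: real assume "\<epsilon> > 0"
      then obtain N where N: "q ^ N < \<epsilon> * q" using small[of "\<epsilon> * q"] q by auto
      show "\<exists>M. \<forall>m\<ge>M. \<forall>n>m. dist (b m i) (b n i) < \<epsilon>"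
      proof (intro exI allI impI)
        fix m n assume mn: "N \<le> m" "m < n"
        have "dist (b m i) (b n i) \<le> q ^ m / q"
          unfolding dist_absv using mn by (intro close i) simp
        also have "\<dots> \<le> q ^ N / q"
          using q mn by (intro divide_right_mono power_decreasing) auto
        also have "\<dots> < \<epsilon>" using N q by (simp add: field_simps)
        finally show "dist (b m i) (b n i) < \<epsilon>" .
      qed
    qed
    moreover have "b N i \<in> K" for N using b by (simp add: valuation_ring_def)
    ultimately show ?thesis
      using complete_K[unfolded complete_def, rule_format, of "\<lambda>N. b N i"] by simp
  qed
  then obtain l where l: "\<And>i. i < e \<Longrightarrow> l i \<in> K \<and> (\<lambda>N. b N i) \<longlonglongrightarrow> l i" by metis
  have approx: "absv (b N i - l i) \<le> q ^ N / q" if "i < e" for N i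
  proof (rule LIMSEQ_le_const2)
    have "(\<lambda>N'. dist (b N i) (b N' i)) \<longlonglongrightarrow> dist (b N i) (l i)"
      using l[OF that] by (intro tendsto_dist tendsto_const) blast
    then show "(\<lambda>N'. absv (b N i - b N' i)) \<longlonglongrightarrow> absv (b N i - l i)"
      by (simp add: dist_absv)
    show "\<exists>N0. \<forall>N'\<ge>N0. absv (b N i - b N' i) \<le> q ^ N / q"
      using close[OF that] by blast
  qed
  have integral: "absv (l i) \<le> 1" if "i < e" for i
  proof -
    have "absv (b 1 i - (b 1 i - l i)) \<le> 1"
      by (rule absv_diff_le) (use approx[OF that, of 1] b[of 1 i] q in \<open>auto simp: valuation_ring_def\<close>)
    then show ?thesis by simp
  qed
  \<comment> \<open>Extended by 0 so that every value, not only those below \<open>e\<close>, is an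
    integer of K.\<close>
  define l' where "l' i = (if i < e then l i else 0)" for i
  have "z - (\<Sum>i<e. l i * x ^ i) = 0"
  proof (rule ccontr)
    assume "z - (\<Sum>i<e. l i * x ^ i) \<noteq> 0"
    then have "0 < absv (z - (\<Sum>i<e. l i * x ^ i)) * q" using q by simp
    then obtain N where N: "q ^ N < absv (z - (\<Sum>i<e. l i * x ^ i)) * q" using small by blast
    have "z - (\<Sum>i<e. l i * x ^ i) = (\<Sum>i<e. (b N i - l i) * x ^ i) + of_nat p ^ N * w N"
      by (subst zN[of N]) (simp add: left_diff_distrib sum_subtractf)
    moreover have "absv (\<Sum>i<e. (b N i - l i) * x ^ i) \<le> q ^ N / q"
    proof (rule absv_sum_le)
      show "absv ((b N i - l i) * x ^ i) \<le> q ^ N / q" if "i \<in> {..<e}" for i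
        using that absv_x_bounds by (intro absv_mult_le approx) (auto simp: power_le_one)
    qed (use q in auto)
    moreover have "absv (of_nat p ^ N * w N) \<le> q ^ N / q"
    proof -
      have "q ^ N * q \<le> q ^ N" by (rule mult_left_le) (use q in auto)
      then have "q ^ N \<le> q ^ N / q" using q by (simp add: pos_le_divide_eq)
      with rem[of N] show ?thesis by (rule order_trans)
    qed
    ultimately have "absv (z - (\<Sum>i<e. l i * x ^ i)) \<le> q ^ N / q"
      by (simp add: absv_add_le)
    with N q show False by (simp add: field_simps)
  qed
  moreover have "(\<Sum>i<e. l' i * x ^ i) = (\<Sum>i<e. l i * x ^ i)"
    by (rule sum.cong) (auto simp: l'_def)
  moreover have "l' i \<in> valuation_ring K" for i
    using l integral by (auto simp: l'_def valuation_ring_def)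
  ultimately show ?thesis using that[of l'] by simp
qed

text \<open>A field containing K and \<open>x\<close> is thus determined by the bound on its value
  group. Applied to L, to its closure and to K(P), with suitable choices of \<open>x\<close>, this
  identifies the fields without any computation of degrees.\<close>

lemma eq_power_span: "M = power_span K x e"
proof
  show "power_span K x e \<subseteq> M"
    using KM xM by (auto elim!: power_spanE intro!: M.mem_intros)
  show "M \<subseteq> power_span K x e"
  proof
    fix z assume z: "z \<in> M"
    obtain n where n: "absv z < real p ^ n"
      using real_arch_pow[of "real p" "absv z"] p_gt_1 by auto
    have pn: "of_nat p ^ n \<noteq> (0 :: 'a)" using p_gt_1 by simp
    have "absv (of_nat p ^ n * z) \<le> 1"
      using n p_gt_1 by (simp add: absv_mult absv_p power_one_over field_simps)
    then have "of_nat p ^ n * z \<in> valuation_ring M"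
      using z by (simp add: valuation_ring_def M.mem_intros)
    then obtain b where b: "\<And>i. b i \<in> valuation_ring K" "of_nat p ^ n * z = (\<Sum>i<e. b i * x ^ i)"
      using valuation_ring_expansion by blast
    have "z = (of_nat p ^ n * z) / of_nat p ^ n" using pn by simp
    also have "\<dots> = (\<Sum>i<e. (b i / of_nat p ^ n) * x ^ i)"
      unfolding b(2) by (simp add: sum_divide_distrib)
    also have "\<dots> \<in> power_span K x e"
      by (rule power_spanI) (use b in \<open>auto simp: valuation_ring_def intro!: K.mem_intros\<close>)
    finally show "z \<in> power_span K x e" .
  qed
qed

text \<open>Powers of \<open>x\<close> already generate all integers of \<open>M\<close>, and
  further integral generators stay inside; \<open>S\<close> will be the set of coordinates of a
  torsion point.\<close>

lemma valuation_ring_eq_ring_adjoin: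
  assumes S: "x \<in> S" "S \<subseteq> valuation_ring M"
  shows "valuation_ring M = ring_adjoin (valuation_ring K) S"
proof
  show "valuation_ring M \<subseteq> ring_adjoin (valuation_ring K) S"
  proof
    fix z assume "z \<in> valuation_ring M"
    then obtain b where b: "\<And>i. b i \<in> valuation_ring K" "z = (\<Sum>i<e. b i * x ^ i)"
      using valuation_ring_expansion by blast
    show "z \<in> ring_adjoin (valuation_ring K) S"
      unfolding b(2) using b(1) S ring_adjoin_closed(1,2)
      by (intro ring_adjoin_sum ring_adjoin_closed(4) ring_adjoin_power) blast+
  qed
  show "ring_adjoin (valuation_ring K) S \<subseteq> valuation_ring M"
    by (rule ring_adjoin_least)
      (use S KM in \<open>auto simp: valuation_ring_def intro: M.mem_intros absv_add_le absv_mult_le\<close>)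
qed

end

text \<open>The values of K are the powers of |x| whose exponent is divisible by \<open>e\<close>,
  so the coset of |x|^k corresponds to k modulo \<open>e\<close>.\<close>

lemma ramification_index_eq:
  assumes "value_group M = range (\<lambda>k::int. absv x powi k)"
  shows "ramification_index K M = e"
proof -
  define c where "c k = (\<lambda>v. absv x powi k * v) ` value_group K" for k :: int
  have c: "c k = range (\<lambda>l. absv x powi (k - int e * l))" for k
    using absv_x_bounds unfolding c_def value_group_K image_image power_p_eq
    by (simp flip: power_int_add)
  have "(\<lambda>c. (\<lambda>v. c * v) ` value_group K) ` value_group M = c ` UNIV"
    by (simp add: assms c_def image_image)
  also have "\<dots> = c ` {0..<int e}"
  proof -
    have "c k = c (k mod int e)" for k
    proof -
      have k: "k mod int e = k - int e * (k div int e)" by (simp add: minus_mult_div_eq_mod)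
      have "absv x powi (k - int e * l) \<in> c (k mod int e)" for l
        unfolding c k by (rule range_eqI[of _ _ "l - k div int e"]) (simp add: algebra_simps)
      moreover have "absv x powi (k mod int e - int e * l) \<in> c k" for l
        unfolding c k by (rule range_eqI[of _ _ "l + k div int e"]) (simp add: algebra_simps)
      ultimately show ?thesis unfolding c[of k] c[of "k mod int e"] by auto
    qed
    moreover have "k mod int e \<in> {0..<int e}" for k using e_pos by simp
    ultimately show ?thesis by (metis (no_types, lifting) UNIV_I image_eqI image_subsetI subset_antisym image_mono subset_UNIV)
  qed
  also have "card (c ` {0..<int e}) = e"
  proof -
    have "inj_on c {0..<int e}"
    proof (rule inj_onI)
      fix k l assume kl: "k \<in> {0..<int e}" "l \<in> {0..<int e}" "c k = c l"
      have "absv x powi k \<in> c k" unfolding c by (rule range_eqI[of _ _ 0]) simp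
      then obtain m where "absv x powi k = absv x powi (l - int e * m)"
        unfolding kl(3) unfolding c by blast
      then have "k = l - int e * m" by (simp only: powi_inject)
      then have "k mod int e = l mod int e" by (simp add: mod_diff_eq[symmetric])
      then show "k = l" using kl by simp
    qed
    then show ?thesis by (simp add: card_image)
  qed
  finally show ?thesis by (simp add: ramification_index_def)
qed

end

section \<open>Zeros of strict series\<close>

lemma has_sum_finite_approx:
  fixes t :: "'b \<Rightarrow> 'a::nonarch_field"
  assumes "(t has_sum s) UNIV" "finite S0" "\<epsilon> > 0"
  obtains S where "finite S" "S0 \<subseteq> S" "absv (sum t S - s) < \<epsilon>"
proof -
  have "\<forall>\<^sub>F S in finite_subsets_at_top UNIV. dist (sum t S) s < \<epsilon>"
    using assms(1,3) by (auto simp: has_sum_def dest: tendstoD)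
  then obtain T where T: "finite T" "\<And>S. finite S \<Longrightarrow> T \<subseteq> S \<Longrightarrow> dist (sum t S) s < \<epsilon>"
    by (auto simp: eventually_finite_subsets_at_top)
  show ?thesis
    using that[of "S0 \<union> T"] T assms(2) by (simp add: dist_absv)
qed

text \<open>In a finite partial sum close to 0, the terms outside \<open>S0\<close> cannot cancel a
  larger sum over \<open>S0\<close>. Arguing with finite sums avoids limits in the incomplete
  ambient field.\<close>

lemma has_sum_0_dominant:
  fixes t :: "'b \<Rightarrow> 'a::nonarch_field"
  assumes sum0: "(t has_sum 0) UNIV" and S0: "finite S0" and B: "0 \<le> B"
    and rest: "\<And>m. m \<notin> S0 \<Longrightarrow> absv (t m) \<le> B"
  shows "absv (sum t S0) \<le> B"
proof (rule ccontr)
  assume "\<not> absv (sum t S0) \<le> B"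
  then have gt: "B < absv (sum t S0)" by simp
  then have "absv (sum t S0) > 0" using B by linarith
  then obtain S where S: "finite S" "S0 \<subseteq> S" "absv (sum t S - 0) < absv (sum t S0)"
    using has_sum_finite_approx[OF sum0 S0] by blast
  have "absv (sum t (S - S0)) \<le> B"
    by (rule absv_sum_le) (use B rest in auto)
  then have "absv (sum t S - sum t (S - S0)) < absv (sum t S0)"
    using S(3) gt by (intro absv_diff_less) auto
  also have "sum t S - sum t (S - S0) = sum t S0"
    using sum.subset_diff[OF S(2,1), of t] by simp
  finally show False by simp
qed

definition monomial :: "('v::finite \<Rightarrow> 'a::comm_monoid_mult) \<Rightarrow> ('v \<Rightarrow> nat) \<Rightarrow> 'a" where
  "monomial x m = (\<Prod>v\<in>UNIV. x v ^ m v)"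

lemma monomial_scale:
  "monomial (\<lambda>v. c * x v) m = c ^ multi_degree m * monomial x m" for c :: "'a::comm_semiring_1"
  by (simp add: monomial_def multi_degree_def power_mult_distrib prod.distrib power_sum)

lemma monomial_single: "monomial x ((\<lambda>_. 0)(v := n)) = x v ^ n"
proof -
  have "monomial x ((\<lambda>_. 0)(v := n)) = (\<Prod>w\<in>UNIV. if w = v then x w ^ n else 1)"
    unfolding monomial_def by (rule prod.cong) auto
  then show ?thesis by simp
qed

lemma absv_monomial_le_1:
  fixes x :: "'v::finite \<Rightarrow> 'a::nonarch_field"
  assumes "\<And>v. absv (x v) \<le> 1"
  shows "absv (monomial x m) \<le> 1"
  unfolding monomial_def absv_prod using assms by (intro prod_le_1) (auto simp: power_le_one)

lemma absv_monomial_le: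
  fixes x :: "'v::finite \<Rightarrow> 'a::nonarch_field"
  assumes "\<And>v. absv (x v) \<le> r"
  shows "absv (monomial x m) \<le> r ^ multi_degree m"
  unfolding monomial_def multi_degree_def absv_prod power_sum
  using assms by (intro prod_mono) (auto intro: power_mono)

lemma absv_mult_diff_le:
  fixes a b c d :: "'a::nonarch_field"
  assumes "absv (a - b) \<le> \<delta>" "absv (c - d) \<le> \<delta>" "absv b \<le> 1" "absv c \<le> 1"
  shows "absv (a * c - b * d) \<le> \<delta>"
proof -
  have "absv ((a - b) * c + (c - d) * b) \<le> \<delta>"
    using assms by (intro absv_add_le absv_mult_le)
  then show ?thesis by (simp add: algebra_simps)
qed

lemma absv_power_diff_le:
  fixes a b :: "'a::nonarch_field"
  assumes "absv (a - b) \<le> \<delta>" "absv a \<le> 1" "absv b \<le> 1"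
  shows "absv (a ^ n - b ^ n) \<le> \<delta>"
proof (induction n)
  case 0
  show ?case using assms(1) absv_ge_0[of "a - b"] by (simp del: absv_ge_0)
next
  case (Suc n)
  then show ?case
    unfolding power_Suc using assms by (intro absv_mult_diff_le) (auto simp: power_le_one)
qed

lemma absv_monomial_diff_le:
  fixes x y :: "'v::finite \<Rightarrow> 'a::nonarch_field"
  assumes "\<And>v. absv (x v - y v) \<le> \<delta>" "\<And>v. absv (x v) \<le> 1" "\<And>v. absv (y v) \<le> 1"
  shows "absv (monomial x m - monomial y m) \<le> \<delta>"
proof -
  have "0 \<le> \<delta>" using assms(1) absv_ge_0 order_trans by metis
  have "absv ((\<Prod>v\<in>I. x v ^ m v) - (\<Prod>v\<in>I. y v ^ m v)) \<le> \<delta>" if "finite I" for I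
    using that
  proof induction
    case (insert v I)
    have "absv (\<Prod>v\<in>I. x v ^ m v) \<le> 1"
      unfolding absv_prod using assms by (intro prod_le_1) (auto simp: power_le_one)
    with insert assms show ?case
      by (simp add: absv_mult_diff_le absv_power_diff_le power_le_one)
  qed (use \<open>0 \<le> \<delta>\<close> in simp)
  then show ?thesis by (simp add: monomial_def)
qed

lemma monomial_power:
  "monomial x (\<lambda>v. n * k v) = monomial x k ^ n" for x :: "'v::finite \<Rightarrow> 'a::comm_semiring_1"
  by (simp add: monomial_def power_mult mult.commute[of n] prod_power_distrib)

text \<open>In the expansion of ((a - b) + b)^p the inner binomial coefficients are divisible by p,
  and the last term is (a - b)^p. So p-th powers of close points are closer still.\<close>

lemma absv_power_prime_diff_le:
  fixes a b :: "'a::nonarch_field"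
  assumes p: "Factorial_Ring.prime p" and ab: "absv (a - b) \<le> \<delta>" "absv b \<le> 1" and \<delta>: "0 \<le> \<delta>" "\<delta> \<le> 1"
  shows "absv (a ^ p - b ^ p) \<le> max (absv (of_nat p :: 'a) * \<delta>) (\<delta> ^ p)"
proof -
  define t where "t = a - b"
  have t: "absv t \<le> \<delta>" using ab by (simp add: t_def)
  have p1: "p > 1" using p by (rule prime_gt_1_nat)
  have "a ^ p = (t + b) ^ p" by (simp add: t_def)
  also have "\<dots> = (\<Sum>k\<le>p. of_nat (p choose k) * t ^ k * b ^ (p - k))" by (rule binomial_ring)
  also have "\<dots> = b ^ p + (\<Sum>k\<in>{..p} - {0}. of_nat (p choose k) * t ^ k * b ^ (p - k))"
    by (subst sum.remove[of _ 0]) auto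
  finally have eq: "a ^ p - b ^ p = (\<Sum>k\<in>{..p} - {0}. of_nat (p choose k) * t ^ k * b ^ (p - k))"
    by simp
  show ?thesis
    unfolding eq
  proof (rule absv_sum_le)
    fix k assume k: "k \<in> {..p} - {0}"
    have "absv (of_nat (p choose k) * t ^ k) \<le> max (absv (of_nat p :: 'a) * \<delta>) (\<delta> ^ p)"
    proof (cases "k = p")
      case True
      then have "absv (of_nat (p choose k) * t ^ k) \<le> \<delta> ^ p"
        using t by (simp add: power_mono)
      then show ?thesis by simp
    next
      case False
      then have "p dvd (p choose k)" using k p by (intro dvd_choose_prime) auto
      then obtain c where c: "p choose k = p * c" by blast
      have "absv (t ^ k) \<le> \<delta>"
      proof -
        have "absv (t ^ k) \<le> \<delta> ^ k" using t by (simp add: power_mono)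
        also have "\<dots> \<le> \<delta> ^ 1" using k \<delta> by (intro power_decreasing) auto
        finally show ?thesis by simp
      qed
      then have "absv (of_nat p :: 'a) * absv (t ^ k) \<le> absv (of_nat p :: 'a) * \<delta>"
        by (intro mult_left_mono) auto
      then have "absv (of_nat p * t ^ k) \<le> absv (of_nat p :: 'a) * \<delta>"
        by (simp add: absv_mult)
      then have "absv (of_nat p * t ^ k * of_nat c) \<le> absv (of_nat p :: 'a) * \<delta>"
        by (rule absv_mult_le) simp
      then show ?thesis by (simp add: c mult_ac)
    qed
    then show "absv (of_nat (p choose k) * t ^ k * b ^ (p - k)) \<le> max (absv (of_nat p :: 'a) * \<delta>) (\<delta> ^ p)"
      by (rule absv_mult_le) (use ab in \<open>simp add: power_le_one\<close>)
  qed (use \<delta> in \<open>simp add: le_max_iff_disj\<close>)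
qed

text \<open>Retains, of multiplication by p on a strict formal group, the facts about coefficients
  that govern its zeros.\<close>

locale strict_series = discrete_base K p
  for K :: "'a::{field_char_0, nonarch_field} set" and p +
  fixes f :: "'n::finite \<Rightarrow> ('n, 'a) mfps" and d :: nat
  assumes p: "Factorial_Ring.prime p"
    and coeff_K: "mfps_nth (f i) m \<in> valuation_ring K"
    and const: "mfps_nth (f i) (\<lambda>_. 0) = 0"
    and linear: "mfps_nth (f i) ((\<lambda>_. 0)(v := 1)) = (if i = v then of_nat p else 0)"
    and unit_exponent: "absv (mfps_nth (f i) m) = 1 \<Longrightarrow> p dvd m v"
    and unit_degree_eq: "unit_degree (f i) = d"
    and strict: "(\<And>i. form_eval d (mfps_reduce (unit_form (f i))) y = 0) \<Longrightarrow> y = 0"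
    and d: "d \<ge> 2"
begin

lemma unit_multi_degree_ge:
  assumes "absv (mfps_nth (f i) m) = 1"
  shows "d \<le> multi_degree m"
  unfolding unit_degree_eq[of i, symmetric] unit_degree_def
  by (rule Least_le) (use assms in \<open>auto simp: unit_monomials_def\<close>)

lemma nonunit_le: "absv (mfps_nth (f i) m) \<noteq> 1 \<Longrightarrow> absv (mfps_nth (f i) m) \<le> 1 / real p"
  using coeff_K[of i m] by (intro absv_nonunit_le) (auto simp: valuation_ring_def)

lemma coeff_le_1: "absv (mfps_nth (f i) m) \<le> 1"
  using coeff_K[of i m] by (simp add: valuation_ring_def)

lemma multi_degree_1E:
  fixes m :: "'n \<Rightarrow> nat"
  assumes "multi_degree m = 1"
  obtains v where "m = (\<lambda>_. 0)(v := 1)"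
proof -
  have "m \<noteq> (\<lambda>_. 0)" using assms by auto
  then obtain v where v: "m v \<noteq> 0" by auto
  have "sum m UNIV = m v + sum m (UNIV - {v})" by (rule sum.remove) auto
  then have s: "m v + sum m (UNIV - {v}) = 1" using assms by (simp only: multi_degree_def)
  then have v1: "m v = 1" using v by linarith
  with s have "sum m (UNIV - {v}) = 0" by linarith
  then have "m w = 0" if "w \<noteq> v" for w using that by simp
  with v1 have "m = (\<lambda>_. 0)(v := 1)" by (auto simp: fun_eq_iff)
  then show ?thesis by (rule that)
qed

section \<open>The largest absolute value of a coordinate of a nonzero zero\<close>

context
  fixes x :: "'a ^ 'n"
  assumes small: "\<And>j. absv (x $ j) < 1" and zero: "\<And>i. mfps_has_value (f i) x 0" and nz: "x \<noteq> 0"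
begin

definition radius where "radius = Max (range (\<lambda>j. absv (x $ j)))"

definition dominant where "dominant = (SOME k. absv (x $ k) = radius)"

lemma absv_dominant: "absv (x $ dominant) = radius"
proof -
  have "radius \<in> range (\<lambda>j. absv (x $ j))" unfolding radius_def by (rule Max_in) auto
  then obtain k where "absv (x $ k) = radius" by auto
  then show ?thesis unfolding dominant_def by (rule someI)
qed

lemma absv_le_radius: "absv (x $ j) \<le> radius"
  unfolding radius_def by (rule Max_ge) auto

lemma radius_pos: "0 < radius"
proof -
  obtain j where "x $ j \<noteq> 0" using nz by (auto simp: vec_eq_iff)
  then have "0 < absv (x $ j)" by simp
  then show ?thesis using absv_le_radius by (rule less_le_trans)
qed

lemma radius_less_1: "radius < 1"
  using small[of dominant] by (simp add: absv_dominant)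

abbreviation t where "t i m \<equiv> mfps_nth (f i) m * monomial (($) x) m"

lemma t_has_sum: "(t i has_sum 0) UNIV"
  using zero[of i] by (simp add: mfps_has_value_def monomial_def)

lemma absv_t_le: "absv (t i m) \<le> absv (mfps_nth (f i) m) * radius ^ multi_degree m"
  unfolding absv_mult by (intro mult_left_mono absv_monomial_le absv_le_radius) simp

lemma radius_power_le: "n \<le> multi_degree m \<Longrightarrow> radius ^ multi_degree m \<le> radius ^ n"
  using radius_pos radius_less_1 by (intro power_decreasing) auto

lemma absv_t_nonunit_le:
  assumes "absv (mfps_nth (f i) m) \<noteq> 1" "n \<le> multi_degree m"
  shows "absv (t i m) \<le> radius ^ n / real p"
proof -
  have "absv (mfps_nth (f i) m) * radius ^ multi_degree m \<le> 1 / real p * radius ^ n"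
    using assms nonunit_le radius_power_le radius_pos by (intro mult_mono) auto
  then show ?thesis using absv_t_le[of i m] by simp
qed

lemma absv_t_unit_le:
  assumes "n \<le> multi_degree m"
  shows "absv (t i m) \<le> radius ^ n"
proof -
  have "absv (mfps_nth (f i) m) * radius ^ multi_degree m \<le> 1 * radius ^ n"
    using assms coeff_le_1 radius_power_le radius_pos by (intro mult_mono) auto
  then show ?thesis using absv_t_le[of i m] by simp
qed

text \<open>Suppose r^d > r/p for the radius r. Dividing by a largest coordinate and reducing gives
  a nonzero point, so by strictness some unit form does not vanish there, and its terms at
  \<open>x\<close> add up to absolute value exactly r^d. All other terms are at most max(r^(d+1),
  r/p) < r^d and cannot cancel them.\<close>

lemma unit_form_dominates: "radius ^ d \<le> radius / real p"
proof (rule ccontr)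
  assume "\<not> ?thesis"
  then have gt: "radius / real p < radius ^ d" by simp
  define y where "y = (\<chi> j. reduce (x $ j / x $ dominant))"
  have x0: "x $ dominant \<noteq> 0" using absv_dominant radius_pos by auto
  have int: "absv (x $ j / x $ dominant) \<le> 1" for j
    using absv_le_radius[of j] radius_pos by (simp add: absv_divide absv_dominant)
  have "y $ dominant = 1" using x0 by (simp add: y_def)
  then have "y \<noteq> 0" by auto
  then obtain i where i: "form_eval d (mfps_reduce (unit_form (f i))) y \<noteq> 0"
    using strict by blast
  define D where "D = {m :: 'n \<Rightarrow> nat. multi_degree m = d}"
  define S0 where "S0 = {m \<in> D. absv (mfps_nth (f i) m) = 1}"
  have finD: "finite D" by (rule finite_subset[OF _ finite_multi_degree_le[of d]]) (auto simp: D_def)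
  have S0: "finite S0" using finD by (simp add: S0_def)
  let ?z = "\<lambda>j. x $ j / x $ dominant"
  let ?c = "\<lambda>m. if m \<in> S0 then mfps_nth (f i) m else 0"
  have z: "absv (monomial ?z m) \<le> 1" for m
    by (rule absv_monomial_le_1) (rule int)
  have c: "absv (?c m) \<le> 1" for m using coeff_le_1 by simp
  have "form_eval d (mfps_reduce (unit_form (f i))) y = (\<Sum>m\<in>D. reduce (?c m) * (\<Prod>v\<in>UNIV. reduce (?z v) ^ m v))"
    unfolding form_eval_def D_def[symmetric]
    by (rule sum.cong) (auto simp: mfps_reduce_def unit_form_def unit_monomials_def unit_degree_eq S0_def D_def y_def)
  also have "\<dots> = (\<Sum>m\<in>D. reduce (?c m * monomial ?z m))"
  proof (rule sum.cong)
    fix m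
    have "(\<Prod>v\<in>UNIV. reduce (?z v) ^ m v) = reduce (monomial ?z m)"
      unfolding monomial_def using int by (subst reduce_prod) (simp_all add: power_le_one reduce_power)
    then show "reduce (?c m) * (\<Prod>v\<in>UNIV. reduce (?z v) ^ m v) = reduce (?c m * monomial ?z m)"
      using reduce_mult[OF c z] by simp
  qed simp
  also have "\<dots> = reduce (\<Sum>m\<in>D. ?c m * monomial ?z m)"
    by (rule reduce_sum[symmetric]) (rule absv_mult_le[OF c z])
  also have "(\<Sum>m\<in>D. ?c m * monomial ?z m) = (\<Sum>m\<in>S0. mfps_nth (f i) m * monomial ?z m)"
    by (rule sum.mono_neutral_cong_right) (auto simp: finD S0_def)
  finally have "reduce (\<Sum>m\<in>S0. mfps_nth (f i) m * monomial ?z m) \<noteq> 0" using i by simp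
  moreover have "absv (\<Sum>m\<in>S0. mfps_nth (f i) m * monomial ?z m) \<le> 1"
    by (rule absv_sum_le) (use coeff_le_1 z in \<open>auto intro: absv_mult_le\<close>)
  ultimately have one: "absv (\<Sum>m\<in>S0. mfps_nth (f i) m * monomial ?z m) = 1"
    using reduce_eq_0_iff[of "\<Sum>m\<in>S0. mfps_nth (f i) m * monomial ?z m"] by fastforce
  have "sum (t i) S0 = x $ dominant ^ d * (\<Sum>m\<in>S0. mfps_nth (f i) m * monomial ?z m)"
    unfolding sum_distrib_left
  proof (rule sum.cong)
    fix m assume "m \<in> S0"
    then have "multi_degree m = d" by (simp add: S0_def D_def)
    then show "t i m = x $ dominant ^ d * (mfps_nth (f i) m * monomial ?z m)"
      using monomial_scale[of "x $ dominant" ?z m] x0 by (simp add: mult_ac)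
  qed simp
  then have "absv (sum (t i) S0) = radius ^ d"
    by (simp add: absv_mult one absv_dominant)
  moreover have "absv (sum (t i) S0) \<le> max (radius ^ Suc d) (radius / real p)"
  proof (rule has_sum_0_dominant[OF t_has_sum S0])
    show "0 \<le> max (radius ^ Suc d) (radius / real p)" using radius_pos by (simp add: le_max_iff_disj)
    fix m assume m: "m \<notin> S0"
    show "absv (t i m) \<le> max (radius ^ Suc d) (radius / real p)"
    proof (cases "absv (mfps_nth (f i) m) = 1")
      case True
      then have "Suc d \<le> multi_degree m"
        using unit_multi_degree_ge[OF True] m by (cases "multi_degree m = d") (auto simp: S0_def D_def)
      then have "absv (t i m) \<le> radius ^ Suc d" by (rule absv_t_unit_le)
      then show ?thesis by simp
    next
      case False
      have "absv (t i m) \<le> radius / real p"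
      proof (cases "multi_degree m = 0")
        case True
        then show ?thesis using const[of i] radius_pos by simp
      next
        case False
        then have "1 \<le> multi_degree m" by linarith
        from absv_t_nonunit_le[OF \<open>absv (mfps_nth (f i) m) \<noteq> 1\<close> this] show ?thesis by simp
      qed
      then show ?thesis by simp
    qed
  qed
  moreover have "radius ^ Suc d < radius ^ d"
    using radius_pos radius_less_1 by simp
  ultimately show False using gt by simp
qed

text \<open>In the component of a largest coordinate the linear term has absolute value r/p. Other
  terms are at most r^d if their coefficient is a unit and at most r^2/p otherwise, because the
  constant coefficient and the remaining linear ones vanish.\<close>

lemma linear_term_dominates: "radius / real p \<le> radius ^ d"
proof (rule ccontr)
  assume "\<not> ?thesis"
  then have gt: "radius ^ d < radius / real p" by simp
  let ?e = "(\<lambda>_. 0)(dominant := 1 :: nat)"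
  have "absv (sum (t dominant) {?e}) = radius / real p"
    using monomial_single[of "($) x" dominant 1] linear[of dominant dominant]
    by (simp add: absv_mult absv_p absv_dominant)
  moreover have "absv (sum (t dominant) {?e}) \<le> max (radius ^ d) (radius ^ 2 / real p)"
  proof (rule has_sum_0_dominant[OF t_has_sum])
    show "0 \<le> max (radius ^ d) (radius ^ 2 / real p)" using radius_pos by (simp add: le_max_iff_disj)
    fix m assume m: "m \<notin> {?e}"
    show "absv (t dominant m) \<le> max (radius ^ d) (radius ^ 2 / real p)"
    proof (cases "absv (mfps_nth (f dominant) m) = 1")
      case True
      then have "absv (t dominant m) \<le> radius ^ d"
        by (intro absv_t_unit_le unit_multi_degree_ge)
      then show ?thesis by simp
    next
      case False
      consider "multi_degree m = 0" | "multi_degree m = 1" | "2 \<le> multi_degree m" by linarith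
      then have "absv (t dominant m) \<le> radius ^ 2 / real p"
      proof cases
        case 1
        then show ?thesis using const[of dominant] by simp
      next
        case 2
        then obtain v where "m = (\<lambda>_. 0)(v := 1)" by (rule multi_degree_1E)
        then show ?thesis using m linear[of dominant v] by auto
      next
        case 3
        then show ?thesis by (rule absv_t_nonunit_le[OF False])
      qed
      then show ?thesis by simp
    qed
  qed simp
  moreover have "radius ^ 2 / real p < radius / real p"
    using radius_pos radius_less_1 p_gt_1 by (simp add: power2_eq_square divide_strict_right_mono)
  ultimately show False using gt by simp
qed

lemma radius_power: "radius ^ (d - 1) = 1 / real p"
proof -
  have "radius * radius ^ (d - 1) = radius ^ d"
    using d by (simp flip: power_Suc)
  also have "\<dots> = radius * (1 / real p)"
    using unit_form_dominates linear_term_dominates by simp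
  finally have "radius * radius ^ (d - 1) = radius * (1 / real p)" .
  moreover have "radius \<noteq> 0" using radius_pos by simp
  ultimately show ?thesis using mult_left_cancel by blast
qed

end

end

context discrete_base
begin

text \<open>K already has all residues of the ambient field, so the residue extension is trivial and
  X - \<alpha> witnesses separability.\<close>

lemma tamely_ramified_if_same_residue_field:
  assumes "Defs.finite_extension K L" "K \<subseteq> L" "CHAR('a residue) = p" "\<not> p dvd ramification_index K L"
  shows "tamely_ramified K L"
proof -
  have "residue_field K \<subseteq> residue_field L"
    using assms(2) by (auto simp: residue_field_def valuation_ring_def)
  then have "residue_field L = UNIV" by (simp add: residue_field_K top.extremum_unique)
  moreover have "separable_extension (UNIV :: 'a residue set) UNIV"
    unfolding separable_extension_def
  proof
    fix \<alpha> :: "'a residue"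
    show "\<exists>h. set (coeffs h) \<subseteq> UNIV \<and> coprime h (pderiv h) \<and> poly h \<alpha> = 0"
      by (intro exI[of _ "[:- \<alpha>, 1:]"]) (simp add: pderiv_pCons flip: one_pCons)
  qed
  ultimately show ?thesis
    using assms residue_field_K by (simp add: tamely_ramified_def)
qed

end

context strict_series
begin

section \<open>Zeros lie in the field generated by \<pi>\<close>

context
  fixes \<pi> :: 'a
  assumes \<pi>: "\<pi> ^ (d - 1) = of_nat p"
begin

interpretation tame_uniformiser K p \<pi> "d - 1"
proof
  show "d - 1 > 0" using d by simp
  show "absv \<pi> ^ (d - 1) = 1 / real p"
    using arg_cong[OF \<pi>, of absv] by (simp add: absv_p)
qed

lemma absv_uniformiser_power_d: "absv \<pi> ^ d = absv (of_nat p * \<pi>)"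
proof -
  have "absv \<pi> ^ d = absv \<pi> ^ (d - 1) * absv \<pi>"
    using d by (simp flip: power_Suc2)
  then show ?thesis unfolding absv_x by (simp add: absv_mult absv_p)
qed

lemma absv_p_le_uniformiser: "1 / real p \<le> absv \<pi>"
proof -
  have "absv \<pi> ^ (d - 1) \<le> absv \<pi> ^ 1"
    using absv_x_bounds d by (intro power_decreasing) auto
  then show ?thesis unfolding absv_x by simp
qed

context
  fixes x :: "'a ^ 'n"
  assumes small: "\<And>j. absv (x $ j) < 1" and zero: "\<And>i. mfps_has_value (f i) x 0" and nz: "x \<noteq> 0"
begin

lemma radius_eq: "radius x = absv \<pi>"
proof (rule power_eq_imp_eq_base)
  show "radius x ^ (d - 1) = absv \<pi> ^ (d - 1)"
    using radius_power[OF small zero nz] absv_x by simp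
qed (use radius_pos[OF small zero nz] d in auto)

text \<open>The coefficient at \<open>m\<close> of f_i(\<pi> y)/(p \<pi>). This divisor makes the
  linear coefficient 1 and, as |\<pi>|^d = |p \<pi>|, leaves the others integral.\<close>

definition scaled_coeff where
  "scaled_coeff i m = mfps_nth (f i) m * \<pi> ^ multi_degree m / (of_nat p * \<pi>)"

lemma absv_scaled_coeff_le_1:
  assumes "m \<noteq> (\<lambda>_. 0)(i := 1)"
  shows "absv (scaled_coeff i m) \<le> 1"
    and "absv (mfps_nth (f i) m) \<noteq> 1 \<Longrightarrow> absv (scaled_coeff i m) \<le> absv \<pi>"
proof -
  have pos: "0 < absv (of_nat p * \<pi>)" using absv_x_bounds p_gt_1 by (simp add: absv_mult absv_p)
  show le: "absv (scaled_coeff i m) \<le> absv \<pi>" if nonunit: "absv (mfps_nth (f i) m) \<noteq> 1"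
  proof -
    consider "multi_degree m = 0" | "multi_degree m = 1" | "2 \<le> multi_degree m" by linarith
    then show ?thesis
    proof cases
      case 1
      then show ?thesis using const[of i] by (simp add: scaled_coeff_def)
    next
      case 2
      then obtain v where "m = (\<lambda>_. 0)(v := 1)" by (rule multi_degree_1E)
      then show ?thesis using assms linear[of i v] by (auto simp: scaled_coeff_def)
    next
      case 3
      have "absv (mfps_nth (f i) m) * absv \<pi> ^ multi_degree m \<le> 1 / real p * absv \<pi> ^ 2"
        using nonunit_le[OF nonunit] 3 absv_x_bounds by (intro mult_mono power_decreasing) auto
      also have "\<dots> = absv \<pi> * absv (of_nat p * \<pi>)"
        by (simp add: absv_mult absv_p power2_eq_square)
      finally show ?thesis
        using pos by (simp add: scaled_coeff_def absv_divide absv_mult[of "mfps_nth _ _"] pos_divide_le_eq)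
    qed
  qed
  show "absv (scaled_coeff i m) \<le> 1"
  proof (cases "absv (mfps_nth (f i) m) = 1")
    case True
    have "absv \<pi> ^ multi_degree m \<le> absv \<pi> ^ d"
      using unit_multi_degree_ge[OF True] absv_x_bounds by (intro power_decreasing) auto
    then show ?thesis
      using pos True
      by (simp add: scaled_coeff_def absv_divide absv_mult[of "mfps_nth _ _"] absv_uniformiser_power_d)
  next
    case False
    then show ?thesis using le absv_x_bounds by fastforce
  qed
qed

lemma scaled_coeff_single: "scaled_coeff i ((\<lambda>_. 0)(i := 1)) = 1"
  using linear[of i i] absv_x_bounds p_gt_1 by (simp add: scaled_coeff_def)

text \<open>
  With \<open>x = \<pi>y\<close>, the equations \<open>f\<^sub>i(x) = 0\<close> say that \<open>y\<close> is a fixed point of a map whose coefficients are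
  divisible by \<open>\<pi>\<close> except at monomials that are \<open>p\<close>-th powers. Such a map is a contraction on residue
  classes, so iterating it on an approximation of \<open>y\<close> in \<open>L\<close> gives approximations of any precision.
\<close>

lemma zero_in_closure:
  assumes L: "type_subfield L" and KL: "K \<subseteq> L" and \<pi>L: "\<pi> \<in> L"
  shows "x $ j \<in> closure L"
proof -
  interpret L: type_subfield L by (rule L)
  define y where "y v = x $ v / \<pi>" for v
  have x: "($) x = (\<lambda>v. \<pi> * y v)" using absv_x_bounds by (simp add: y_def fun_eq_iff)
  have y1: "absv (y v) \<le> 1" for v
    using absv_le_radius[OF small zero nz, of v] absv_x_bounds radius_eq
    by (simp add: y_def absv_divide)
  have "\<exists>z. z \<in> K \<and> absv z \<le> 1 \<and> absv (y v - z) < 1" for v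
  proof -
    have "reduce (y v) \<in> residue_field K" by (simp add: residue_field_K)
    then obtain z where "z \<in> K" "absv z \<le> 1" "reduce (y v) = reduce z"
      by (auto simp: residue_field_def valuation_ring_def)
    then show ?thesis using reduce_eq_iff[OF y1] by blast
  qed
  then obtain z0 where z0: "\<And>v. z0 v \<in> K" "\<And>v. absv (z0 v) \<le> 1" "\<And>v. absv (y v - z0 v) < 1" by metis
  \<comment> \<open>The contraction factor. It bounds |\<pi>| and the initial errors, and is below 1
    because there are finitely many coordinates.\<close>
  define \<rho> where "\<rho> = max (absv \<pi>) (Max (range (\<lambda>v. absv (y v - z0 v))))"
  have "Max (range (\<lambda>v. absv (y v - z0 v))) < 1" using z0(3) by (subst Max_less_iff) auto
  then have \<rho>: "0 < \<rho>" "\<rho> < 1" "absv \<pi> \<le> \<rho>" using absv_x_bounds by (auto simp: \<rho>_def less_max_iff_disj)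
  have base: "absv (y v - z0 v) \<le> \<rho>" for v
    unfolding \<rho>_def by (intro max.coboundedI2 Max_ge) auto
  let ?c = scaled_coeff
  have "\<exists>z. \<forall>v. z v \<in> L \<and> absv (z v) \<le> 1 \<and> absv (y v - z v) \<le> \<rho> ^ Suc n" for n
  proof (induction n)
    case 0
    then show ?case using z0 base KL by (intro exI[of _ z0]) auto
  next
    case (Suc n)
    then obtain z where z: "\<And>v. z v \<in> L" "\<And>v. absv (z v) \<le> 1" "\<And>v. absv (y v - z v) \<le> \<rho> ^ Suc n" by metis
    have "\<exists>w. w \<in> L \<and> absv w \<le> 1 \<and> absv (y i - w) \<le> \<rho> ^ Suc (Suc n)" for i
    proof -
      let ?e = "(\<lambda>_. 0)(i := 1 :: nat)"
      have pos: "0 < absv (of_nat p * \<pi>)" using absv_x_bounds p_gt_1 by (simp add: absv_mult absv_p)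
      then have "0 < \<rho> ^ Suc (Suc n) * absv (of_nat p * \<pi>)" using \<rho> by simp
      \<comment> \<open>A finite partial sum has the required precision, so the next approximation
        is a finite expression and stays in \<open>L\<close>.\<close>
      then obtain S where S: "finite S" "{?e} \<subseteq> S"
        and "absv ((\<Sum>m\<in>S. mfps_nth (f i) m * monomial (($) x) m) - 0) < \<rho> ^ Suc (Suc n) * absv (of_nat p * \<pi>)"
        using has_sum_finite_approx[OF t_has_sum[OF small zero nz], of "{?e}"] by blast
      moreover have "mfps_nth (f i) m * monomial (($) x) m = of_nat p * \<pi> * (?c i m * monomial y m)" for m
        unfolding x monomial_scale using absv_x_bounds p_gt_1 by (simp add: scaled_coeff_def)
      ultimately have "absv (of_nat p * \<pi> * (\<Sum>m\<in>S. ?c i m * monomial y m)) < \<rho> ^ Suc (Suc n) * absv (of_nat p * \<pi>)"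
        by (simp add: sum_distrib_left)
      then have tail: "absv (\<Sum>m\<in>S. ?c i m * monomial y m) < \<rho> ^ Suc (Suc n)"
        unfolding absv_mult[of "of_nat p * \<pi>"] mult.commute[of "absv (of_nat p * \<pi>)"]
        using pos by (rule mult_right_less_imp_less[OF _ less_imp_le])
      \<comment> \<open>The linear coefficient is 1: the truncated equation is solved for
        \<open>y i\<close>, with \<open>y\<close> replaced by \<open>z\<close> in the other
        terms.\<close>
      define w where "w = - (\<Sum>m\<in>S - {?e}. ?c i m * monomial z m)"
      have diff: "absv (?c i m * (monomial y m - monomial z m)) \<le> \<rho> ^ Suc (Suc n)" if m: "m \<in> S - {?e}" for m
      proof (cases "absv (mfps_nth (f i) m) = 1")
        case True
        then have "\<exists>k. m = (\<lambda>v. p * k v)"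
          using unit_exponent[OF True] by (intro exI[of _ "\<lambda>v. m v div p"]) auto
        then obtain k where k: "m = (\<lambda>v. p * k v)" by blast
        have "absv (monomial y m - monomial z m) \<le> max (absv (of_nat p :: 'a) * \<rho> ^ Suc n) ((\<rho> ^ Suc n) ^ p)"
          unfolding k monomial_power
          by (rule absv_power_prime_diff_le[OF p absv_monomial_diff_le[OF z(3) y1 z(2)] absv_monomial_le_1[OF z(2)]])
            (use \<rho> in \<open>auto simp del: power_Suc intro: power_le_one\<close>)
        \<comment> \<open>In the first entry the factor |p| \<le> |\<pi>| \<le> \<rho> gains one
          power; in the second, (n + 1) p \<ge> n + 2 since p \<ge> 2.\<close>
        also have "\<dots> \<le> \<rho> ^ Suc (Suc n)"
        proof (rule max.boundedI)
          show "absv (of_nat p :: 'a) * \<rho> ^ Suc n \<le> \<rho> ^ Suc (Suc n)"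
            unfolding power_Suc[of \<rho> "Suc n"] absv_p
            using \<rho> absv_p_le_uniformiser by (intro mult_right_mono) auto
          have "Suc n * 2 \<le> Suc n * p" using p_gt_1 by (intro mult_le_mono2) simp
          then have "Suc (Suc n) \<le> Suc n * p" by simp
          then show "(\<rho> ^ Suc n) ^ p \<le> \<rho> ^ Suc (Suc n)"
            unfolding power_mult[symmetric] using \<rho> by (intro power_decreasing) auto
        qed
        finally have "absv ((monomial y m - monomial z m) * ?c i m) \<le> \<rho> ^ Suc (Suc n)"
          by (rule absv_mult_le) (use m in \<open>auto intro: absv_scaled_coeff_le_1\<close>)
        then show ?thesis by (simp only: mult.commute)
      next
        case False
        have "absv (?c i m) * absv (monomial y m - monomial z m) \<le> \<rho> * \<rho> ^ Suc n"
          using absv_scaled_coeff_le_1(2)[OF _ False] m \<rho> absv_monomial_diff_le[OF z(3) y1 z(2)]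
          by (intro mult_mono) auto
        then show ?thesis by (simp add: absv_mult)
      qed
      have "y i - w = (\<Sum>m\<in>S. ?c i m * monomial y m) - (\<Sum>m\<in>S - {?e}. ?c i m * (monomial y m - monomial z m))"
        using S monomial_single[of y i 1] scaled_coeff_single[of i]
        by (simp add: w_def sum.remove[of S ?e] right_diff_distrib sum_subtractf)
      moreover have "absv (\<Sum>m\<in>S - {?e}. ?c i m * (monomial y m - monomial z m)) \<le> \<rho> ^ Suc (Suc n)"
        by (rule absv_sum_le) (use \<rho> diff in auto)
      ultimately have "absv (y i - w) \<le> \<rho> ^ Suc (Suc n)"
        using tail by (simp only: absv_diff_le less_imp_le)
      moreover have "absv w \<le> 1"
        unfolding w_def absv_uminus
        by (intro absv_sum_le absv_mult_le absv_scaled_coeff_le_1(1) absv_monomial_le_1 z(2)) auto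
      moreover have "w \<in> L"
      proof -
        have "mfps_nth (f i) m \<in> L" for m using coeff_K[of i m] KL by (auto simp: valuation_ring_def)
        then show ?thesis
          unfolding w_def scaled_coeff_def monomial_def using \<pi>L z(1) by (intro L.mem_intros)
      qed
      ultimately show ?thesis by blast
    qed
    then show ?case by metis
  qed
  then have approx: "\<exists>z\<in>L. absv (y v - z) \<le> \<rho> ^ Suc n" for v n by metis
  have "y j \<in> closure L"
    unfolding closure_absv_iff
  proof (intro allI impI)
    fix \<epsilon> :: real assume "\<epsilon> > 0"
    then obtain n where n: "\<rho> ^ n < \<epsilon>" using real_arch_pow_inv \<rho> by blast
    have "\<rho> ^ Suc n \<le> \<rho> ^ n" using \<rho> by (intro power_decreasing) auto
    with n approx[of j n] show "\<exists>z\<in>L. absv (y j - z) < \<epsilon>" by force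
  qed
  moreover have "\<pi> \<in> closure L" using \<pi>L closure_subset by blast
  ultimately have "\<pi> * y j \<in> closure L"
    using type_subfield_closure[OF L] by (simp add: type_subfield.mult_mem)
  then show ?thesis using x by (simp add: fun_eq_iff)
qed

end

text \<open>The field K(\<pi>); the name anticipates that it contains the coordinates of all zeros
  in the open unit polydisc.\<close>

definition splitting_field where "splitting_field = power_span K \<pi> (d - 1)"

lemma splitting_field:
  shows "Defs.finite_extension K splitting_field" "type_subfield splitting_field" "K \<subseteq> splitting_field"
    "\<pi> \<in> splitting_field" "value_group splitting_field = range (\<lambda>k::int. absv \<pi> powi k)"
proof -
  have "\<pi> ^ (d - 1) = (\<Sum>i<d - 1. (if i = 0 then of_nat p else 0) * \<pi> ^ i)"
    using \<pi> d by (simp add: if_distrib[of "\<lambda>u. u * _"] cong: if_cong)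
  also have "\<dots> \<in> power_span K \<pi> (d - 1)"
    by (rule power_spanI) (auto intro: K.of_nat_mem)
  finally have ext: "Defs.finite_extension K splitting_field" "\<pi> \<in> splitting_field"
    unfolding splitting_field_def using d by (auto intro: K.finite_extension_power_span)
  show "Defs.finite_extension K splitting_field" "\<pi> \<in> splitting_field" by (rule ext)+
  show L: "type_subfield splitting_field" and "K \<subseteq> splitting_field"
    using ext(1) by (simp_all add: Defs.finite_extension_def type_subfield_def)
  interpret L: type_subfield splitting_field by (rule L)
  have "absv \<pi> powi k \<in> value_group splitting_field" for k :: int
  proof -
    define w where "w = (if k \<ge> 0 then \<pi> ^ nat k else inverse (\<pi> ^ nat (- k)))"
    have "absv w = absv \<pi> powi k"
      by (simp add: w_def power_int_def absv_inverse power_inverse)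
    moreover have "w \<in> splitting_field" "w \<noteq> 0"
      using ext(2) absv_x_bounds(3) by (simp_all add: w_def L.power_mem L.inverse_mem)
    then have "absv w \<in> value_group splitting_field" by (rule value_groupI)
    ultimately show ?thesis by simp
  qed
  then show "value_group splitting_field = range (\<lambda>k::int. absv \<pi> powi k)"
    using value_group_power_span unfolding splitting_field_def by blast
qed

text \<open>The closure has the same value group, so \<open>eq_power_span\<close> identifies it with
  the same span. This stands in for completeness of a finite extension of K.\<close>

lemma closure_splitting_field: "closure splitting_field = splitting_field"
proof -
  have "closure splitting_field = power_span K \<pi> (d - 1)"
  proof (rule eq_power_span)
    show "type_subfield (closure splitting_field)"
      by (rule type_subfield_closure) (rule splitting_field)
    show "K \<subseteq> closure splitting_field" "\<pi> \<in> closure splitting_field"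
      using splitting_field(3,4) closure_subset by blast+
    show "value_group (closure splitting_field) \<subseteq> range (\<lambda>k::int. absv \<pi> powi k)"
      by (simp add: value_group_closure splitting_field(5))
  qed
  then show ?thesis by (simp add: splitting_field_def)
qed

lemma coordinates_subset_splitting_field:
  fixes x :: "'a ^ 'n"
  assumes "\<And>j. absv (x $ j) < 1" "\<And>i. mfps_has_value (f i) x 0"
  shows "coordinates x \<subseteq> splitting_field"
proof (cases "x = 0")
  case True
  interpret L: type_subfield splitting_field by (rule splitting_field)
  show ?thesis using True by (auto simp: coordinates_def)
next
  case False
  have "x $ j \<in> closure splitting_field" for j
    by (rule zero_in_closure[OF assms False]) (rule splitting_field)+
  then show ?thesis by (auto simp: coordinates_def closure_splitting_field)
qed

text \<open>A largest coordinate \<open>u\<close> has the absolute value of \<pi> and so is itself a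
  uniformiser. The field generated by the coordinates contains \<open>u\<close> and lies in
  \<open>splitting_field\<close>, hence \<open>eq_power_span\<close> for \<open>u\<close> gives both
  fields the same span.\<close>

lemma zero_generates:
  fixes x :: "'a ^ 'n"
  assumes x: "\<And>j. absv (x $ j) < 1" "\<And>i. mfps_has_value (f i) x 0" "x \<noteq> 0"
  shows "field_adjoin K (coordinates x) = splitting_field"
    and "valuation_ring splitting_field = ring_adjoin (valuation_ring K) (coordinates x)"
proof -
  define u where "u = x $ dominant x"
  have u: "absv u = absv \<pi>"
    unfolding u_def absv_dominant[OF x] by (rule radius_eq[OF x])
  interpret U: tame_uniformiser K p u "d - 1"
    by standard (use d absv_x u in auto)
  have uc: "u \<in> coordinates x" by (auto simp: u_def coordinates_def)
  have sub: "field_adjoin K (coordinates x) \<subseteq> splitting_field"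
    by (intro field_adjoin_least splitting_field coordinates_subset_splitting_field x)
  have "splitting_field = power_span K u (d - 1)"
    using coordinates_subset_splitting_field[OF x(1,2)] uc
    by (intro U.eq_power_span splitting_field) (auto simp: u splitting_field(5))
  moreover have "field_adjoin K (coordinates x) = power_span K u (d - 1)"
  proof (rule U.eq_power_span)
    show "value_group (field_adjoin K (coordinates x)) \<subseteq> range (\<lambda>k::int. absv u powi k)"
      using value_group_mono[OF sub] by (simp add: u splitting_field(5))
    show "u \<in> field_adjoin K (coordinates x)" using uc field_adjoin_incl(2) by blast
  qed (rule type_subfield_field_adjoin field_adjoin_incl)+
  ultimately show "field_adjoin K (coordinates x) = splitting_field" by simp
  show "valuation_ring splitting_field = ring_adjoin (valuation_ring K) (coordinates x)"
  proof (rule U.valuation_ring_eq_ring_adjoin)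
    show "coordinates x \<subseteq> valuation_ring splitting_field"
      using coordinates_subset_splitting_field[OF x(1,2)] x(1)
      by (auto simp: valuation_ring_def coordinates_def less_imp_le)
    show "u \<in> splitting_field" using coordinates_subset_splitting_field[OF x(1,2)] uc by blast
  qed (use uc splitting_field in \<open>auto simp: u\<close>)
qed

lemma tamely_ramified_splitting_field:
  assumes "CHAR('a residue) = p" "\<not> p dvd d - 1"
  shows "tamely_ramified K splitting_field"
  using assms splitting_field ramification_index_eq[OF splitting_field(5)]
  by (intro tamely_ramified_if_same_residue_field) auto

end

end

theorem theoremB:
  fixes p :: nat
    and K :: "'a::{alg_closed_field, field_char_0, nonarch_field} set"
    and F :: "'n::finite \<Rightarrow> ('n + 'n, 'a) mfps"
  assumes "Factorial_Ring.prime p" and "p > 2"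
    and "completed_maximal_unramified p K"
    and "algebraic_closure_of K"
    and "formal_group_law (valuation_ring K) F"
    and "strict_formal_group p F"
  shows "(\<forall>P\<in>torsion_points p F. P \<noteq> 0 \<longrightarrow>
            tamely_ramified K (field_adjoin K (coordinates P)) \<and>
            valuation_ring (field_adjoin K (coordinates P)) =
              ring_adjoin (valuation_ring K) (coordinates P)) \<and>
         tamely_ramified K (field_adjoin K (\<Union>P\<in>torsion_points p F. coordinates P))"
proof -
  have absv_p: "absv (of_nat p :: 'a) = 1 / real p"
    using assms(3) by (simp add: completed_maximal_unramified_def)
  interpret N: normalised_absv_closed p "TYPE('a)"
    by standard (use assms(1) absv_p in auto)
  have K: "type_subfield K" by (rule N.type_subfield_base[OF assms(3,4)])
  interpret D: discrete_base K p
  proof (rule discrete_base.intro)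
    show "complete K" using assms(3) unfolding completed_maximal_unramified_def by blast
  qed (rule K N.p_gt_1 absv_p N.value_group_base[OF assms(3,4)] N.residue_field_base[OF assms(3,4)])+
  let ?f = "formal_mult F p"
  have ring: "coefficient_ring (valuation_ring K)"
    by (rule coefficient_ring_valuation_ring) (auto intro: D.K.mem_intros)
  have integral: "absv x \<le> 1" if "x \<in> valuation_ring K" for x using that by (simp add: valuation_ring_def)
  have coeff: "mfps_nth (?f i) m \<in> valuation_ring K" for i m
    using coefficient_ring.series_over_formal_mult[OF ring assms(5), of p i]
    by (simp add: coefficient_ring.series_over_def[OF ring])
  have const: "mfps_nth (?f i) (\<lambda>_. 0) = 0" for i
    by (rule formal_mult_const[OF assms(5) ring integral])
  have linear: "mfps_nth (?f i) ((\<lambda>_. 0)(v := 1)) = (if i = v then of_nat p else 0)" for i v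
    by (rule formal_mult_linear[OF assms(5) ring integral])
  have exponent: "p dvd m v" if "absv (mfps_nth (?f i) m) = 1" for i m v
  proof -
    have "absv (of_nat (m v) :: 'a) \<le> 1 / real p"
      using absv_exponent_formal_mult_le[OF assms(5) ring integral, of m v p i] that
      by (simp add: absv_mult absv_p)
    also have "\<dots> < 1" using N.p_gt_1 by simp
    finally show ?thesis by (simp add: N.absv_of_nat_less_1_iff)
  qed
  obtain d where deg: "\<And>i. unit_degree (?f i) = d"
    and strict: "\<And>y. (\<forall>i. form_eval d (mfps_reduce (unit_form (?f i))) y = 0) \<Longrightarrow> y = 0"
    and units: "\<And>i. unit_monomials (?f i) \<noteq> {}"
    using assms(6) unfolding strict_formal_group_def by blast
  \<comment> \<open>Some unit monomial has degree \<open>d\<close>; all its exponents are divisible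
    by p, and it is not constant because the constant term is 0.\<close>
  have "p dvd d \<and> d \<noteq> 0"
  proof -
    fix i :: 'n
    have "\<exists>d. \<exists>m\<in>unit_monomials (?f i). multi_degree m = d" using units[of i] by blast
    then have "\<exists>m\<in>unit_monomials (?f i). multi_degree m = d"
      unfolding deg[of i, symmetric] unit_degree_def by (rule LeastI_ex)
    then obtain m where m: "absv (mfps_nth (?f i) m) = 1" "multi_degree m = d"
      by (auto simp: unit_monomials_def)
    have "p dvd multi_degree m"
      unfolding multi_degree_def by (rule dvd_sum) (rule exponent[OF m(1)])
    moreover have "m \<noteq> (\<lambda>_. 0)" using m(1) const[of i] by auto
    ultimately show ?thesis using m(2) by auto
  qed
  then have d: "d \<ge> 2" and tame: "\<not> p dvd d - 1"
  proof -
    assume "p dvd d \<and> d \<noteq> 0"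
    then have "p \<le> d" by (auto dest: dvd_imp_le)
    then show "d \<ge> 2" using assms(2) by simp
    show "\<not> p dvd d - 1"
    proof
      assume "p dvd d - 1"
      then have "p dvd d - (d - 1)"
        using \<open>p dvd d \<and> d \<noteq> 0\<close> dvd_diff_nat by blast
      moreover have "d - (d - 1) = 1" using \<open>p \<le> d\<close> assms(2) by simp
      ultimately show False using assms(2) by simp
    qed
  qed
  interpret S: strict_series K p ?f d
    by standard (use assms(1) coeff const linear exponent deg strict d in auto)
  obtain \<pi> :: 'a where \<pi>: "\<pi> ^ (d - 1) = of_nat p"
    using nth_root_exists[of "d - 1" "of_nat p :: 'a"] d by auto
  let ?L = "S.splitting_field \<pi>"
  have char: "CHAR('a residue) = p" by (rule N.CHAR_residue)
  have torsion: "(\<forall>j. absv (P $ j) < 1) \<and> (\<forall>i. mfps_has_value (?f i) P 0)" if "P \<in> torsion_points p F" for P :: "'a ^ 'n"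
    using that by (simp add: torsion_points_def)
  have L: "tamely_ramified K ?L"
    by (rule S.tamely_ramified_splitting_field[OF \<pi> char tame])
  have gen: "field_adjoin K (coordinates P) = ?L"
    "valuation_ring ?L = ring_adjoin (valuation_ring K) (coordinates P)"
    if "P \<in> torsion_points p F" "P \<noteq> 0" for P
    using S.zero_generates[OF \<pi>, of P] torsion[OF that(1)] that(2) by blast+
  have "tamely_ramified K (field_adjoin K (\<Union>P\<in>torsion_points p F. coordinates P))"
  \<comment> \<open>With a nonzero torsion point P, the field K(F[p]) is squeezed between K(P) = L
    and L. Otherwise it is K, whose ramification index over itself is 1.\<close>
  proof (cases "\<exists>P\<in>torsion_points p F. P \<noteq> 0")
    case True
    then obtain P where P: "P \<in> torsion_points p F" "P \<noteq> 0" by blast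
    let ?M = "field_adjoin K (\<Union>P\<in>torsion_points p F. coordinates P)"
    have "(\<Union>P\<in>torsion_points p F. coordinates P) \<subseteq> ?L"
      using S.coordinates_subset_splitting_field[OF \<pi>] torsion by (intro UN_least) blast
    then have "?M \<subseteq> ?L"
      by (intro field_adjoin_least S.splitting_field[OF \<pi>])
    moreover have "coordinates P \<subseteq> (\<Union>P\<in>torsion_points p F. coordinates P)"
      using P(1) by blast
    then have "coordinates P \<subseteq> ?M"
      using field_adjoin_incl(2) by (rule subset_trans)
    then have "field_adjoin K (coordinates P) \<subseteq> ?M"
      by (rule field_adjoin_least[OF type_subfield_field_adjoin field_adjoin_incl(1)])
    ultimately have "?M = ?L" unfolding gen(1)[OF P] by (rule subset_antisym)
    then show ?thesis using L by (simp only:)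
  next
    case False
    have "field_adjoin K (\<Union>P\<in>torsion_points p F. coordinates P) = K"
    proof
      show "field_adjoin K (\<Union>P\<in>torsion_points p F. coordinates P) \<subseteq> K"
        using False by (intro field_adjoin_least K) (auto simp: coordinates_def)
    qed (rule field_adjoin_incl)
    moreover have "tamely_ramified K K"
    proof (rule D.tamely_ramified_if_same_residue_field)
      interpret R: Ring.field "ring_of_type_algebra :: 'a ring" by rule
      have "R.finite_dimension K K"
        by (rule R.finite_dimensionI[OF R.dimension_one]) (rule D.K.subfield)
      then show "Defs.finite_extension K K"
        by (simp add: Defs.finite_extension_def D.K.subfield)
      show "\<not> p dvd ramification_index K K"
        using assms(2) by (simp add: ramification_index_eq_1[OF K])
    qed (use char in auto)
    ultimately show ?thesis by simp
  qed
  then show ?thesis using L gen by auto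
qed

end
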